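(* There is an absolute constant $c>0$ such that the following holds. For all integers $n,m\ge 1$, if $M$ is an $n\times n$ random matrix whose entries are independent and uniformly distributed on $\{-m,-m+1,\ldots,m\}$, then $$\Pr[M \text{ is singular}] \le m^{-cn}.$$
   Context: $c$ does not depend on $n$ or $m$. *)

theory Defs
  imports "HOL-Probability.Probability_Mass_Function" "Jordan_Normal_Form.Determinant"
begin

text \<open>The sample space: all n x n integer matrices with entries in {-m,...,m}.
  Independent uniform entries = uniform distribution on this finite set.\<close>
definition bounded_int_mats :: "nat \<Rightarrow> nat \<Rightarrow> int mat set" where
  "bounded_int_mats n m = {A \<in> carrier_mat n n.
      \<forall>i<n. \<forall>j<n. A $$ (i, j) \<in> {- int m .. int m}}"

definition prob_singular :: "nat \<Rightarrow> nat \<Rightarrow> real" where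
  "prob_singular n m =
     measure_pmf.prob (pmf_of_set (bounded_int_mats n m)) {A. det A = 0}"

end

theory Submission
  imports Defs "HOL-Analysis.Analysis" "HOL-Probability.Product_PMF" "HOL-Library.Function_Algebras"
begin

text \<open>
  The proof follows the replacement argument of Kahn, Komlos and Szemeredi. If the matrix is singular,
  some row \<open>X\<^sub>k\<close> lies in the span \<open>U\<close> of the independent rows \<open>X\<^sub>0, \<dots>, X\<^sub>k\<^sub>-\<^sub>1\<close>. Compare the row \<open>X\<close> with
  a more concentrated (lazy) random vector \<open>Y\<close>. If \<open>P(X \<in> U) \<le> \<epsilon> P(Y \<in> U)\<close> for all proper subspaces \<open>U\<close>,
  then exchanging \<open>r\<close> of the basis rows for independent copies of \<open>Y\<close> gains about \<open>\<epsilon>\<^sup>r\<close> at the cost of a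
  binomial coefficient, unless \<open>P(X \<in> U)\<close> is already tiny; the latter threshold is governed by the
  largest atom of \<open>Y\<close>.

  The comparison is proved for a hyperplane orthogonal to an arbitrary real vector \<open>a \<noteq> 0\<close> by writing both
  probabilities as time averages of \<open>\<Prod>\<^sub>i \<phi>(a\<^sub>i t)\<close> and \<open>\<Prod>\<^sub>i \<psi>(a\<^sub>i t)\<close>. Where some \<open>a\<^sub>i t\<close> is far from the integers
  the gain is pointwise. Elsewhere, on a short interval the first product is dominated by a Gaussian
  in \<open>t\<close> which is much narrower than the interval, while the second product is almost constant there.

  Taking \<open>Y\<close> lazy with a fixed parameter gives an exponential bound uniformly in \<open>m\<close>. For large \<open>m\<close>, taking
  \<open>Y\<close> of width \<open>q \<approx> m\<^bsup>1/8\<^esup>\<close> that vanishes with additional probability \<open>1/q\<close> gives \<open>\<epsilon> = O(q\<^sup>-\<^sup>2)\<close> and atoms \<open>O(1/q)\<close>, so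
  that all exponential factors are absorbed.
\<close>

section \<open>Comparing products of characteristic functions\<close>

text \<open>A Lorentzian stands in for the Gaussian because its antiderivative is an arctangent: the
  bound then depends neither on the window nor on the centre \<open>c\<close>.\<close>

lemma integral_lorentz_le:
  fixes \<kappa> c u \<tau> :: real
  assumes "\<kappa> > 0" "\<tau> > 0"
  shows "integral {u..u+\<tau>} (\<lambda>s. 1 / (1 + (\<kappa> * (s - c))\<^sup>2)) \<le> pi / \<kappa>"
proof -
  have "((\<lambda>s. 1 / (1 + (\<kappa> * (s - c))\<^sup>2)) has_integral
      (arctan (\<kappa> * (u + \<tau> - c)) / \<kappa> - arctan (\<kappa> * (u - c)) / \<kappa>)) {u..u+\<tau>}"
  proof (rule fundamental_theorem_of_calculus)
    fix x assume "x \<in> {u..u+\<tau>}"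
    have "1 + (\<kappa> * (x - c))\<^sup>2 > 0" by (smt (verit) zero_le_power2)
    then have "((\<lambda>x. arctan (\<kappa> * (x - c)) / \<kappa>) has_real_derivative 1 / (1 + (\<kappa> * (x - c))\<^sup>2)) (at x within {u..u+\<tau>})"
      using assms by (auto intro!: derivative_eq_intros simp: power2_eq_square divide_inverse)
    then show "((\<lambda>x. arctan (\<kappa> * (x - c)) / \<kappa>) has_vector_derivative 1 / (1 + (\<kappa> * (x - c))\<^sup>2)) (at x within {u..u+\<tau>})"
      by (simp add: has_real_derivative_iff_has_vector_derivative)
  qed (use assms in simp)
  then have "integral {u..u+\<tau>} (\<lambda>s. 1 / (1 + (\<kappa> * (s - c))\<^sup>2)) =
     (arctan (\<kappa> * (u + \<tau> - c)) - arctan (\<kappa> * (u - c))) / \<kappa>"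
    by (simp add: integral_unique diff_divide_distrib)
  also have "\<dots> \<le> pi / \<kappa>"
    using arctan_bounded[of "\<kappa> * (u + \<tau> - c)"] arctan_bounded[of "\<kappa> * (u - c)"] assms
    by (intro divide_right_mono) auto
  finally show ?thesis .
qed

lemma exp_minus_le_inverse: "x \<ge> 0 \<Longrightarrow> exp (- x) \<le> 1 / (1 + x)" for x :: real
  using exp_ge_add_one_self[of x] by (simp add: exp_minus field_simps)

lemma periodic_diff_int:
  fixes f :: "real \<Rightarrow> real"
  assumes "\<And>x k. f (x + of_int k) = f x"
  shows "f x = f (x - of_int k)"
  using assms[of "x - of_int k" k] by simp

text \<open>The comparison uses only these properties of the two characteristic functions.
  \<open>\<alpha>\<close> separates the zone where the gain is the factor
  \<open>\<epsilon>\<^sub>0\<close> from the zone of Gaussian decay. \<open>A \<ge> 4 * D\<close>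
  lets half of the decay of \<open>\<phi>\<close> survive after paying for \<open>\<psi>\<close>,
  and \<open>\<alpha> \<le> 1/8\<close> leaves room for a move by 1/8 within the range 1/4 of
  \<open>lower\<close>.\<close>

locale charfun_pair =
  fixes \<phi> \<psi> :: "real \<Rightarrow> real" and \<alpha> A D \<epsilon>\<^sub>0 :: real
  assumes cont: "continuous_on UNIV \<phi>" "continuous_on UNIV \<psi>"
    and per: "\<And>x k. \<phi> (x + of_int k) = \<phi> x" "\<And>x k. \<psi> (x + of_int k) = \<psi> x"
    and psi_nonneg: "\<And>x. \<psi> x \<ge> 0"
    and pos: "\<alpha> > 0" "\<alpha> \<le> 1/8" "D > 0" "A \<ge> 4 * D" "0 \<le> \<epsilon>\<^sub>0" "\<epsilon>\<^sub>0 \<le> 1"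
    and far: "\<And>x. \<alpha> \<le> \<bar>x\<bar> \<Longrightarrow> \<bar>x\<bar> \<le> 1/2 \<Longrightarrow> \<bar>\<phi> x\<bar> \<le> \<epsilon>\<^sub>0 * \<psi> x"
    and near: "\<And>x. \<bar>x\<bar> \<le> \<alpha> \<Longrightarrow> \<bar>\<phi> x\<bar> \<le> exp (- A * x\<^sup>2)"
    and lower: "\<And>x. \<bar>x\<bar> \<le> 1/4 \<Longrightarrow> exp (- D * x\<^sup>2) \<le> \<psi> x"
begin

lemma dominated: "\<bar>\<phi> x\<bar> \<le> \<psi> x"
proof -
  define y where "y = x - of_int (round x)"
  have y: "\<bar>y\<bar> \<le> 1/2" unfolding y_def using of_int_round_abs_le[of x] by (simp add: abs_minus_commute)
  have "\<bar>\<phi> y\<bar> \<le> \<psi> y"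
  proof (cases "\<bar>y\<bar> \<le> \<alpha>")
    case True
    have "\<bar>\<phi> y\<bar> \<le> exp (- A * y\<^sup>2)" using near True by auto
    also have "\<dots> \<le> exp (- D * y\<^sup>2)" using pos by (auto intro!: mult_right_mono)
    also have "\<dots> \<le> \<psi> y" using lower True pos by auto
    finally show ?thesis .
  next
    case False
    then have "\<bar>\<phi> y\<bar> \<le> \<epsilon>\<^sub>0 * \<psi> y" using far y by auto
    also have "\<dots> \<le> 1 * \<psi> y" using pos psi_nonneg by (intro mult_right_mono) auto
    finally show ?thesis by simp
  qed
  then show ?thesis unfolding y_def
    using periodic_diff_int[of \<phi> x "round x"] periodic_diff_int[of \<psi> x "round x"] per by simp
qed

text \<open>A single coordinate far from the integers yields the gain
  \<open>\<epsilon>\<^sub>0\<close>; for the other factors \<open>dominated\<close> is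
  enough.\<close>

lemma prod_far:
  fixes a :: "nat \<Rightarrow> real"
  assumes "j < n" "\<bar>a j * t - of_int (round (a j * t))\<bar> \<ge> \<alpha>"
  shows "(\<Prod>i<n. \<bar>\<phi> (a i * t)\<bar>) \<le> \<epsilon>\<^sub>0 * (\<Prod>i<n. \<psi> (a i * t))"
proof -
  have "\<bar>\<phi> (a j * t)\<bar> \<le> \<epsilon>\<^sub>0 * \<psi> (a j * t)"
    using far[OF assms(2)] of_int_round_abs_le[of "a j * t"]
      periodic_diff_int[of \<phi> "a j * t" "round (a j * t)"] periodic_diff_int[of \<psi> "a j * t" "round (a j * t)"] per
    by (simp add: abs_minus_commute)
  moreover have "(\<Prod>i\<in>{..<n}-{j}. \<bar>\<phi> (a i * t)\<bar>) \<le> (\<Prod>i\<in>{..<n}-{j}. \<psi> (a i * t))"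
    using dominated by (intro prod_mono) auto
  ultimately have "\<bar>\<phi> (a j * t)\<bar> * (\<Prod>i\<in>{..<n}-{j}. \<bar>\<phi> (a i * t)\<bar>)
      \<le> (\<epsilon>\<^sub>0 * \<psi> (a j * t)) * (\<Prod>i\<in>{..<n}-{j}. \<psi> (a i * t))"
    using pos psi_nonneg by (intro mult_mono) (auto intro!: prod_nonneg)
  moreover have "{..<n} = insert j ({..<n}-{j})" using assms by auto
  ultimately show ?thesis
    using assms by (simp add: prod.remove[of "{..<n}" j] mult.assoc)
qed

lemma prod_dominated: "(\<Prod>i<n. \<bar>\<phi> (a i * t)\<bar>) \<le> (\<Prod>i<n. \<psi> (a i * t))"
  using dominated by (intro prod_mono) auto

text \<open>Since \<open>t\<close> ranges freely over points within \<open>\<tau>\<close> of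
  \<open>s\<close>, the bound can afterwards be averaged over \<open>t\<close>. Moving from
  \<open>s\<close> to \<open>t\<close> at most doubles the quadratic form and adds
  \<open>2 * (S * \<tau>\<^sup>2)\<close>, which costs the constant \<open>exp 2\<close>; the
  doubled form uses up half of the exponent \<open>A\<close>.\<close>

lemma good_pointwise:
  fixes a :: "nat \<Rightarrow> real" and N :: "nat \<Rightarrow> int"
  assumes S: "S = (\<Sum>i<n. (a i)\<^sup>2)" and \<tau>: "\<tau> > 0" "D * S * \<tau>\<^sup>2 \<le> 1"
    and M: "\<And>i. i < n \<Longrightarrow> \<bar>a i\<bar> * \<tau> \<le> 1/8"
    and st: "\<bar>t - s\<bar> \<le> \<tau>" and good: "\<And>i. i < n \<Longrightarrow> \<bar>a i * s - of_int (N i)\<bar> \<le> \<alpha>"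
  shows "(\<Prod>i<n. \<bar>\<phi> (a i * s)\<bar>) \<le>
    exp 2 * exp (- (A/2) * (\<Sum>i<n. (a i * s - of_int (N i))\<^sup>2)) * (\<Prod>i<n. \<psi> (a i * t))"
proof -
  define Q where "Q = (\<lambda>s. \<Sum>i<n. (a i * s - of_int (N i))\<^sup>2)"
  have Qnn: "Q s \<ge> 0" unfolding Q_def by (intro sum_nonneg) auto
  have "(\<Prod>i<n. \<bar>\<phi> (a i * s)\<bar>) \<le> (\<Prod>i<n. exp (- A * (a i * s - of_int (N i))\<^sup>2))"
  proof (intro prod_mono conjI)
    fix i assume "i \<in> {..<n}"
    then show "\<bar>\<phi> (a i * s)\<bar> \<le> exp (- A * (a i * s - of_int (N i))\<^sup>2)"
      using near[OF good[of i]] periodic_diff_int[of \<phi> "a i * s" "N i"] per by auto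
  qed auto
  also have "\<dots> = exp (- A * Q s)"
    unfolding Q_def by (simp add: exp_sum sum_distrib_left)
  finally have 1: "(\<Prod>i<n. \<bar>\<phi> (a i * s)\<bar>) \<le> exp (- A * Q s)" .
  have "exp (- D * Q t) = (\<Prod>i<n. exp (- D * (a i * t - of_int (N i))\<^sup>2))"
    unfolding Q_def by (simp add: exp_sum sum_distrib_left)
  also have "\<dots> \<le> (\<Prod>i<n. \<psi> (a i * t))"
  proof (intro prod_mono conjI)
    fix i assume i: "i \<in> {..<n}"
    have "\<bar>a i * t - a i * s\<bar> = \<bar>a i\<bar> * \<bar>t - s\<bar>" by (simp add: abs_mult flip: right_diff_distrib)
    also have "\<dots> \<le> \<bar>a i\<bar> * \<tau>" using st by (intro mult_left_mono) auto
    also have "\<dots> \<le> 1/8" using M i by auto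
    finally have "\<bar>a i * t - a i * s\<bar> \<le> 1/8" .
    moreover have "\<bar>a i * s - of_int (N i)\<bar> \<le> \<alpha>" using good i by auto
    ultimately have "\<bar>a i * t - of_int (N i)\<bar> \<le> 1/4" using pos(2) by linarith
    then show "exp (- D * (a i * t - of_int (N i))\<^sup>2) \<le> \<psi> (a i * t)"
      using lower[of "a i * t - of_int (N i)"] periodic_diff_int[of \<psi> "a i * t" "N i"] per by auto
  qed auto
  finally have 2: "exp (- D * Q t) \<le> (\<Prod>i<n. \<psi> (a i * t))" .
  have "Q t \<le> 2 * Q s + 2 * (S * \<tau>\<^sup>2)"
  proof -
    have "(a i * t - of_int (N i))\<^sup>2 \<le> 2 * (a i * s - of_int (N i))\<^sup>2 + 2 * ((a i)\<^sup>2 * \<tau>\<^sup>2)" for i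
    proof -
      have "(x + y)\<^sup>2 \<le> 2 * x\<^sup>2 + 2 * y\<^sup>2" for x y :: real
        using sum_squares_ge_zero[of "x-y" 0] by (simp add: power2_eq_square algebra_simps)
      from this[of "a i * s - of_int (N i)" "a i * (t - s)"]
      have "(a i * t - of_int (N i))\<^sup>2 \<le> 2 * (a i * s - of_int (N i))\<^sup>2 + 2 * (a i * (t - s))\<^sup>2"
        by (simp add: algebra_simps)
      moreover have "(t-s)\<^sup>2 \<le> \<tau>\<^sup>2" using st by (metis abs_le_square_iff abs_of_pos \<tau>(1))
      then have "(a i * (t - s))\<^sup>2 \<le> (a i)\<^sup>2 * \<tau>\<^sup>2"
        by (simp add: power_mult_distrib mult_left_mono)
      ultimately show ?thesis by linarith
    qed
    then have "Q t \<le> (\<Sum>i<n. 2 * (a i * s - of_int (N i))\<^sup>2 + 2 * ((a i)\<^sup>2 * \<tau>\<^sup>2))"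
      unfolding Q_def by (intro sum_mono) auto
    then show ?thesis unfolding Q_def S by (simp add: sum.distrib sum_distrib_left sum_distrib_right)
  qed
  then have "D * Q t \<le> D * (2 * Q s + 2 * (S * \<tau>\<^sup>2))" using pos by (intro mult_left_mono) auto
  also have "\<dots> \<le> 2 * D * Q s + 2" using \<tau> by (simp add: algebra_simps)
  also have "\<dots> \<le> (A/2) * Q s + 2" using pos Qnn mult_right_mono[of "4 * D" A "Q s"] by simp
  finally have "- A * Q s \<le> 2 + - (A/2) * Q s + - D * Q t" by simp
  then have "exp (- A * Q s) \<le> exp (2 + - (A/2) * Q s + - D * Q t)" by simp
  also have "\<dots> = exp 2 * exp (- (A/2) * Q s) * exp (- D * Q t)" by (simp only: exp_add)
  also have "\<dots> \<le> exp 2 * exp (- (A/2) * Q s) * (\<Prod>i<n. \<psi> (a i * t))"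
    using 2 by (intro mult_left_mono) auto
  finally show ?thesis using 1 unfolding Q_def by linarith
qed


text \<open>
  On an interval of length \<open>\<tau>\<close> all \<open>a i * t\<close> move by at most \<open>1/8\<close>, so the nearest integers \<open>N i\<close> are the same at all
  good points and \<open>\<Sum>i. (a i * t - N i)\<^sup>2\<close> is a quadratic polynomial in \<open>t\<close>. The Gaussian decay, or the bound
  \<open>\<bar>a j * t - N j\<bar> \<le> \<alpha>\<close> for the largest \<open>\<bar>a j\<bar>\<close>, beats \<open>\<tau>\<close>, depending on which constraint determines \<open>\<tau>\<close>.
\<close>
lemma local_comparison:
  fixes a :: "nat \<Rightarrow> real"
  assumes i0: "i0 < n" "a i0 \<noteq> 0"
    and \<epsilon>\<^sub>1: "exp 2 * (16 * pi * \<alpha>) \<le> \<epsilon>\<^sub>1" "exp 2 * (pi * sqrt (2 * D / A)) \<le> \<epsilon>\<^sub>1"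
  shows "\<exists>\<tau>>0. \<forall>u. integral {u..u+\<tau>} (\<lambda>t. \<Prod>i<n. \<bar>\<phi> (a i * t)\<bar>) \<le>
    (\<epsilon>\<^sub>0 + (1 - \<epsilon>\<^sub>0) * \<epsilon>\<^sub>1) * integral {u..u+\<tau>} (\<lambda>t. \<Prod>i<n. \<psi> (a i * t))"
proof -
  define S where "S = (\<Sum>i<n. (a i)\<^sup>2)"
  have "S \<ge> (a i0)\<^sup>2" unfolding S_def using i0 by (intro member_le_sum) auto
  then have Spos: "S > 0" using i0 by (smt (verit) zero_less_power2)
  have "Max ((\<lambda>i. \<bar>a i\<bar>) ` {..<n}) \<in> (\<lambda>i. \<bar>a i\<bar>) ` {..<n}" using i0 by (intro Max_in) auto
  then obtain j where j: "j < n" "\<bar>a j\<bar> = Max ((\<lambda>i. \<bar>a i\<bar>) ` {..<n})" by auto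
  define M where "M = \<bar>a j\<bar>"
  have Mmax: "\<bar>a i\<bar> \<le> M" if "i < n" for i using that j by (auto simp: M_def)
  have Mpos: "M > 0" using Mmax[OF i0(1)] i0(2) by auto
  \<comment> \<open>The first bound caps each move of \<open>a i * t\<close> at 1/8, the second caps
    the loss in the product of the \<open>\<psi>\<close> at a constant factor.\<close>
  define \<tau> where "\<tau> = min (1/(8*M)) (1/sqrt (D*S))"
  have \<tau>pos: "\<tau> > 0" using Mpos Spos pos by (auto simp: \<tau>_def)
  have \<tau>M: "\<bar>a i\<bar> * \<tau> \<le> 1/8" if "i < n" for i
  proof -
    have "\<bar>a i\<bar> * \<tau> \<le> M * (1/(8*M))" using Mmax[OF that] Mpos \<tau>pos by (intro mult_mono) (auto simp: \<tau>_def)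
    then show ?thesis using Mpos by simp
  qed
  have \<tau>S: "D * S * \<tau>\<^sup>2 \<le> 1"
  proof -
    have "\<tau>\<^sup>2 \<le> (1/sqrt (D*S))\<^sup>2" using \<tau>pos by (intro power_mono) (auto simp: \<tau>_def)
    also have "\<dots> = 1 / (D*S)" using pos Spos by (simp add: power_divide)
    finally show ?thesis using pos Spos by (simp add: field_simps)
  qed
  have Apos: "A > 0" using pos by linarith
  define F where "F = (\<lambda>t. \<Prod>i<n. \<bar>\<phi> (a i * t)\<bar>)"
  define G where "G = (\<lambda>t. \<Prod>i<n. \<psi> (a i * t))"
  have contF: "continuous_on X F" for X unfolding F_def
    by (intro continuous_intros continuous_on_compose2[OF cont(1)]) auto
  have contG: "continuous_on X G" for X unfolding G_def
    by (intro continuous_intros continuous_on_compose2[OF cont(2)]) auto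
  have FG: "F t \<le> G t" for t unfolding F_def G_def by (rule prod_dominated)
  have Gnn: "G t \<ge> 0" for t unfolding G_def using psi_nonneg by (intro prod_nonneg) auto
  have "integral {u..u+\<tau>} F \<le> (\<epsilon>\<^sub>0 + (1 - \<epsilon>\<^sub>0) * \<epsilon>\<^sub>1) * integral {u..u+\<tau>} G" for u
  proof -
    define IG where "IG = integral {u..u+\<tau>} G"
    have intG: "G integrable_on {u..u+\<tau>}" and intF: "F integrable_on {u..u+\<tau>}"
      using contG contF by (auto intro: integrable_continuous_real)
    have IGnn: "IG \<ge> 0" unfolding IG_def using Gnn by (intro integral_nonneg intG) auto
    \<comment> \<open>All cases are brought to one shape: a share \<open>\<epsilon>\<^sub>0\<close>
      of \<open>G\<close> plus a share \<open>1 - \<epsilon>\<^sub>0\<close> of the mean of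
      \<open>G\<close> times a multiple of a narrow Lorentzian. The integral of that multiple,
      divided by \<open>\<tau>\<close>, is at most \<open>\<epsilon>\<^sub>1\<close>.\<close>
    have "\<exists>C \<kappa> c. C \<ge> 0 \<and> \<kappa> > 0 \<and> C * (pi / \<kappa>) / \<tau> \<le> \<epsilon>\<^sub>1 \<and>
       (\<forall>s\<in>{u..u+\<tau>}. F s \<le> \<epsilon>\<^sub>0 * G s + (1 - \<epsilon>\<^sub>0) * (C * (1 / (1 + (\<kappa> * (s - c))\<^sup>2)) * (IG / \<tau>)))"
    proof (cases "\<exists>s0\<in>{u..u+\<tau>}. \<forall>i<n. \<bar>a i * s0 - of_int (round (a i * s0))\<bar> < \<alpha>")
      case False
      have "0 \<le> exp 2 * (16 * pi * \<alpha>)" using pos by auto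
      then have "0 \<le> \<epsilon>\<^sub>1" using \<epsilon>\<^sub>1 by linarith
      moreover have "F s \<le> \<epsilon>\<^sub>0 * G s" if "s \<in> {u..u+\<tau>}" for s
        using False that prod_far[of _ n a s] unfolding F_def G_def by (meson not_le)
      ultimately show ?thesis by (intro exI[of _ 0] exI[of _ 1]) auto
    next
      case True
      then obtain s0 where s0: "s0 \<in> {u..u+\<tau>}"
        "\<And>i. i < n \<Longrightarrow> \<bar>a i * s0 - of_int (round (a i * s0))\<bar> < \<alpha>" by blast
      define N where "N = (\<lambda>i. round (a i * s0))"
      define Q where "Q = (\<lambda>s. \<Sum>i<n. (a i * s - of_int (N i))\<^sup>2)"
      have good: "\<bar>a i * s - of_int (N i)\<bar> \<le> \<alpha>"
        if "i < n" "s \<in> {u..u+\<tau>}" "\<And>i. i < n \<Longrightarrow> \<bar>a i * s - of_int (round (a i * s))\<bar> < \<alpha>" for i s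
      proof -
        have "\<bar>a i * s - a i * s0\<bar> = \<bar>a i\<bar> * \<bar>s - s0\<bar>" by (simp add: abs_mult flip: right_diff_distrib)
        also have "\<dots> \<le> \<bar>a i\<bar> * \<tau>" using that s0 by (intro mult_left_mono) auto
        also have "\<dots> \<le> 1/8" using \<tau>M that by auto
        finally have "\<bar>a i * s - a i * s0\<bar> \<le> 1/8" .
        then have "\<bar>real_of_int (round (a i * s)) - of_int (N i)\<bar> < 1"
          using that(3)[OF that(1)] s0(2)[OF that(1)] pos(2) unfolding N_def by linarith
        then have "round (a i * s) = N i" by linarith
        then show ?thesis using that(3)[OF that(1)] by simp
      qed
      have key: "F s \<le> exp 2 * exp (- (A/2) * Q s) * (IG / \<tau>)"
        if s: "s \<in> {u..u+\<tau>}" "\<And>i. i < n \<Longrightarrow> \<bar>a i * s - of_int (round (a i * s))\<bar> < \<alpha>" for s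
      proof -
        have "F s \<le> exp 2 * exp (- (A/2) * Q s) * G t" if t: "t \<in> {u..u+\<tau>}" for t
          unfolding F_def G_def Q_def
          by (rule good_pointwise[OF S_def \<tau>pos \<tau>S \<tau>M]) (use t s good in auto)
        then have "integral {u..u+\<tau>} (\<lambda>t. F s) \<le> integral {u..u+\<tau>} (\<lambda>t. exp 2 * exp (- (A/2) * Q s) * G t)"
          by (intro integral_le) (auto intro: integrable_continuous_real continuous_intros contG)
        then have "\<tau> * F s \<le> exp 2 * exp (- (A/2) * Q s) * IG"
          using \<tau>pos by (simp add: IG_def)
        then show ?thesis using \<tau>pos by (simp add: field_simps)
      qed
      have "\<exists>C \<kappa> c. C \<ge> 0 \<and> \<kappa> > 0 \<and> C * (pi / \<kappa>) / \<tau> \<le> \<epsilon>\<^sub>1 \<and>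
        (\<forall>s\<in>{u..u+\<tau>}. (\<forall>i<n. \<bar>a i * s - of_int (round (a i * s))\<bar> < \<alpha>) \<longrightarrow>
           exp 2 * exp (- (A/2) * Q s) \<le> C * (1 / (1 + (\<kappa> * (s - c))\<^sup>2)))"
      proof (cases "1/(8*M) \<le> 1/sqrt (D*S)")
        case True
        then have \<tau>: "\<tau> = 1/(8*M)" by (simp add: \<tau>_def)
        \<comment> \<open>Here the Lorentzian replaces the indicator of
          \<open>\<bar>a j * s - N j\<bar> \<le> \<alpha>\<close>: centred at
          \<open>N j / a j\<close> with width \<open>\<alpha> / M\<close>, its double is at least 1
          at all good points. Against \<open>\<tau> = 1/(8*M)\<close> its mass gives
          \<open>16 * pi * \<alpha>\<close>.\<close>
        show ?thesis
        proof (intro exI conjI ballI impI)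
          show "0 \<le> 2 * exp (2::real)" "0 < M / \<alpha>" using Mpos pos by auto
          have "2 * exp 2 * (pi / (M / \<alpha>)) / \<tau> = exp 2 * (16 * pi * \<alpha>)"
            using Mpos pos by (simp add: \<tau> field_simps)
          then show "2 * exp 2 * (pi / (M / \<alpha>)) / \<tau> \<le> \<epsilon>\<^sub>1" using \<epsilon>\<^sub>1 by simp
          fix s assume s: "s \<in> {u..u+\<tau>}" "\<forall>i<n. \<bar>a i * s - of_int (round (a i * s))\<bar> < \<alpha>"
          have g: "\<bar>a j * s - of_int (N j)\<bar> \<le> \<alpha>" using good j s by auto
          have "a j \<noteq> 0" using Mpos by (auto simp: M_def)
          then have "a j * s - of_int (N j) = a j * (s - of_int (N j) / a j)" by (simp add: field_simps)
          then have "\<bar>a j * s - of_int (N j)\<bar> = M * \<bar>s - of_int (N j) / a j\<bar>" by (simp add: M_def abs_mult)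
          then have "\<bar>(M / \<alpha>) * (s - of_int (N j) / a j)\<bar> = \<bar>a j * s - of_int (N j)\<bar> / \<alpha>"
            using pos Mpos by (simp add: abs_mult)
          also have "\<dots> \<le> 1" using g pos by simp
          finally have "((M / \<alpha>) * (s - of_int (N j) / a j))\<^sup>2 \<le> 1" by (simp add: abs_square_le_1)
          have lz: "1 \<le> 2 * (1 / (1 + z))" if "0 \<le> z" "z \<le> 1" for z :: real
            using that by (simp add: field_simps)
          have "2 * (1 / (1 + ((M / \<alpha>) * (s - of_int (N j) / a j))\<^sup>2)) \<ge> 1"
            by (rule lz[OF zero_le_power2]) fact
          moreover have "exp (- (A/2) * Q s) \<le> 1" using Apos by (auto simp: Q_def intro!: mult_nonneg_nonneg sum_nonneg)
          ultimately have "exp (- (A/2) * Q s) \<le> 2 * (1 / (1 + ((M / \<alpha>) * (s - of_int (N j) / a j))\<^sup>2))" by linarith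
          then have "exp 2 * exp (- (A/2) * Q s) \<le> exp 2 * (2 * (1 / (1 + ((M / \<alpha>) * (s - of_int (N j) / a j))\<^sup>2)))"
            by (intro mult_left_mono) auto
          then show "exp 2 * exp (- (A/2) * Q s) \<le> 2 * exp 2 * (1 / (1 + ((M / \<alpha>) * (s - of_int (N j) / a j))\<^sup>2))"
            by (simp only: mult_ac)
        qed
      next
        case False
        then have \<tau>: "\<tau> = 1/sqrt (D*S)" by (simp add: \<tau>_def)
        \<comment> \<open>The vertex of the parabola \<open>Q\<close>: the linear term vanishes, so
          \<open>Q s\<close> is at least \<open>(s - c)\<^sup>2 * S\<close>.\<close>
        define c where "c = (\<Sum>i<n. a i * of_int (N i)) / S"
        show ?thesis
        proof (intro exI conjI ballI impI)
          show "0 \<le> exp (2::real)" "0 < sqrt (A * S / 2)" using Apos Spos by auto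
          have "exp 2 * (pi / sqrt (A * S / 2)) / \<tau> = exp 2 * (pi * sqrt (2 * D / A))"
            using Apos Spos pos by (simp add: \<tau> real_sqrt_divide real_sqrt_mult field_simps)
          then show "exp 2 * (pi / sqrt (A * S / 2)) / \<tau> \<le> \<epsilon>\<^sub>1" using \<epsilon>\<^sub>1 by simp
          fix s
          define T where "T = (\<Sum>i<n. (a i * c - of_int (N i))\<^sup>2)"
          have "T \<ge> 0" unfolding T_def by (intro sum_nonneg) auto
          have "(a i * s - of_int (N i))\<^sup>2 = (s - c)\<^sup>2 * (a i)\<^sup>2 + (a i * c - of_int (N i))\<^sup>2
              + 2 * (s - c) * (c * (a i)\<^sup>2 - a i * of_int (N i))" for i
            by (simp add: power2_eq_square algebra_simps)
          then have "Q s = (s - c)\<^sup>2 * S + T + 2 * (s - c) * (c * S - (\<Sum>i<n. a i * of_int (N i)))"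
            unfolding Q_def T_def S_def by (simp add: sum.distrib sum_distrib_left sum_subtractf right_diff_distrib)
          also have "c * S - (\<Sum>i<n. a i * of_int (N i)) = 0" using Spos by (simp add: c_def)
          finally have "Q s \<ge> (s - c)\<^sup>2 * S" using \<open>T \<ge> 0\<close> by simp
          then have "(A/2) * ((s - c)\<^sup>2 * S) \<le> (A/2) * Q s" using Apos by (intro mult_left_mono) auto
          moreover have "(A/2) * ((s - c)\<^sup>2 * S) = (sqrt (A * S / 2) * (s - c))\<^sup>2"
            using Apos Spos by (simp add: power_mult_distrib)
          ultimately have "exp (- (A/2) * Q s) \<le> exp (- (sqrt (A * S / 2) * (s - c))\<^sup>2)" by simp
          also have "\<dots> \<le> 1 / (1 + (sqrt (A * S / 2) * (s - c))\<^sup>2)" by (intro exp_minus_le_inverse) auto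
          finally show "exp 2 * exp (- (A/2) * Q s) \<le> exp 2 * (1 / (1 + (sqrt (A * S / 2) * (s - c))\<^sup>2))"
            by (intro mult_left_mono) auto
        qed
      qed
      then obtain C \<kappa> c where C: "C \<ge> 0" "\<kappa> > 0" "C * (pi / \<kappa>) / \<tau> \<le> \<epsilon>\<^sub>1"
        "\<And>s. s \<in> {u..u+\<tau>} \<Longrightarrow> (\<forall>i<n. \<bar>a i * s - of_int (round (a i * s))\<bar> < \<alpha>) \<Longrightarrow>
           exp 2 * exp (- (A/2) * Q s) \<le> C * (1 / (1 + (\<kappa> * (s - c))\<^sup>2))" by blast
      have "F s \<le> \<epsilon>\<^sub>0 * G s + (1 - \<epsilon>\<^sub>0) * (C * (1 / (1 + (\<kappa> * (s - c))\<^sup>2)) * (IG / \<tau>))"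
        if s: "s \<in> {u..u+\<tau>}" for s
      proof (cases "\<forall>i<n. \<bar>a i * s - of_int (round (a i * s))\<bar> < \<alpha>")
        case True
        have "F s \<le> exp 2 * exp (- (A/2) * Q s) * (IG / \<tau>)" using key s True by auto
        also have "\<dots> \<le> C * (1 / (1 + (\<kappa> * (s - c))\<^sup>2)) * (IG / \<tau>)"
          using C(4)[OF s True] IGnn \<tau>pos by (intro mult_right_mono) auto
        \<comment> \<open>Only the share \<open>1 - \<epsilon>\<^sub>0\<close> uses the decay; the
          rest is charged to \<open>FG\<close>, so that good and far points obey the same
          bound.\<close>
        finally have "(1 - \<epsilon>\<^sub>0) * F s \<le> (1 - \<epsilon>\<^sub>0) * (C * (1 / (1 + (\<kappa> * (s - c))\<^sup>2)) * (IG / \<tau>))"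
          using pos by (intro mult_left_mono) auto
        moreover have "\<epsilon>\<^sub>0 * F s \<le> \<epsilon>\<^sub>0 * G s" using pos FG by (intro mult_left_mono) auto
        ultimately show ?thesis by (simp add: algebra_simps)
      next
        case False
        then have "F s \<le> \<epsilon>\<^sub>0 * G s" using prod_far[of _ n a s] unfolding F_def G_def by (meson not_le)
        moreover have "0 \<le> (1 - \<epsilon>\<^sub>0) * (C * (1 / (1 + (\<kappa> * (s - c))\<^sup>2)) * (IG / \<tau>))"
          using pos C IGnn \<tau>pos by (intro mult_nonneg_nonneg) auto
        ultimately show ?thesis by linarith
      qed
      then show ?thesis using C by blast
    qed
    then obtain C \<kappa> c where C: "C \<ge> 0" "\<kappa> > 0" "C * (pi / \<kappa>) / \<tau> \<le> \<epsilon>\<^sub>1"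
      "\<And>s. s \<in> {u..u+\<tau>} \<Longrightarrow> F s \<le> \<epsilon>\<^sub>0 * G s + (1 - \<epsilon>\<^sub>0) * (C * (1 / (1 + (\<kappa> * (s - c))\<^sup>2)) * (IG / \<tau>))"
      by blast
    define L where "L = (\<lambda>s. 1 / (1 + (\<kappa> * (s - c))\<^sup>2))"
    have contL: "continuous_on X L" for X unfolding L_def
      by (intro continuous_intros) (smt (verit) zero_le_power2)
    then have intL: "L integrable_on {u..u+\<tau>}" by (auto intro: integrable_continuous_real)
    define K where "K = (1 - \<epsilon>\<^sub>0) * C * (IG / \<tau>)"
    have "integral {u..u+\<tau>} F \<le> integral {u..u+\<tau>} (\<lambda>s. \<epsilon>\<^sub>0 * G s + K * L s)"
    proof (rule integral_le[OF intF])
      show "(\<lambda>s. \<epsilon>\<^sub>0 * G s + K * L s) integrable_on {u..u+\<tau>}"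
        by (intro integrable_continuous_real continuous_intros contG contL)
      fix s assume "s \<in> {u..u+\<tau>}"
      from C(4)[OF this] show "F s \<le> \<epsilon>\<^sub>0 * G s + K * L s" by (simp add: K_def L_def mult_ac)
    qed
    also have "\<dots> = \<epsilon>\<^sub>0 * IG + K * integral {u..u+\<tau>} L"
    proof -
      have "(\<lambda>s. \<epsilon>\<^sub>0 * G s) integrable_on {u..u+\<tau>}" "(\<lambda>s. K * L s) integrable_on {u..u+\<tau>}"
        by (intro integrable_continuous_real continuous_intros contG contL)+
      then show ?thesis by (simp add: integral_add IG_def)
    qed
    also have "\<dots> \<le> \<epsilon>\<^sub>0 * IG + K * (pi / \<kappa>)"
      using integral_lorentz_le[OF C(2) \<tau>pos, of u c] pos C(1) IGnn \<tau>pos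
      by (intro add_left_mono mult_left_mono) (auto simp: L_def K_def)
    also have "K * (pi / \<kappa>) = ((1 - \<epsilon>\<^sub>0) * IG) * (C * (pi / \<kappa>) / \<tau>)" by (simp add: K_def mult_ac)
    also have "\<dots> \<le> ((1 - \<epsilon>\<^sub>0) * IG) * \<epsilon>\<^sub>1" using C(3) pos IGnn by (intro mult_left_mono) auto
    finally show ?thesis by (simp add: IG_def algebra_simps)
  qed
  then show ?thesis using \<tau>pos unfolding F_def G_def by blast
qed

end

section \<open>Hyperplane probabilities as time averages\<close>

lemma expectation_finite:
  fixes f :: "_ \<Rightarrow> real"
  assumes "finite (set_pmf p)"
  shows "measure_pmf.expectation p f = (\<Sum>x\<in>set_pmf p. pmf p x * f x)"
  using integral_measure_pmf[of "set_pmf p" p f] assms by simp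

lemma expectation_pair:
  fixes f :: "_ \<Rightarrow> real"
  assumes "finite (set_pmf p)" "finite (set_pmf q)"
  shows "measure_pmf.expectation (pair_pmf p q) f =
    measure_pmf.expectation p (\<lambda>x. measure_pmf.expectation q (\<lambda>y. f (x, y)))"
  using assms
  by (simp add: expectation_finite sum.cartesian_product' pmf_pair sum_distrib_left mult_ac split: prod.splits)

text \<open>For symmetric laws this is the full characteristic function; the factor
  \<open>2 * pi\<close> gives period 1 when the support is integral.\<close>

definition cosf :: "real pmf \<Rightarrow> real \<Rightarrow> real" where
  "cosf p t = measure_pmf.expectation p (\<lambda>x. cos (2 * pi * t * x))"

lemma cosf_eq_sum:
  "finite (set_pmf p) \<Longrightarrow> cosf p t = (\<Sum>x\<in>set_pmf p. pmf p x * cos (2 * pi * t * x))"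
  unfolding cosf_def by (rule expectation_finite)

lemma continuous_on_cosf: "finite (set_pmf p) \<Longrightarrow> continuous_on X (cosf p)"
  by (subst continuous_on_cong[OF refl cosf_eq_sum]) (auto intro!: continuous_intros)

lemma cosf_add_int:
  assumes "finite (set_pmf p)" "set_pmf p \<subseteq> \<int>"
  shows "cosf p (t + of_int k) = cosf p t"
  unfolding cosf_eq_sum[OF assms(1)]
proof (intro sum.cong refl)
  fix x assume "x \<in> set_pmf p"
  then obtain j where j: "x = of_int j" using assms by (auto elim: Ints_cases)
  have "2 * pi * (t + of_int k) * x = 2 * pi * t * x + 2 * pi * of_int (k * j)"
    by (simp add: j algebra_simps)
  then have "cos (2 * pi * (t + of_int k) * x) = cos (2 * pi * t * x)"
    by (simp only: cos_add cos_int_2pin sin_int_2pin)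
  then show "pmf p x * cos (2 * pi * (t + of_int k) * x) = pmf p x * cos (2 * pi * t * x)" by simp
qed

definition symmetric_pmf :: "real pmf \<Rightarrow> bool" where
  "symmetric_pmf p \<longleftrightarrow> map_pmf uminus p = p"

lemma symmetric_sin:
  assumes "symmetric_pmf p"
  shows "measure_pmf.expectation p (\<lambda>x. sin (c * x)) = 0"
proof -
  have "measure_pmf.expectation p (\<lambda>x. sin (c * x)) = measure_pmf.expectation (map_pmf uminus p) (\<lambda>x. sin (c * x))"
    using assms by (simp add: symmetric_pmf_def)
  also have "\<dots> = measure_pmf.expectation p (\<lambda>x. - sin (c * x))" by (subst integral_map_pmf) simp
  also have "\<dots> = - measure_pmf.expectation p (\<lambda>x. sin (c * x))" by simp
  finally show ?thesis by linarith
qed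

lemma finite_set_Pi_pmf:
  assumes "finite A" "finite (set_pmf p)"
  shows "finite (set_pmf (Pi_pmf A d (\<lambda>_. p)))"
  using assms by (subst set_Pi_pmf) auto

text \<open>The addition theorem splits off one coordinate, and symmetry kills the product of
  sines.\<close>

lemma expectation_cos_Pi:
  assumes "finite A" "finite (set_pmf p)" "symmetric_pmf p"
  shows "measure_pmf.expectation (Pi_pmf A 0 (\<lambda>_. p)) (\<lambda>x. cos (2 * pi * t * (\<Sum>i\<in>A. a i * x i))) =
    (\<Prod>i\<in>A. cosf p (a i * t))"
  using assms(1)
proof induction
  case empty
  then show ?case by simp
next
  case (insert j A)
  let ?Q = "Pi_pmf A 0 (\<lambda>_. p)"
  have fin: "finite (set_pmf ?Q)" using insert assms by (intro finite_set_Pi_pmf) auto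
  have "measure_pmf.expectation (Pi_pmf (insert j A) 0 (\<lambda>_. p)) (\<lambda>x. cos (2 * pi * t * (\<Sum>i\<in>insert j A. a i * x i)))
    = measure_pmf.expectation (pair_pmf p ?Q) (\<lambda>(y, f). cos (2 * pi * t * (\<Sum>i\<in>insert j A. a i * (f(j := y)) i)))"
    using insert by (subst Pi_pmf_insert) (auto simp: case_prod_unfold)
  also have "\<dots> = measure_pmf.expectation p (\<lambda>y. measure_pmf.expectation ?Q
      (\<lambda>f. cos (2 * pi * t * (\<Sum>i\<in>insert j A. a i * (f(j := y)) i))))"
    by (subst expectation_pair[OF assms(2) fin]) simp
  also have "\<dots> = measure_pmf.expectation p (\<lambda>y. measure_pmf.expectation ?Q
      (\<lambda>f. cos (2 * pi * (a j * t) * y) * cos (2 * pi * t * (\<Sum>i\<in>A. a i * f i)) -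
           sin (2 * pi * (a j * t) * y) * sin (2 * pi * t * (\<Sum>i\<in>A. a i * f i))))"
  proof (intro arg_cong[of _ _ "measure_pmf.expectation _"] ext)
    fix y f
    have "(\<Sum>i\<in>insert j A. a i * (f(j := y)) i) = a j * y + (\<Sum>i\<in>A. a i * f i)"
      using insert by (auto intro!: sum.cong)
    then have "2 * pi * t * (\<Sum>i\<in>insert j A. a i * (f(j := y)) i) = 2 * pi * (a j * t) * y + 2 * pi * t * (\<Sum>i\<in>A. a i * f i)"
      by (simp add: algebra_simps)
    then show "cos (2 * pi * t * (\<Sum>i\<in>insert j A. a i * (f(j := y)) i)) =
      cos (2 * pi * (a j * t) * y) * cos (2 * pi * t * (\<Sum>i\<in>A. a i * f i)) -
           sin (2 * pi * (a j * t) * y) * sin (2 * pi * t * (\<Sum>i\<in>A. a i * f i))"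
      by (simp only: cos_add)
  qed
  also have "\<dots> = measure_pmf.expectation p (\<lambda>y.
      cos (2 * pi * (a j * t) * y) * measure_pmf.expectation ?Q (\<lambda>f. cos (2 * pi * t * (\<Sum>i\<in>A. a i * f i))) -
      sin (2 * pi * (a j * t) * y) * measure_pmf.expectation ?Q (\<lambda>f. sin (2 * pi * t * (\<Sum>i\<in>A. a i * f i))))"
    by (subst Bochner_Integration.integral_diff) (auto intro!: integrable_measure_pmf_finite fin)
  also have "\<dots> = cosf p (a j * t) * measure_pmf.expectation ?Q (\<lambda>f. cos (2 * pi * t * (\<Sum>i\<in>A. a i * f i)))"
    by (subst Bochner_Integration.integral_diff)
       (auto intro!: integrable_measure_pmf_finite assms simp: symmetric_sin[OF assms(3)] cosf_def)
  finally show ?case using insert by simp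
qed

section \<open>Time averages of cosine sums\<close>

lemma integral_cos_scale:
  fixes c T :: real assumes "c \<noteq> 0" "T \<ge> 0"
  shows "integral {0..T} (\<lambda>t. cos (c * t)) = sin (c * T) / c"
proof -
  have "((\<lambda>t. cos (c * t)) has_integral (sin (c * T) / c - sin (c * 0) / c)) {0..T}"
  proof (rule fundamental_theorem_of_calculus)
    fix x assume "x \<in> {0..T}"
    have "((\<lambda>x. sin (c * x) / c) has_real_derivative cos (c * x)) (at x within {0..T})"
      using assms by (auto intro!: derivative_eq_intros)
    then show "((\<lambda>x. sin (c * x) / c) has_vector_derivative cos (c * x)) (at x within {0..T})"
      by (simp add: has_real_derivative_iff_has_vector_derivative)
  qed (use assms in auto)
  then show ?thesis by (simp add: integral_unique)
qed

text \<open>An outcome with \<open>s x = 0\<close> has integral exactly \<open>T\<close>; all others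
  oscillate and have bounded integrals. Finiteness of the support makes the error uniform in
  \<open>T\<close>.\<close>

lemma time_average_cos:
  fixes s :: "'a \<Rightarrow> real"
  assumes "finite (set_pmf q)"
  shows "\<exists>C. \<forall>T\<ge>0. \<bar>integral {0..T} (\<lambda>t. measure_pmf.expectation q (\<lambda>x. cos (2 * pi * t * s x)))
      - T * measure_pmf.prob q {x. s x = 0}\<bar> \<le> C"
proof (intro exI allI impI)
  fix T :: real assume T: "T \<ge> 0"
  define I where "I = (\<lambda>x. integral {0..T} (\<lambda>t. cos (2 * pi * t * s x)))"
  have "integral {0..T} (\<lambda>t. measure_pmf.expectation q (\<lambda>x. cos (2 * pi * t * s x))) =
    integral {0..T} (\<lambda>t. \<Sum>x\<in>set_pmf q. pmf q x * cos (2 * pi * t * s x))"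
    by (simp add: expectation_finite assms)
  also have "\<dots> = (\<Sum>x\<in>set_pmf q. pmf q x * I x)"
    unfolding I_def using assms
    by (subst integral_sum) (auto intro!: integrable_continuous_real continuous_intros)
  finally have 1: "integral {0..T} (\<lambda>t. measure_pmf.expectation q (\<lambda>x. cos (2 * pi * t * s x))) =
      (\<Sum>x\<in>set_pmf q. pmf q x * I x)" .
  have "measure_pmf.prob q {x. s x = 0} = measure_pmf.expectation q (indicator {x. s x = 0})" by simp
  also have "\<dots> = (\<Sum>x\<in>set_pmf q. pmf q x * indicator {x. s x = 0} x)"
    by (rule expectation_finite[OF assms])
  finally have 2: "T * measure_pmf.prob q {x. s x = 0} = (\<Sum>x\<in>set_pmf q. pmf q x * (T * indicator {x. s x = 0} x))"
    by (simp add: sum_distrib_left mult_ac)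
  have "\<bar>(\<Sum>x\<in>set_pmf q. pmf q x * I x) - (\<Sum>x\<in>set_pmf q. pmf q x * (T * indicator {x. s x = 0} x))\<bar>
    = \<bar>\<Sum>x\<in>set_pmf q. pmf q x * (I x - T * indicator {x. s x = 0} x)\<bar>"
    by (simp add: sum_subtractf right_diff_distrib)
  \<comment> \<open>For \<open>s x = 0\<close> the right-hand summand is \<open>1 / 0 = 0\<close>,
    in agreement with the vanishing difference on the left.\<close>
  also have "\<dots> \<le> (\<Sum>x\<in>set_pmf q. 1 * (1 / \<bar>2 * pi * s x\<bar>))"
  proof (rule order_trans[OF sum_abs sum_mono])
    fix x assume "x \<in> set_pmf q"
    have "\<bar>I x - T * indicator {x. s x = 0} x\<bar> \<le> 1 / \<bar>2 * pi * s x\<bar>"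
    proof (cases "s x = 0")
      case True
      then show ?thesis using T by (simp add: I_def)
    next
      case False
      have "I x = integral {0..T} (\<lambda>t. cos ((2 * pi * s x) * t))" unfolding I_def by (simp add: mult_ac)
      also have "\<dots> = sin (2 * pi * s x * T) / (2 * pi * s x)"
        using False T by (intro integral_cos_scale) auto
      finally have "\<bar>I x\<bar> = \<bar>sin (2 * pi * s x * T)\<bar> / \<bar>2 * pi * s x\<bar>" by (simp add: abs_divide)
      also have "\<dots> \<le> 1 / \<bar>2 * pi * s x\<bar>" by (intro divide_right_mono) auto
      finally show ?thesis using False by simp
    qed
    then show "\<bar>pmf q x * (I x - T * indicator {x. s x = 0} x)\<bar> \<le> 1 * (1 / \<bar>2 * pi * s x\<bar>)"
      unfolding abs_mult by (intro mult_mono) (auto simp: pmf_le_1)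
  qed
  finally show "\<bar>integral {0..T} (\<lambda>t. measure_pmf.expectation q (\<lambda>x. cos (2 * pi * t * s x)))
      - T * measure_pmf.prob q {x. s x = 0}\<bar> \<le> (\<Sum>x\<in>set_pmf q. 1 * (1 / \<bar>2 * pi * s x\<bar>))"
    unfolding 1 2 .
qed

text \<open>Vectors are functions on all naturals that vanish from index \<open>n\<close> on, so
  that the linear algebra takes place in one type for every \<open>n\<close>.\<close>

definition iid_vec :: "nat \<Rightarrow> real pmf \<Rightarrow> (nat \<Rightarrow> real) pmf" where
  "iid_vec n p = Pi_pmf {..<n} 0 (\<lambda>_. p)"

lemma integral_multiples_le:
  fixes f g :: "real \<Rightarrow> real"
  assumes "\<tau> > 0" "\<And>X. continuous_on X f" "\<And>X. continuous_on X g"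
    "\<And>u. integral {u..u+\<tau>} f \<le> \<epsilon> * integral {u..u+\<tau>} g"
  shows "integral {0..real N * \<tau>} f \<le> \<epsilon> * integral {0..real N * \<tau>} g"
proof (induction N)
  case (Suc N)
  have "integral {0..real N * \<tau>} h + integral {real N * \<tau>..real N * \<tau> + \<tau>} h = integral {0..real (Suc N) * \<tau>} h"
    if "\<And>X. continuous_on X h" for h :: "real \<Rightarrow> real"
    using Henstock_Kurzweil_Integration.integral_combine[of 0 "real N * \<tau>" "real N * \<tau> + \<tau>" h] that assms(1)
    by (auto simp: algebra_simps intro: integrable_continuous_real)
  note split = this
  have "integral {0..real (Suc N) * \<tau>} f \<le> \<epsilon> * integral {0..real N * \<tau>} g
      + \<epsilon> * integral {real N * \<tau>..real N * \<tau> + \<tau>} g"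
    using Suc split[of f, OF assms(2)] assms(4)[of "real N * \<tau>"] by linarith
  also have "\<dots> = \<epsilon> * integral {0..real (Suc N) * \<tau>} g"
    by (simp only: split[of g, OF assms(3), symmetric] distrib_left)
  finally show ?case .
qed auto

text \<open>The windows of \<open>local_comparison\<close> tile an interval of length
  \<open>N * \<tau>\<close>. Over it each integral differs from its length times the probability by
  a bounded error, which becomes negligible as \<open>N\<close> grows.\<close>

lemma hyperplane_comparison:
  fixes a :: "nat \<Rightarrow> real"
  assumes "finite (set_pmf p)" "finite (set_pmf q)" "symmetric_pmf p" "symmetric_pmf q"
    and cp: "charfun_pair (cosf p) (cosf q) \<alpha> A D \<epsilon>\<^sub>0"
    and i0: "i0 < n" "a i0 \<noteq> 0"
    and \<epsilon>\<^sub>1: "exp 2 * (16 * pi * \<alpha>) \<le> \<epsilon>\<^sub>1" "exp 2 * (pi * sqrt (2 * D / A)) \<le> \<epsilon>\<^sub>1"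
  shows "measure_pmf.prob (iid_vec n p) {x. (\<Sum>i<n. a i * x i) = 0} \<le>
    (\<epsilon>\<^sub>0 + (1 - \<epsilon>\<^sub>0) * \<epsilon>\<^sub>1) * measure_pmf.prob (iid_vec n q) {x. (\<Sum>i<n. a i * x i) = 0}"
proof -
  interpret charfun_pair "cosf p" "cosf q" \<alpha> A D \<epsilon>\<^sub>0 by (fact cp)
  define \<epsilon> where "\<epsilon> = \<epsilon>\<^sub>0 + (1 - \<epsilon>\<^sub>0) * \<epsilon>\<^sub>1"
  have "0 \<le> exp 2 * (16 * pi * \<alpha>)" using pos by auto
  then have "\<epsilon>\<^sub>1 \<ge> 0" using \<epsilon>\<^sub>1 by linarith
  then have "\<epsilon> \<ge> 0" using pos by (simp add: \<epsilon>_def)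
  obtain \<tau> where \<tau>: "\<tau> > 0" "\<And>u. integral {u..u+\<tau>} (\<lambda>t. \<Prod>i<n. \<bar>cosf p (a i * t)\<bar>) \<le>
    \<epsilon> * integral {u..u+\<tau>} (\<lambda>t. \<Prod>i<n. cosf q (a i * t))"
    using local_comparison[of i0 n a \<epsilon>\<^sub>1, OF i0 \<epsilon>\<^sub>1] unfolding \<epsilon>_def by blast
  define P where "P = (\<lambda>p. measure_pmf.prob (iid_vec n p) {x. (\<Sum>i<n. a i * x i) = 0})"
  have *: "\<exists>C. \<forall>T\<ge>0. \<bar>integral {0..T} (\<lambda>t. \<Prod>i<n. cosf p (a i * t)) - T * P p\<bar> \<le> C"
    if "finite (set_pmf p)" "symmetric_pmf p" for p
    using time_average_cos[of "iid_vec n p" "\<lambda>x. \<Sum>i<n. a i * x i"] that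
      expectation_cos_Pi[of "{..<n}" p]
    by (simp add: iid_vec_def P_def finite_set_Pi_pmf)
  from *[OF assms(1,3)] obtain C1 where C1: "\<And>T. T \<ge> 0 \<Longrightarrow> \<bar>integral {0..T} (\<lambda>t. \<Prod>i<n. cosf p (a i * t)) - T * P p\<bar> \<le> C1" by blast
  from *[OF assms(2,4)] obtain C2 where C2: "\<And>T. T \<ge> 0 \<Longrightarrow> \<bar>integral {0..T} (\<lambda>t. \<Prod>i<n. cosf q (a i * t)) - T * P q\<bar> \<le> C2" by blast
  have cont: "continuous_on X (\<lambda>t. cosf p (a i * t))" if "finite (set_pmf p)" for p i X
    by (rule continuous_on_compose2[OF continuous_on_cosf[OF that, of UNIV]]) (auto intro!: continuous_intros)
  have cF: "continuous_on X (\<lambda>t. \<Prod>i<n. \<bar>cosf p (a i * t)\<bar>)" for X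
    using assms by (intro continuous_intros cont) auto
  have cF': "continuous_on X (\<lambda>t. \<Prod>i<n. cosf p (a i * t))" for X
    using assms by (intro continuous_intros cont) auto
  have cG: "continuous_on X (\<lambda>t. \<Prod>i<n. cosf q (a i * t))" for X
    using assms by (intro continuous_intros cont) auto
  have bound: "real N * (\<tau> * (P p - \<epsilon> * P q)) \<le> C1 + \<epsilon> * C2" for N
  proof -
    let ?T = "real N * \<tau>"
    have "?T * P p - C1 \<le> integral {0..?T} (\<lambda>t. \<Prod>i<n. cosf p (a i * t))"
      using C1[of ?T] \<tau>(1) by auto
    also have "\<dots> \<le> integral {0..?T} (\<lambda>t. \<Prod>i<n. \<bar>cosf p (a i * t)\<bar>)"
      by (intro integral_le integrable_continuous_real cF cF') (simp flip: abs_prod)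
    also have "\<dots> \<le> \<epsilon> * integral {0..?T} (\<lambda>t. \<Prod>i<n. cosf q (a i * t))"
      by (rule integral_multiples_le[OF \<tau>(1) cF cG \<tau>(2)])
    also have "\<dots> \<le> \<epsilon> * (?T * P q + C2)"
      using C2[of ?T] \<tau>(1) \<open>\<epsilon> \<ge> 0\<close> by (intro mult_left_mono) auto
    finally show ?thesis by (simp add: algebra_simps)
  qed
  have "P p - \<epsilon> * P q \<le> 0"
  proof (rule ccontr)
    assume "\<not> ?thesis"
    then have "\<tau> * (P p - \<epsilon> * P q) > 0" using \<tau> by auto
    then obtain N where "real N * (\<tau> * (P p - \<epsilon> * P q)) > C1 + \<epsilon> * C2"
      using reals_Archimedean3 by blast
    with bound[of N] show False by simp
  qed
  then show ?thesis by (simp add: P_def \<epsilon>_def)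
qed

section \<open>The exchange argument\<close>

lemma prob_eq_expectation: "measure_pmf.prob p {x. R x} = measure_pmf.expectation p (\<lambda>x. of_bool (R x))"
proof -
  have "measure_pmf.prob p {x. R x} = measure_pmf.expectation p (indicator {x. R x})" by simp
  also have "indicator {x. R x} = (\<lambda>x. of_bool (R x) :: real)" by (auto simp: indicator_def)
  finally show ?thesis .
qed

lemma expectation_mono_supp:
  fixes f g :: "_ \<Rightarrow> real"
  assumes "finite (set_pmf p)" "\<And>x. x \<in> set_pmf p \<Longrightarrow> f x \<le> g x"
  shows "measure_pmf.expectation p f \<le> measure_pmf.expectation p g"
  using assms by (auto simp: expectation_finite intro!: sum_mono mult_left_mono)

lemma expectation_le_const:
  fixes f :: "_ \<Rightarrow> real"
  assumes "finite (set_pmf p)" "\<And>x. x \<in> set_pmf p \<Longrightarrow> f x \<le> c"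
  shows "measure_pmf.expectation p f \<le> c"
  using expectation_mono_supp[OF assms(1), of f "\<lambda>_. c"] assms(2) by simp

lemma expectation_Pi_union:
  fixes h :: "_ \<Rightarrow> real"
  assumes "finite A" "finite B" "A \<inter> B = {}" "finite (set_pmf p)"
  shows "measure_pmf.expectation (Pi_pmf (A \<union> B) d (\<lambda>_. p)) h =
    measure_pmf.expectation (Pi_pmf A d (\<lambda>_. p)) (\<lambda>f. measure_pmf.expectation (Pi_pmf B d (\<lambda>_. p))
      (\<lambda>g. h (\<lambda>x. if x \<in> A then f x else g x)))"
  using assms by (subst Pi_pmf_union)
    (auto simp: expectation_pair finite_set_Pi_pmf case_prod_unfold cong: if_cong)

lemma expectation_Pi_Suc:
  fixes h :: "_ \<Rightarrow> real"
  assumes "finite (set_pmf p)"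
  shows "measure_pmf.expectation (Pi_pmf {..<Suc k} d (\<lambda>_. p)) h =
    measure_pmf.expectation (Pi_pmf {..<k} d (\<lambda>_. p)) (\<lambda>f. measure_pmf.expectation p (\<lambda>y. h (f(k := y))))"
proof -
  let ?Q = "Pi_pmf {..<k} d (\<lambda>_. p)"
  have "measure_pmf.expectation (Pi_pmf {..<Suc k} d (\<lambda>_. p)) h =
     measure_pmf.expectation (pair_pmf p ?Q) (\<lambda>(y, f). h (f(k := y)))"
    unfolding lessThan_Suc by (subst Pi_pmf_insert) (auto simp: case_prod_unfold)
  also have "\<dots> = measure_pmf.expectation (pair_pmf ?Q p) (\<lambda>(f, y). h (f(k := y)))"
    by (subst pair_commute_pmf) (auto simp: case_prod_unfold)
  finally show ?thesis using assms by (simp add: expectation_pair finite_set_Pi_pmf)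
qed

lemma set_Pi_pmfD: "x \<in> set_pmf (Pi_pmf A d (\<lambda>_. p)) \<Longrightarrow> finite A \<Longrightarrow> i \<in> A \<Longrightarrow> x i \<in> set_pmf p"
  by (auto simp: set_Pi_pmf PiE_dflt_def)

text \<open>A separate locale, since definitions made in \<open>vector_space\<close> would clash with its interpretation for real vector spaces.\<close>
locale row_space = vector_space scale
  for scale :: "'a::field \<Rightarrow> 'b::ab_group_add \<Rightarrow> 'b"
begin

text \<open>Independence of a family rather than of a set: injectivity makes a repeated row count as
  dependent.\<close>

definition indep_upto :: "(nat \<Rightarrow> 'b) \<Rightarrow> nat \<Rightarrow> bool" where
  "indep_upto X k \<longleftrightarrow> inj_on X {..<k} \<and> \<not> dependent (X ` {..<k})"

lemma indep_upto_0 [simp]: "indep_upto X 0"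
  by (simp add: indep_upto_def independent_empty)

lemma indep_upto_Suc: "indep_upto X (Suc k) \<longleftrightarrow> indep_upto X k \<and> X k \<notin> span (X ` {..<k})"
  unfolding indep_upto_def lessThan_Suc
  by (auto simp: independent_insert span_base)

lemma indep_upto_cong: "(\<And>i. i < k \<Longrightarrow> X i = Y i) \<Longrightarrow> indep_upto X k = indep_upto Y k"
proof -
  assume *: "\<And>i. i < k \<Longrightarrow> X i = Y i"
  then have "X ` {..<k} = Y ` {..<k}" "inj_on X {..<k} = inj_on Y {..<k}"
    by (auto intro!: image_cong inj_on_cong)
  then show ?thesis by (simp add: indep_upto_def)
qed

text \<open>The probability that, among independent samples, index \<open>k\<close> is the first
  whose vector lies in the span of its predecessors; vector \<open>k\<close> itself is already
  integrated out.\<close>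

definition dep_prob :: "'b pmf \<Rightarrow> nat \<Rightarrow> real" where
  "dep_prob P k = measure_pmf.expectation (Pi_pmf {..<k} 0 (\<lambda>_. P))
     (\<lambda>X. of_bool (indep_upto X k) * measure_pmf.prob P (span (X ` {..<k})))"

text \<open>A dependent family has a first vector in the span of its predecessors; the union bound
  runs over its index.\<close>

lemma prob_dependent_le:
  assumes "finite (set_pmf P)"
  shows "measure_pmf.prob (Pi_pmf {..<n} 0 (\<lambda>_. P)) {X. \<not> indep_upto X n} \<le> (\<Sum>k<n. dep_prob P k)"
proof (induction n)
  case 0
  then show ?case by simp
next
  case (Suc n)
  let ?Q = "Pi_pmf {..<n} 0 (\<lambda>_. P)"
  have fin: "finite (set_pmf ?Q)" using assms by (intro finite_set_Pi_pmf) auto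
  have "measure_pmf.prob (Pi_pmf {..<Suc n} 0 (\<lambda>_. P)) {X. \<not> indep_upto X (Suc n)} =
    measure_pmf.expectation ?Q (\<lambda>f. measure_pmf.expectation P (\<lambda>y. of_bool (\<not> indep_upto (f(n := y)) (Suc n))))"
    by (simp add: prob_eq_expectation expectation_Pi_Suc[OF assms])
  also have "\<dots> \<le> measure_pmf.expectation ?Q (\<lambda>f. of_bool (\<not> indep_upto f n) +
      of_bool (indep_upto f n) * measure_pmf.prob P (span (f ` {..<n})))"
  proof (rule expectation_mono_supp[OF fin])
    fix f
    have 1: "indep_upto (f(n := y)) (Suc n) \<longleftrightarrow> indep_upto f n \<and> y \<notin> span (f ` {..<n})" for y
    proof -
      have "(f(n := y)) ` {..<n} = f ` {..<n}" by (auto intro!: image_cong)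
      moreover have "indep_upto (f(n := y)) n = indep_upto f n" by (rule indep_upto_cong) auto
      ultimately show ?thesis by (simp add: indep_upto_Suc)
    qed
    show "measure_pmf.expectation P (\<lambda>y. of_bool (\<not> indep_upto (f(n := y)) (Suc n)))
      \<le> of_bool (\<not> indep_upto f n) + of_bool (indep_upto f n) * measure_pmf.prob P (span (f ` {..<n}))"
      using prob_eq_expectation[of P "\<lambda>y. y \<in> span (f ` {..<n})"] by (cases "indep_upto f n") (auto simp: 1)
  qed
  also have "\<dots> = measure_pmf.prob ?Q {X. \<not> indep_upto X n} + dep_prob P n"
    unfolding dep_prob_def prob_eq_expectation
    by (subst Bochner_Integration.integral_add) (auto intro!: integrable_measure_pmf_finite fin)
  finally show ?case using Suc by simp
qed

lemma dep_prob_le: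
  assumes "finite (set_pmf P)" "c \<ge> 0"
    "\<And>B. finite B \<Longrightarrow> card B \<le> k \<Longrightarrow> B \<subseteq> set_pmf P \<Longrightarrow> measure_pmf.prob P (span B) \<le> c"
  shows "dep_prob P k \<le> c"
  unfolding dep_prob_def
proof (rule expectation_le_const)
  fix X assume X: "X \<in> set_pmf (Pi_pmf {..<k} 0 (\<lambda>_. P))"
  have "measure_pmf.prob P (span (X ` {..<k})) \<le> c"
    using card_image_le[of "{..<k}" X] X by (intro assms) (auto dest: set_Pi_pmfD)
  then show "of_bool (indep_upto X k) * measure_pmf.prob P (span (X ` {..<k})) \<le> c"
    using assms by auto
qed (use assms in \<open>auto intro: finite_set_Pi_pmf\<close>)

text \<open>The vectors are drawn one at a time: each lands in \<open>U\<close> with the probability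
  of \<open>U\<close>, and at most \<open>\<sigma>\<close> of that is lost to the span of the fewer
  than \<open>r\<close> vectors drawn before.\<close>

lemma prob_indep_in_subspace_ge:
  assumes "finite (set_pmf Q)" "j \<le> r" "\<sigma> \<le> measure_pmf.prob Q U"
    "\<And>B. finite B \<Longrightarrow> card B < r \<Longrightarrow> B \<subseteq> set_pmf Q \<Longrightarrow> measure_pmf.prob Q (span B) \<le> \<sigma>"
  shows "(measure_pmf.prob Q U - \<sigma>) ^ j \<le> measure_pmf.expectation (Pi_pmf {..<j} 0 (\<lambda>_. Q))
    (\<lambda>Y. of_bool (indep_upto Y j \<and> Y ` {..<j} \<subseteq> U))"
  using assms(2)
proof (induction j)
  case 0
  then show ?case by simp
next
  case (Suc j)
  let ?Q = "Pi_pmf {..<j} 0 (\<lambda>_. Q)" and ?c = "measure_pmf.prob Q U - \<sigma>"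
  have fin: "finite (set_pmf ?Q)" using assms by (intro finite_set_Pi_pmf) auto
  have "?c ^ Suc j \<le> measure_pmf.expectation ?Q (\<lambda>Y. of_bool (indep_upto Y j \<and> Y ` {..<j} \<subseteq> U)) * ?c"
    using Suc assms(3) by (simp add: mult.commute mult_left_mono)
  also have "\<dots> = measure_pmf.expectation ?Q (\<lambda>Y. of_bool (indep_upto Y j \<and> Y ` {..<j} \<subseteq> U) * ?c)" by simp
  also have "\<dots> \<le> measure_pmf.expectation ?Q (\<lambda>f. measure_pmf.expectation Q
     (\<lambda>y. of_bool (indep_upto (f(j := y)) (Suc j) \<and> (f(j := y)) ` {..<Suc j} \<subseteq> U)))"
  proof (rule expectation_mono_supp[OF fin])
    fix f assume f: "f \<in> set_pmf ?Q"
    have 1: "indep_upto (f(j := y)) (Suc j) \<longleftrightarrow> indep_upto f j \<and> y \<notin> span (f ` {..<j})"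
      "(f(j := y)) ` {..<Suc j} = insert y (f ` {..<j})" for y
    proof -
      have "(f(j := y)) ` {..<j} = f ` {..<j}" by (auto intro!: image_cong)
      moreover have "indep_upto (f(j := y)) j = indep_upto f j" by (rule indep_upto_cong) auto
      ultimately show "indep_upto (f(j := y)) (Suc j) \<longleftrightarrow> indep_upto f j \<and> y \<notin> span (f ` {..<j})"
        "(f(j := y)) ` {..<Suc j} = insert y (f ` {..<j})" by (auto simp: indep_upto_Suc lessThan_Suc)
    qed
    show "of_bool (indep_upto f j \<and> f ` {..<j} \<subseteq> U) * ?c \<le> measure_pmf.expectation Q
     (\<lambda>y. of_bool (indep_upto (f(j := y)) (Suc j) \<and> (f(j := y)) ` {..<Suc j} \<subseteq> U))"
    proof (cases "indep_upto f j \<and> f ` {..<j} \<subseteq> U")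
      case True
      let ?W = "span (f ` {..<j})"
      have "measure_pmf.prob Q ?W \<le> \<sigma>"
        using card_image_le[of "{..<j}" f] f Suc(2) by (intro assms(4)) (auto dest: set_Pi_pmfD)
      moreover have "measure_pmf.prob Q U \<le> measure_pmf.prob Q (U - ?W) + measure_pmf.prob Q ?W"
        by (rule order_trans[OF measure_pmf.finite_measure_mono measure_Un_le]) auto
      ultimately have "?c \<le> measure_pmf.prob Q {y. y \<in> U \<and> y \<notin> ?W}"
        by (simp add: set_diff_eq)
      moreover have "indep_upto (f(j := y)) (Suc j) \<and> (f(j := y)) ` {..<Suc j} \<subseteq> U \<longleftrightarrow> y \<in> U \<and> y \<notin> ?W" for y
        unfolding 1 using True by auto
      ultimately show ?thesis using True by (simp only: prob_eq_expectation) simp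
    qed auto
  qed
  also have "\<dots> = measure_pmf.expectation (Pi_pmf {..<Suc j} 0 (\<lambda>_. Q))
    (\<lambda>Y. of_bool (indep_upto Y (Suc j) \<and> Y ` {..<Suc j} \<subseteq> U))"
    by (simp only: expectation_Pi_Suc[OF assms(1)])
  finally show ?case .
qed

text \<open>Steinitz exchange: the \<open>Y\<close> vectors extend to a basis of the span by vectors
  from \<open>X\<close>, and counting shows that exactly \<open>k - r\<close> of these are
  taken.\<close>

lemma exchange_subset:
  assumes "indep_upto X k" "indep_upto Y r" "Y ` {..<r} \<subseteq> span (X ` {..<k})" "r \<le> k"
  shows "\<exists>S\<subseteq>{..<k}. card S = k - r \<and> span (X ` S \<union> Y ` {..<r}) = span (X ` {..<k})"
proof -
  let ?X = "X ` {..<k}" and ?Y = "Y ` {..<r}"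
  have cards: "card ?X = k" "card ?Y = r" using assms by (auto simp: indep_upto_def card_image)
  obtain B where B: "?Y \<subseteq> B" "B \<subseteq> ?Y \<union> ?X" "\<not> dependent B" "?Y \<union> ?X \<subseteq> span B"
    using maximal_independent_subset_extend[of ?Y "?Y \<union> ?X"] assms(2) by (auto simp: indep_upto_def)
  have sp: "span B = span ?X"
  proof
    have "B \<subseteq> span ?X" using B(2) assms(3) span_superset by blast
    then show "span B \<subseteq> span ?X" by (simp add: span_minimal)
    show "span ?X \<subseteq> span B" using B(4) by (simp add: span_minimal)
  qed
  have finB: "finite B" using B(2) by (rule finite_subset) auto
  have "card B \<le> card ?X" using independent_span_bound[of ?X B] B(3) sp span_superset[of B] by auto
  moreover have "card ?X \<le> card B"
    using independent_span_bound[of B ?X] assms(1) B(4) finB by (auto simp: indep_upto_def)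
  ultimately have cB: "card B = k" using cards by simp
  define S where "S = {j\<in>{..<k}. X j \<in> B - ?Y}"
  have XS: "X ` S = B - ?Y" using B(2) by (auto simp: S_def)
  have "inj_on X S" using assms(1) by (auto simp: S_def indep_upto_def inj_on_def)
  then have "card S = card (B - ?Y)" using XS card_image by metis
  also have "\<dots> = k - r" using B(1) cB cards by (simp add: card_Diff_subset)
  finally have "card S = k - r" .
  moreover have "X ` S \<union> ?Y = B" using XS B(1) by auto
  ultimately show ?thesis using sp by (intro exI[of _ S]) (auto simp: S_def)
qed

text \<open>
  For a subspace \<open>U\<close> with \<open>P(U) > \<beta>\<close>, the weight \<open>w U\<close> in the proof is chosen such that inserting the event that \<open>r\<close>
  independent \<open>Q\<close>-vectors lie in \<open>U\<close> compensates a factor \<open>P(U)\<close>. After the exchange, \<open>U\<close> is spanned by \<open>k - r\<close> of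
  the \<open>P\<close>-vectors together with the \<open>Q\<close>-vectors, and the other \<open>r\<close> \<open>P\<close>-vectors lie in \<open>U\<close> independently of it.
\<close>
lemma dep_prob_swap:
  assumes fP: "finite (set_pmf P)" and fQ: "finite (set_pmf Q)" and rk: "r \<le> k"
    and cmp: "\<And>B. finite B \<Longrightarrow> card B \<le> k \<Longrightarrow> measure_pmf.prob P (span B) \<le> \<epsilon> * measure_pmf.prob Q (span B)"
    and atom: "\<And>B. finite B \<Longrightarrow> card B < r \<Longrightarrow> B \<subseteq> set_pmf Q \<Longrightarrow> measure_pmf.prob Q (span B) \<le> \<sigma>"
    and \<beta>: "\<sigma> \<le> \<eta> * \<beta>" "0 \<le> \<beta>" and \<eta>: "0 < \<eta>" "\<eta> < 1" and \<epsilon>: "0 < \<epsilon>" "\<epsilon> \<le> 1"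
  shows "dep_prob P k \<le> \<beta> + real (k choose r) * (\<epsilon> / (1 - \<eta>)) ^ r"
proof -
  define \<kappa> where "\<kappa> = \<epsilon> / (1 - \<eta>)"
  have \<kappa>: "\<kappa> > 0" using \<epsilon> \<eta> by (simp add: \<kappa>_def)
  let ?PX = "Pi_pmf {..<k} 0 (\<lambda>_. P)" and ?QY = "Pi_pmf {..<r} 0 (\<lambda>_. Q)"
  let ?pr = "\<lambda>U. measure_pmf.prob P U"
  have finX: "finite (set_pmf ?PX)" using fP by (intro finite_set_Pi_pmf) auto
  have finY: "finite (set_pmf ?QY)" using fQ by (intro finite_set_Pi_pmf) auto
  \<comment> \<open>With \<open>p\<close> for the \<open>P\<close>-probability of \<open>U\<close>,
    two identities are behind this choice: \<open>(p / \<kappa>) ^ r * w U = p\<close> and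
    \<open>w U * p ^ r = p * \<kappa> ^ r\<close>. Subspaces with \<open>p \<le> \<beta>\<close> get
    weight 0 since the summand \<open>\<beta>\<close> pays for them.\<close>
  define w where "w = (\<lambda>U. if ?pr U > \<beta> then ?pr U * (\<kappa> / ?pr U) ^ r else 0)"
  have w_nonneg: "w U \<ge> 0" for U using \<kappa> by (auto simp: w_def)
  have w_le: "w U * ?pr U ^ r \<le> \<kappa> ^ r" for U
  proof (cases "?pr U > \<beta>")
    case True
    then have "?pr U > 0" using \<beta> by linarith
    then have "w U * ?pr U ^ r = ?pr U * \<kappa> ^ r" using True by (simp add: w_def power_divide)
    also have "\<dots> \<le> 1 * \<kappa> ^ r" using \<kappa> by (intro mult_right_mono) auto
    finally show ?thesis by simp
  next
    case False
    then show ?thesis using \<kappa> by (simp add: w_def)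
  qed
  let ?U = "\<lambda>X. span (X ` {..<k})"
  let ?US = "\<lambda>S X Y. span (X ` S \<union> Y ` {..<r})"
  define \<S> where "\<S> = {S. S \<subseteq> {..<k} \<and> card S = k - r}"
  have fS: "finite \<S>" unfolding \<S>_def by simp
  have cS: "card \<S> = k choose r"
    using n_subsets[of "{..<k}" "k - r"] rk binomial_symmetric[of r k] by (simp add: \<S>_def)
  have "dep_prob P k \<le> measure_pmf.expectation ?PX (\<lambda>X. \<beta> + measure_pmf.expectation ?QY (\<lambda>Y.
      \<Sum>S\<in>\<S>. of_bool (\<forall>j\<in>{..<k}-S. X j \<in> ?US S X Y) * w (?US S X Y)))"
    unfolding dep_prob_def
  proof (rule expectation_mono_supp[OF finX])
    fix X assume X: "X \<in> set_pmf ?PX"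
    let ?R = "measure_pmf.expectation ?QY (\<lambda>Y. \<Sum>S\<in>\<S>. of_bool (\<forall>j\<in>{..<k}-S. X j \<in> ?US S X Y) * w (?US S X Y))"
    have Rnn: "?R \<ge> 0" using w_nonneg by (intro Bochner_Integration.integral_nonneg sum_nonneg) auto
    show "of_bool (indep_upto X k) * ?pr (?U X) \<le> \<beta> + ?R"
    proof (cases "indep_upto X k \<and> ?pr (?U X) > \<beta>")
      case False
      then show ?thesis using Rnn \<beta> by auto
    next
      case True
      let ?p = "?pr (?U X)" and ?q = "measure_pmf.prob Q (?U X)"
      have ppos: "?p > 0" using True \<beta> by linarith
      \<comment> \<open>The comparison also shows that the span has \<open>Q\<close>-probability
        above \<open>\<beta>\<close>, so \<open>\<sigma>\<close> is at most the fraction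
        \<open>\<eta>\<close> of it. This is where \<open>\<kappa>\<close> gets its denominator
        \<open>1 - \<eta>\<close>.\<close>
      have pq: "?p \<le> \<epsilon> * ?q" by (rule cmp) (use card_image_le[of "{..<k}" X] in auto)
      also have "\<dots> \<le> 1 * ?q" using \<epsilon> by (intro mult_right_mono) auto
      finally have "\<beta> < ?q" using True by simp
      then have "\<eta> * \<beta> \<le> \<eta> * ?q" using \<eta> by (intro mult_left_mono) auto
      then have s: "\<sigma> \<le> \<eta> * ?q" using \<beta> by linarith
      then have s': "(1 - \<eta>) * ?q \<le> ?q - \<sigma>" by (simp add: algebra_simps)
      have "?p / \<kappa> \<le> (1 - \<eta>) * ?q" 
      proof -
        have "?p / \<epsilon> \<le> ?q" using pq \<epsilon> by (simp add: field_simps)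
        then have "(1 - \<eta>) * (?p / \<epsilon>) \<le> (1 - \<eta>) * ?q" using \<eta> by (intro mult_left_mono) auto
        then show ?thesis by (simp add: \<kappa>_def mult.commute)
      qed
      then have "(?p / \<kappa>) ^ r \<le> (?q - \<sigma>) ^ r" using s' ppos \<kappa> by (intro power_mono) auto
      also have "\<dots> \<le> measure_pmf.expectation ?QY (\<lambda>Y. of_bool (indep_upto Y r \<and> Y ` {..<r} \<subseteq> ?U X))"
        using \<eta> by (intro prob_indep_in_subspace_ge[where r=r] fQ atom order_trans[OF s] mult_left_le_one_le) auto
      finally have "(?p / \<kappa>) ^ r * w (?U X) \<le> measure_pmf.expectation ?QY (\<lambda>Y. of_bool (indep_upto Y r \<and> Y ` {..<r} \<subseteq> ?U X)) * w (?U X)"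
        using w_nonneg by (intro mult_right_mono)
      moreover have "(?p / \<kappa>) ^ r * w (?U X) = ?p"
        using True ppos \<kappa> by (simp add: w_def power_divide)
      ultimately have "?p \<le> measure_pmf.expectation ?QY (\<lambda>Y. of_bool (indep_upto Y r \<and> Y ` {..<r} \<subseteq> ?U X) * w (?U X))"
        by simp
      also have "\<dots> \<le> ?R"
      proof (rule expectation_mono_supp[OF finY])
        fix Y
        let ?rhs = "\<Sum>S\<in>\<S>. of_bool (\<forall>j\<in>{..<k}-S. X j \<in> ?US S X Y) * w (?US S X Y)"
        show "of_bool (indep_upto Y r \<and> Y ` {..<r} \<subseteq> ?U X) * w (?U X) \<le> ?rhs"
        proof (cases "indep_upto Y r \<and> Y ` {..<r} \<subseteq> ?U X")
          case True': True
          obtain S where S: "S \<in> \<S>" "?US S X Y = ?U X"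
            using exchange_subset[of X k Y r] True True' rk unfolding \<S>_def by blast
          have "of_bool (indep_upto Y r \<and> Y ` {..<r} \<subseteq> ?U X) * w (?U X) =
             of_bool (\<forall>j\<in>{..<k}-S. X j \<in> ?US S X Y) * w (?US S X Y)"
            using True' by (auto simp: S(2) span_base)
          also have "\<dots> \<le> ?rhs" by (rule member_le_sum[OF S(1)]) (use w_nonneg fS in auto)
          finally show ?thesis .
        qed (use w_nonneg in \<open>auto intro!: sum_nonneg\<close>)
      qed
      finally show ?thesis using True \<beta> by simp
    qed
  qed
  also have "\<dots> = \<beta> + (\<Sum>S\<in>\<S>. measure_pmf.expectation ?PX (\<lambda>X. measure_pmf.expectation ?QY (\<lambda>Y.
      of_bool (\<forall>j\<in>{..<k}-S. X j \<in> ?US S X Y) * w (?US S X Y))))"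
    by (simp add: Bochner_Integration.integral_sum integrable_measure_pmf_finite finX finY)
  also have "(\<Sum>S\<in>\<S>. measure_pmf.expectation ?PX (\<lambda>X. measure_pmf.expectation ?QY (\<lambda>Y.
      of_bool (\<forall>j\<in>{..<k}-S. X j \<in> ?US S X Y) * w (?US S X Y)))) \<le> (\<Sum>S\<in>\<S>. \<kappa> ^ r)"
  proof (rule sum_mono)
    fix S assume S: "S \<in> \<S>"
    let ?T = "{..<k} - S"
    have fin: "finite S" "finite ?T" "S \<inter> ?T = {}" "S \<union> ?T = {..<k}" "card ?T = r"
      using S rk by (auto simp: \<S>_def finite_subset card_Diff_subset)
    have "measure_pmf.expectation ?PX (\<lambda>X. measure_pmf.expectation ?QY (\<lambda>Y.
        of_bool (\<forall>j\<in>?T. X j \<in> ?US S X Y) * w (?US S X Y))) =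
      measure_pmf.expectation (pair_pmf ?PX ?QY) (\<lambda>(X, Y). of_bool (\<forall>j\<in>?T. X j \<in> ?US S X Y) * w (?US S X Y))"
      by (simp add: expectation_pair finX finY)
    \<comment> \<open>Fixing \<open>Y\<close> before \<open>X\<close> allows splitting
      \<open>X\<close> into the independent blocks \<open>S\<close> and \<open>?T\<close>; the
      subspace depends only on \<open>Y\<close> and the block \<open>S\<close>.\<close>
    also have "\<dots> = measure_pmf.expectation (pair_pmf ?QY ?PX) (\<lambda>(Y, X). of_bool (\<forall>j\<in>?T. X j \<in> ?US S X Y) * w (?US S X Y))"
      by (subst pair_commute_pmf) (simp add: case_prod_unfold)
    also have "\<dots> = measure_pmf.expectation ?QY (\<lambda>Y. measure_pmf.expectation ?PX (\<lambda>X. 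
        of_bool (\<forall>j\<in>?T. X j \<in> ?US S X Y) * w (?US S X Y)))"
      by (simp add: expectation_pair finX finY)
    also have "\<dots> \<le> \<kappa> ^ r"
    proof (rule expectation_le_const[OF finY])
      fix Y
      have "measure_pmf.expectation ?PX (\<lambda>X. of_bool (\<forall>j\<in>?T. X j \<in> ?US S X Y) * w (?US S X Y)) =
        measure_pmf.expectation (Pi_pmf S 0 (\<lambda>_. P)) (\<lambda>f. measure_pmf.expectation (Pi_pmf ?T 0 (\<lambda>_. P))
         (\<lambda>g. of_bool (\<forall>j\<in>?T. g j \<in> ?US S f Y) * w (?US S f Y)))"
      proof -
        have im: "(\<lambda>x. if x \<in> S then f x else g x) ` S = f ` S" for f g :: "nat \<Rightarrow> 'b"
          by (auto intro!: image_cong)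
        show ?thesis
          using expectation_Pi_union[OF fin(1-3) fP, of 0 "\<lambda>X. of_bool (\<forall>j\<in>?T. X j \<in> ?US S X Y) * w (?US S X Y)"]
          unfolding fin(4) im by simp
      qed
      also have "\<dots> \<le> \<kappa> ^ r"
      proof (rule expectation_le_const)
        fix f
        have "measure_pmf.expectation (Pi_pmf ?T 0 (\<lambda>_. P)) (\<lambda>g. of_bool (\<forall>j\<in>?T. g j \<in> ?US S f Y) * w (?US S f Y))
          = w (?US S f Y) * measure_pmf.prob (Pi_pmf ?T 0 (\<lambda>_. P)) (Pi ?T (\<lambda>_. ?US S f Y))"
          using prob_eq_expectation[of "Pi_pmf ?T 0 (\<lambda>_. P)" "\<lambda>g. \<forall>j\<in>?T. g j \<in> ?US S f Y"]
          by (simp add: Pi_def Ball_def mult.commute)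
        also have "\<dots> = w (?US S f Y) * ?pr (?US S f Y) ^ r"
          using fin by (simp add: measure_Pi_pmf_Pi)
        also have "\<dots> \<le> \<kappa> ^ r" by (rule w_le)
        finally show "measure_pmf.expectation (Pi_pmf ?T 0 (\<lambda>_. P)) (\<lambda>g. of_bool (\<forall>j\<in>?T. g j \<in> ?US S f Y) * w (?US S f Y)) \<le> \<kappa> ^ r" .
      qed (use fP fin in \<open>auto intro: finite_set_Pi_pmf\<close>)
      finally show "measure_pmf.expectation ?PX (\<lambda>X. of_bool (\<forall>j\<in>?T. X j \<in> ?US S X Y) * w (?US S X Y)) \<le> \<kappa> ^ r" .
    qed
    finally show "measure_pmf.expectation ?PX (\<lambda>X. measure_pmf.expectation ?QY (\<lambda>Y.
        of_bool (\<forall>j\<in>?T. X j \<in> ?US S X Y) * w (?US S X Y))) \<le> \<kappa> ^ r" .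
  qed
  finally show ?thesis by (simp add: cS \<kappa>_def)
qed

end

section \<open>Random vectors and subspaces\<close>

global_interpretation rowsp: row_space "\<lambda>(c::real) (f::nat \<Rightarrow> real) i. c * f i"
  by unfold_locales (auto simp: fun_eq_iff algebra_simps)

interpretation rowsp_real: vector_space_pair "\<lambda>(c::real) (f::nat \<Rightarrow> real) i. c * f i" "(*) :: real \<Rightarrow> real \<Rightarrow> real"
proof (rule vector_space_pair.intro[OF rowsp.vector_space_axioms])
  show "vector_space ((*) :: real \<Rightarrow> real \<Rightarrow> real)"
    by unfold_locales (simp_all add: distrib_left distrib_right mult.assoc)
qed

section \<open>Linear functionals and coordinates\<close>

abbreviation "lin_fun \<equiv> Vector_Spaces.linear (\<lambda>(c::real) (f::nat \<Rightarrow> real) i. c * f i) ((*) :: real \<Rightarrow> real \<Rightarrow> real)"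

definition vecs :: "nat \<Rightarrow> (nat \<Rightarrow> real) set" where
  "vecs n = {x. \<forall>i\<ge>n. x i = 0}"

definition unit_fun :: "nat \<Rightarrow> nat \<Rightarrow> real" where
  "unit_fun i = (\<lambda>j. of_bool (j = i))"

lemma sum_fun_apply: "(\<Sum>i\<in>A. f i) x = (\<Sum>i\<in>A. f i x)" for f :: "'i \<Rightarrow> 'a \<Rightarrow> real"
  by (induction A rule: infinite_finite_induct) auto

lemma vecs_expand:
  assumes "x \<in> vecs n"
  shows "x = (\<Sum>i<n. (\<lambda>j. x i * unit_fun i j))"
proof
  fix j
  have "(\<Sum>i<n. x i * unit_fun i j) = (\<Sum>i<n. if i = j then x j else 0)"
    by (intro sum.cong) (auto simp: unit_fun_def)
  also have "\<dots> = x j" using assms by (auto simp: vecs_def)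
  finally show "x j = (\<Sum>i<n. (\<lambda>j. x i * unit_fun i j)) j" by (simp add: sum_fun_apply)
qed

lemma lin_fun_expand:
  assumes "lin_fun g" "x \<in> vecs n"
  shows "g x = (\<Sum>i<n. g (unit_fun i) * x i)"
proof -
  have "g x = g (\<Sum>i<n. (\<lambda>j. x i * unit_fun i j))" using vecs_expand[OF assms(2)] by simp
  also have "\<dots> = (\<Sum>i<n. g (\<lambda>j. x i * unit_fun i j))"
    by (rule rowsp_real.linear_sum[OF assms(1)])
  also have "\<dots> = (\<Sum>i<n. x i * g (unit_fun i))"
    by (simp add: rowsp_real.linear_scale[OF assms(1)])
  finally show ?thesis by (simp add: mult.commute)
qed

lemma separating_functional:
  assumes "x \<notin> rowsp.span B"
  shows "\<exists>g. lin_fun g \<and> (\<forall>b\<in>rowsp.span B. g b = 0) \<and> g x = 1"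
proof -
  obtain B0 where B0: "B0 \<subseteq> B" "rowsp.independent B0" "B \<subseteq> rowsp.span B0"
    by (rule rowsp.maximal_independent_subset[of B])
  have sp: "rowsp.span B0 = rowsp.span B"
    using rowsp.span_mono[OF B0(1)] rowsp.span_minimal[OF B0(3) rowsp.subspace_span] by blast
  have "rowsp.independent (insert x B0)" using assms sp B0 by (intro rowsp.independent_insertI) auto
  then obtain g where g: "lin_fun g" "\<forall>v\<in>insert x B0. g v = of_bool (v = x)"
    using rowsp_real.linear_independent_extend[of "insert x B0" "\<lambda>v. of_bool (v = x)"] by blast
  have "x \<notin> B0" using assms sp rowsp.span_base by blast
  then have "\<forall>v\<in>B0. g v = 0" using g(2) by auto
  then have "\<forall>b\<in>rowsp.span B. g b = 0" using rowsp_real.linear_eq_0_on_span[OF g(1), of B0] sp by auto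
  then show ?thesis using g by auto
qed

text \<open>A perturbation \<open>g + t * h\<close> repairs the value at one new point, and only
  finitely many \<open>t\<close> spoil any of the points.\<close>

lemma generic_functional:
  assumes "finite Z" "Z \<inter> rowsp.span B = {}"
  shows "\<exists>g. lin_fun g \<and> (\<forall>b\<in>rowsp.span B. g b = 0) \<and> (\<forall>z\<in>Z. g z \<noteq> 0)"
  using assms
proof (induction Z rule: finite_induct)
  case empty
  then show ?case using rowsp_real.linear_zero by (intro exI[of _ "\<lambda>_. 0"]) auto
next
  case (insert z Z)
  then obtain g where g: "lin_fun g" "\<forall>b\<in>rowsp.span B. g b = 0" "\<forall>z\<in>Z. g z \<noteq> 0" by blast
  obtain h where h: "lin_fun h" "\<forall>b\<in>rowsp.span B. h b = 0" "h z = 1"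
    using separating_functional[of z B] insert.prems by blast
  \<comment> \<open>These are the values of \<open>t\<close> at which \<open>g + t * h\<close> may
    vanish at \<open>z\<close>, where \<open>h z = 1\<close>, or at some \<open>w\<close> in
    \<open>Z\<close>. If \<open>h w = 0\<close> the quotient is 0, which merely forbids one more
    value.\<close>
  have "finite (insert (- g z) ((\<lambda>w. - g w / h w) ` Z))" using insert.hyps(1) by blast
  from ex_new_if_finite[OF infinite_UNIV_char_0 this]
  obtain t where t: "t \<noteq> - g z" "t \<notin> (\<lambda>w. - g w / h w) ` Z" by blast
  define f where "f = (\<lambda>v. g v + t * h v)"
  have "lin_fun f" unfolding f_def
    by (intro rowsp_real.linear_compose_add rowsp_real.linear_compose_scale_right g h)
  moreover have "f z \<noteq> 0" using t h by (auto simp: f_def)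
  moreover have "f w \<noteq> 0" if "w \<in> Z" for w
  proof (cases "h w = 0")
    case True
    then show ?thesis using g that by (auto simp: f_def)
  next
    case False
    show ?thesis
    proof
      assume "f w = 0"
      then have "t = - g w / h w" using False by (simp add: f_def field_simps)
      then show False using t that by auto
    qed
  qed
  moreover have "\<forall>b\<in>rowsp.span B. f b = 0" using g h by (auto simp: f_def)
  ultimately show ?case by (intro exI[of _ f]) auto
qed

lemma inj_unit_fun: "inj unit_fun"
proof (rule injI)
  fix i j assume "unit_fun i = unit_fun j"
  then have "unit_fun i i = unit_fun j i" by simp
  then show "i = j" by (simp add: unit_fun_def)
qed

lemma independent_unit_fun: "rowsp.independent (unit_fun ` {..<n})"
  unfolding rowsp.dependent_def
proof safe
  fix i assume i: "unit_fun i \<in> rowsp.span (unit_fun ` {..<n} - {unit_fun i})"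
  have lin: "lin_fun (\<lambda>x. x i)" by unfold_locales auto
  have "(\<lambda>x. x i) (unit_fun i) = (0::real)"
    by (rule rowsp_real.linear_eq_0_on_span[OF lin _ i]) (auto simp: unit_fun_def)
  then show False by (simp add: unit_fun_def)
qed

lemma card_unit_fun: "card (unit_fun ` {..<n}) = n"
  by (simp add: card_image inj_on_subset[OF inj_unit_fun])

section \<open>Probability that a random vector lies in a subspace\<close>

lemma set_iid_vec: "x \<in> set_pmf (iid_vec n p) \<Longrightarrow> x \<in> vecs n"
  by (auto simp: iid_vec_def set_Pi_pmf PiE_dflt_def vecs_def)

lemma finite_set_iid_vec: "finite (set_pmf p) \<Longrightarrow> finite (set_pmf (iid_vec n p))"
  unfolding iid_vec_def by (intro finite_set_Pi_pmf) auto

text \<open>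
  A generic functional vanishing on the subspace has the same zeros as the subspace on the finite
  supports, so the hyperplane case suffices.
\<close>
lemma subspace_comparison:
  assumes "finite (set_pmf p)" "finite (set_pmf q)" "finite B" "card B < n"
    and cmp: "\<And>a i0. i0 < n \<Longrightarrow> a i0 \<noteq> 0 \<Longrightarrow>
      measure_pmf.prob (iid_vec n p) {x. (\<Sum>i<n. a i * x i) = 0} \<le>
      \<epsilon> * measure_pmf.prob (iid_vec n q) {x. (\<Sum>i<n. a i * x i) = 0}"
  shows "measure_pmf.prob (iid_vec n p) (rowsp.span B) \<le> \<epsilon> * measure_pmf.prob (iid_vec n q) (rowsp.span B)"
proof -
  \<comment> \<open>The unit vectors are included because one of them lies outside a span of fewer
    than \<open>n\<close> vectors; this makes the coefficient vector \<open>a\<close>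
    nonzero.\<close>
  define Z where "Z = (set_pmf (iid_vec n p) \<union> set_pmf (iid_vec n q) \<union> unit_fun ` {..<n}) - rowsp.span B"
  have "finite Z" unfolding Z_def using assms by (auto intro: finite_set_iid_vec)
  then obtain g where g: "lin_fun g" "\<forall>b\<in>rowsp.span B. g b = 0" "\<forall>z\<in>Z. g z \<noteq> 0"
    using generic_functional[of Z B] by (auto simp: Z_def)
  define a where "a = (\<lambda>i. g (unit_fun i))"
  have "\<not> unit_fun ` {..<n} \<subseteq> rowsp.span B"
    using rowsp.independent_span_bound[OF assms(3) independent_unit_fun[of n]] assms(4) card_unit_fun[of n] by auto
  then obtain i0 where i0: "i0 < n" "unit_fun i0 \<notin> rowsp.span B" by auto
  then have "a i0 \<noteq> 0" using g by (auto simp: a_def Z_def)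
  have eq: "measure_pmf.prob r (rowsp.span B) = measure_pmf.prob r {x. (\<Sum>i<n. a i * x i) = 0}"
    if "set_pmf r \<subseteq> vecs n" "set_pmf r - rowsp.span B \<subseteq> Z" for r
  proof (rule measure_pmf.finite_measure_eq_AE)
    have "x \<in> rowsp.span B \<longleftrightarrow> (\<Sum>i<n. a i * x i) = 0" if "x \<in> set_pmf r" for x
    proof -
      have "g x = (\<Sum>i<n. a i * x i)"
        unfolding a_def using lin_fun_expand[OF g(1), of x n] that \<open>set_pmf r \<subseteq> vecs n\<close> by blast
      moreover have "x \<in> Z" if "x \<notin> rowsp.span B"
        using that \<open>x \<in> set_pmf r\<close> \<open>set_pmf r - rowsp.span B \<subseteq> Z\<close> by blast
      ultimately show ?thesis using g(2,3) by metis
    qed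
    then show "AE x in measure_pmf r. (x \<in> rowsp.span B) = (x \<in> {x. (\<Sum>i<n. a i * x i) = 0})"
      by (auto simp: AE_measure_pmf_iff)
  qed auto
  show ?thesis
  proof -
    have "measure_pmf.prob (iid_vec n p) (rowsp.span B) = measure_pmf.prob (iid_vec n p) {x. (\<Sum>i<n. a i * x i) = 0}"
      by (rule eq) (use set_iid_vec in \<open>auto simp: Z_def\<close>)
    moreover have "measure_pmf.prob (iid_vec n q) (rowsp.span B) = measure_pmf.prob (iid_vec n q) {x. (\<Sum>i<n. a i * x i) = 0}"
      by (rule eq) (use set_iid_vec in \<open>auto simp: Z_def\<close>)
    ultimately show ?thesis using cmp[of i0 a] i0(1) \<open>a i0 \<noteq> 0\<close> by simp
  qed
qed

text \<open>A subspace of dimension at most \<open>k\<close> determines at least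
  \<open>n - k\<close> of the coordinates as linear functions of the remaining ones. Given the
  latter, the determined coordinates are hit independently, each with probability at most
  \<open>\<rho>\<close>.\<close>

lemma prob_span_le:
  assumes "finite (set_pmf p)" "finite B" "card B \<le> k"
    and \<rho>: "\<And>x. pmf p x \<le> \<rho>" "\<rho> \<le> 1"
  shows "measure_pmf.prob (iid_vec n p) (rowsp.span B) \<le> \<rho> ^ (n - k)"
proof -
  have \<rho>0: "\<rho> \<ge> 0" by (rule order_trans[OF pmf_nonneg \<rho>(1)])
  obtain B0 where B0: "B0 \<subseteq> B" "rowsp.independent B0" "B \<subseteq> rowsp.span B0"
    by (rule rowsp.maximal_independent_subset[of B])
  have sp: "rowsp.span B0 = rowsp.span B"
    using rowsp.span_mono[OF B0(1)] rowsp.span_minimal[OF B0(3) rowsp.subspace_span] by blast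
  let ?E = "unit_fun ` {..<n}"
  obtain B' where B': "B0 \<subseteq> B'" "B' \<subseteq> B0 \<union> ?E" "rowsp.independent B'" "B0 \<union> ?E \<subseteq> rowsp.span B'"
    by (rule rowsp.maximal_independent_subset_extend[of B0 "B0 \<union> ?E"]) (use B0(2) in auto)
  have finB0: "finite B0" using B0 assms finite_subset by blast
  have finB': "finite B'" using B'(2) finB0 by (auto intro: finite_subset)
  define J where "J = {i\<in>{..<n}. unit_fun i \<in> B' - B0}"
  have "n \<le> card B'"
    using rowsp.independent_span_bound[OF finB' independent_unit_fun[of n]] B'(4) card_unit_fun[of n] by auto
  also have "B' = B0 \<union> unit_fun ` J" using B'(1,2) by (auto simp: J_def)
  also have "card (B0 \<union> unit_fun ` J) \<le> card B0 + card (unit_fun ` J)" by (rule card_Un_le)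
  also have "\<dots> \<le> k + card J"
    using card_mono[OF assms(2) B0(1)] assms(3) card_image_le[of J unit_fun] by (simp add: J_def)
  finally have cardJ: "n - k \<le> card J" by simp
  \<comment> \<open>Dual functionals: for \<open>j\<close> in \<open>J\<close> the functional
    vanishes on the subspace and on the other unit vectors from \<open>J\<close>, so its equation
    solves for coordinate \<open>j\<close> in terms of those in \<open>I\<close>.\<close>
  have "\<forall>j. \<exists>g. lin_fun g \<and> (\<forall>v\<in>B'. g v = of_bool (v = unit_fun j))"
    using rowsp_real.linear_independent_extend[OF B'(3), of "\<lambda>v. of_bool (v = unit_fun _)"] by fast
  from choice[OF this] obtain g
    where g: "\<And>j. lin_fun (g j)" "\<And>j v. v \<in> B' \<Longrightarrow> g j v = of_bool (v = unit_fun j)" by blast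
  define I where "I = {..<n} - J"
  have IJ: "finite I" "finite J" "I \<inter> J = {}" "I \<union> J = {..<n}" by (auto simp: I_def J_def)
  define h where "h = (\<lambda>f j. - (\<Sum>i\<in>I. g j (unit_fun i) * f i))"
  have det: "x j = h x j" if x: "x \<in> vecs n" "x \<in> rowsp.span B" and j: "j \<in> J" for x j
  proof -
    have "g j x = 0"
      by (rule rowsp_real.linear_eq_0_on_span[OF g(1), of B0]) (use x j sp g(2) B'(1) in \<open>auto simp: J_def\<close>)
    then have "0 = (\<Sum>i<n. g j (unit_fun i) * x i)" using lin_fun_expand[OF g(1) x(1), of j] by simp
    also have "\<dots> = (\<Sum>i\<in>I. g j (unit_fun i) * x i) + (\<Sum>i\<in>J. g j (unit_fun i) * x i)"
      using sum.union_disjoint[OF IJ(1-3), of "\<lambda>i. g j (unit_fun i) * x i"] IJ(4) by simp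
    also have "(\<Sum>i\<in>J. g j (unit_fun i) * x i) = (\<Sum>i\<in>J. if i = j then x j else 0)"
      using g(2) inj_unit_fun by (intro sum.cong) (auto simp: J_def dest: injD)
    also have "\<dots> = x j" using IJ j by simp
    finally show ?thesis by (simp add: h_def)
  qed
  have fin: "finite (set_pmf (iid_vec n p))" using assms by (intro finite_set_iid_vec)
  have "measure_pmf.prob (iid_vec n p) (rowsp.span B) = measure_pmf.expectation (iid_vec n p) (\<lambda>x. of_bool (x \<in> rowsp.span B))"
    using prob_eq_expectation[of "iid_vec n p" "\<lambda>x. x \<in> rowsp.span B"] by simp
  also have "\<dots> \<le> measure_pmf.expectation (iid_vec n p) (\<lambda>x. of_bool (\<forall>j\<in>J. x j = h x j))"
    by (rule expectation_mono_supp[OF fin]) (use det set_iid_vec in auto)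
  also have "\<dots> = measure_pmf.expectation (Pi_pmf I 0 (\<lambda>_. p)) (\<lambda>f. measure_pmf.expectation (Pi_pmf J 0 (\<lambda>_. p))
      (\<lambda>y. of_bool (\<forall>j\<in>J. y j = h f j)))"
  proof -
    have "h (\<lambda>x. if x \<in> I then f x else y x) j = h f j" for f y j
      unfolding h_def by (intro arg_cong[of _ _ uminus] sum.cong) auto
    moreover have "j \<notin> I" if "j \<in> J" for j using that IJ by auto
    ultimately show ?thesis
      unfolding iid_vec_def IJ(4)[symmetric] by (subst expectation_Pi_union[OF IJ(1-3) assms(1)]) simp
  qed
  also have "\<dots> \<le> \<rho> ^ (n - k)"
  proof (rule expectation_le_const)
    fix f
    have "measure_pmf.expectation (Pi_pmf J 0 (\<lambda>_. p)) (\<lambda>y. of_bool (\<forall>j\<in>J. y j = h f j)) =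
       measure_pmf.prob (Pi_pmf J 0 (\<lambda>_. p)) (Pi J (\<lambda>j. {h f j}))"
      using prob_eq_expectation[of "Pi_pmf J 0 (\<lambda>_. p)" "\<lambda>y. \<forall>j\<in>J. y j = h f j"]
      by (simp add: Pi_def Ball_def)
    also have "\<dots> = (\<Prod>j\<in>J. pmf p (h f j))" using IJ by (simp add: measure_Pi_pmf_Pi measure_pmf_single)
    also have "\<dots> \<le> (\<Prod>j\<in>J. \<rho>)" by (intro prod_mono) (auto simp: \<rho>)
    also have "\<dots> = \<rho> ^ card J" by simp
    also have "\<dots> \<le> \<rho> ^ (n - k)" using cardJ \<rho> \<rho>0 by (intro power_decreasing) auto
    finally show "measure_pmf.expectation (Pi_pmf J 0 (\<lambda>_. p)) (\<lambda>y. of_bool (\<forall>j\<in>J. y j = h f j)) \<le> \<rho> ^ (n - k)" .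
  qed (use assms IJ in \<open>auto intro: finite_set_Pi_pmf\<close>)
  finally show ?thesis .
qed

text \<open>The exchange with \<open>r = k - s\<close> and
  \<open>\<beta> = \<rho> ^ s / \<eta>\<close>. Here \<open>s\<close> is the number of basis rows
  kept, and a span of fewer than \<open>k - s\<close> vectors still determines at least
  \<open>s\<close> coordinates, which supplies the bound \<open>\<rho> ^ s\<close>.\<close>

lemma dep_prob_bounds:
  assumes "finite (set_pmf p)" "finite (set_pmf q)" "k < n" "s \<le> k"
    and cmp: "\<And>a i0. i0 < n \<Longrightarrow> a i0 \<noteq> 0 \<Longrightarrow>
      measure_pmf.prob (iid_vec n p) {x. (\<Sum>i<n. a i * x i) = 0} \<le>
      \<epsilon> * measure_pmf.prob (iid_vec n q) {x. (\<Sum>i<n. a i * x i) = 0}"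
    and \<rho>: "\<And>x. pmf q x \<le> \<rho>" "\<rho> \<le> 1"
    and \<eta>: "0 < \<eta>" "\<eta> < 1" and \<epsilon>: "0 < \<epsilon>" "\<epsilon> \<le> 1"
  shows "rowsp.dep_prob (iid_vec n p) k \<le> \<rho> ^ s / \<eta> + real (k choose s) * (\<epsilon> / (1 - \<eta>)) ^ (k - s)"
proof -
  have \<rho>0: "\<rho> \<ge> 0" by (rule order_trans[OF pmf_nonneg \<rho>(1)])
  have "rowsp.dep_prob (iid_vec n p) k \<le> \<rho> ^ s / \<eta> + real (k choose (k - s)) * (\<epsilon> / (1 - \<eta>)) ^ (k - s)"
  proof (rule rowsp.dep_prob_swap[where \<sigma> = "\<rho> ^ s" and \<eta> = \<eta>])
    show "finite (set_pmf (iid_vec n p))" "finite (set_pmf (iid_vec n q))" using assms by (auto intro: finite_set_iid_vec)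
    show "measure_pmf.prob (iid_vec n p) (rowsp.span B) \<le> \<epsilon> * measure_pmf.prob (iid_vec n q) (rowsp.span B)"
      if "finite B" "card B \<le> k" for B
      using that assms by (intro subspace_comparison) auto
    show "measure_pmf.prob (iid_vec n q) (rowsp.span B) \<le> \<rho> ^ s"
      if "finite B" "card B < k - s" "B \<subseteq> set_pmf (iid_vec n q)" for B
    proof -
      have "measure_pmf.prob (iid_vec n q) (rowsp.span B) \<le> \<rho> ^ (n - (k - s))"
        using that assms set_iid_vec by (intro prob_span_le) auto
      also have "\<dots> \<le> \<rho> ^ s" using \<rho> \<rho>0 assms by (intro power_decreasing) auto
      finally show ?thesis .
    qed
  qed (use \<eta> \<epsilon> \<rho>0 in auto)
  then show ?thesis using binomial_symmetric[OF assms(4)] by simp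
qed

text \<open>No exchange is made here; the bound is good while \<open>k\<close> stays away from
  \<open>n\<close>.\<close>

lemma dep_prob_direct:
  assumes "finite (set_pmf p)" "k \<le> n" "\<And>x. pmf p x \<le> \<rho>" "\<rho> \<le> 1"
  shows "rowsp.dep_prob (iid_vec n p) k \<le> \<rho> ^ (n - k)"
proof (rule rowsp.dep_prob_le)
  have "\<rho> \<ge> 0" by (rule order_trans[OF pmf_nonneg assms(3)])
  then show "0 \<le> \<rho> ^ (n - k)" by simp
  show "measure_pmf.prob (iid_vec n p) (rowsp.span B) \<le> \<rho> ^ (n - k)"
    if "finite B" "card B \<le> k" "B \<subseteq> set_pmf (iid_vec n p)" for B
    using that assms set_iid_vec by (intro prob_span_le) auto
qed (use assms in \<open>auto intro: finite_set_iid_vec\<close>)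

section \<open>Characteristic functions of the entries\<close>

text \<open>Concavity places the sine above its chord.\<close>

lemma sin_pi_ge:
  fixes t :: real
  assumes "0 \<le> t" "t \<le> 1/2"
  shows "2 * t \<le> sin (pi * t)"
proof -
  have "convex_on {0..1/2} (\<lambda>t. - sin (pi * t))"
  proof (rule f''_ge0_imp_convex)
    show "((\<lambda>t. - sin (pi * t)) has_real_derivative - (pi * cos (pi * t))) (at t)" for t
      by (auto intro!: derivative_eq_intros)
    show "((\<lambda>t. - (pi * cos (pi * t))) has_real_derivative pi * (pi * sin (pi * t))) (at t)" for t
      by (auto intro!: derivative_eq_intros)
    show "0 \<le> pi * (pi * sin (pi * t))" if "t \<in> {0..1/2}" for t
      using that by (intro mult_nonneg_nonneg sin_ge_zero) auto
  qed auto
  from convex_onD[OF this, of "2 * t" 0 "1/2"] show ?thesis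
    using assms by simp
qed

lemma one_minus_half_square_le_cos: "1 - z\<^sup>2 / 2 \<le> cos (z :: real)"
proof -
  have "cos z = 1 - 2 * (sin (z / 2))\<^sup>2" using cos_double_sin[of "z / 2"] by simp
  moreover have "(sin (z / 2))\<^sup>2 \<le> (z / 2)\<^sup>2"
    using abs_sin_x_le_abs_x[of "z / 2"] by (rule abs_le_square_iff[THEN iffD1])
  ultimately show ?thesis by (simp add: power_divide)
qed

lemma half_le_exp_minus_half: "1/2 \<le> exp (- (1/2) :: real)"
  using exp_ge_add_one_self[of "- (1/2)"] by simp

section \<open>The uniform entry and its cosine transform\<close>

definition unif :: "nat \<Rightarrow> real pmf" where
  "unif m = map_pmf real_of_int (pmf_of_set {- int m..int m})"

lemma finite_unif [simp]: "finite (set_pmf (unif m))"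
  by (simp add: unif_def)

lemma unif_Ints: "set_pmf (unif m) \<subseteq> \<int>"
  by (auto simp: unif_def)

lemma symmetric_unif: "symmetric_pmf (unif m)"
proof -
  have im: "uminus ` {- int m..int m} = {- int m..int m}" by simp
  have "map_pmf uminus (unif m) = map_pmf real_of_int (map_pmf uminus (pmf_of_set {- int m..int m}))"
    by (simp add: unif_def map_pmf_comp)
  also have "map_pmf uminus (pmf_of_set {- int m..int m}) = pmf_of_set {- int m..int m}"
    by (subst map_pmf_of_set_inj) (auto simp: im)
  finally show ?thesis by (simp add: symmetric_pmf_def unif_def)
qed

lemma pmf_unif_le: "pmf (unif m) x \<le> 1 / (2 * real m + 1)"
proof (cases "x \<in> \<int>")
  case True
  then obtain k where k: "x = of_int k" by (auto elim: Ints_cases)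
  have "pmf (unif m) x = pmf (pmf_of_set {- int m..int m}) k"
    unfolding unif_def k by (rule pmf_map_inj') (auto simp: inj_on_def)
  then show ?thesis by (auto simp: indicator_def)
next
  case False
  then have "x \<notin> set_pmf (unif m)" using unif_Ints by auto
  then show ?thesis by (simp add: set_pmf_iff)
qed

lemma cosf_unif: "cosf (unif m) t = (\<Sum>k=-int m..int m. cos (2 * pi * t * of_int k)) / (2 * real m + 1)"
proof -
  have "cosf (unif m) t = measure_pmf.expectation (pmf_of_set {- int m..int m}) (\<lambda>k. cos (2 * pi * t * of_int k))"
    by (simp add: cosf_def unif_def)
  then show ?thesis by (simp add: integral_pmf_of_set)
qed

text \<open>The closed form is kept multiplied out, so that it also holds at integers, where the
  sine vanishes. In the induction the two new terms agree, and the sine addition formulas make the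
  sum telescope.\<close>

lemma dirichlet_kernel:
  "sin (pi * t) * (\<Sum>k=-int m..int m. cos (2 * pi * t * of_int k)) = sin ((2 * real m + 1) * (pi * t))"
proof (induction m)
  case 0
  then show ?case by simp
next
  case (Suc m)
  let ?f = "\<lambda>k::int. cos (2 * pi * t * of_int k)"
  have split: "{- int (Suc m)..int (Suc m)} = insert (- int (Suc m)) (insert (int (Suc m)) {- int m..int m})" by auto
  have notin: "- int (Suc m) \<notin> insert (int (Suc m)) {- int m..int m}" "int (Suc m) \<notin> {- int m..int m}" by auto
  have "?f (- int (Suc m)) = ?f (int (Suc m))" by (simp only: of_int_minus mult_minus_right cos_minus)
  then have "(\<Sum>k=- int (Suc m)..int (Suc m). ?f k) = 2 * ?f (int (Suc m)) + (\<Sum>k=- int m..int m. ?f k)"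
    unfolding split sum.insert[OF finite.insertI[OF finite_atLeastAtMost_int] notin(1)]
      sum.insert[OF finite_atLeastAtMost_int notin(2)] by linarith
  then have "sin (pi * t) * (\<Sum>k=- int (Suc m)..int (Suc m). ?f k) =
     2 * (sin (pi * t) * cos (2 * pi * t * real (Suc m))) + sin ((2 * real m + 1) * (pi * t))"
    using Suc by (simp add: algebra_simps)
  also have "\<dots> = sin ((2 * real (Suc m) + 1) * (pi * t))"
  proof -
    have "(2 * real (Suc m) + 1) * (pi * t) = 2 * pi * t * real (Suc m) + pi * t"
      "(2 * real m + 1) * (pi * t) = 2 * pi * t * real (Suc m) - pi * t"
      by (simp_all add: algebra_simps)
    then show ?thesis by (simp add: sin_add sin_diff)
  qed
  finally show ?case .
qed

lemma cosf_even: "finite (set_pmf p) \<Longrightarrow> cosf p (- t) = cosf p t"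
  by (simp add: cosf_eq_sum)

lemma cosf_unif_abs: "\<bar>cosf (unif m) \<bar>t\<bar>\<bar> = \<bar>cosf (unif m) t\<bar>"
  using cosf_even[of "unif m" t] by (cases "t \<ge> 0") auto

text \<open>The closed form of the Dirichlet kernel has a numerator of modulus at most 1 and a
  denominator bounded below by \<open>sin_pi_ge\<close>.\<close>

lemma cosf_unif_decay:
  assumes "0 < \<bar>t\<bar>" "\<bar>t\<bar> \<le> 1/2"
  shows "\<bar>cosf (unif m) t\<bar> \<le> 1 / (2 * (2 * real m + 1) * \<bar>t\<bar>)"
proof -
  let ?S = "\<Sum>k=-int m..int m. cos (2 * pi * \<bar>t\<bar> * of_int k)"
  have "2 * \<bar>t\<bar> * \<bar>?S\<bar> \<le> sin (pi * \<bar>t\<bar>) * \<bar>?S\<bar>"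
    using sin_pi_ge[of "\<bar>t\<bar>"] assms by (intro mult_right_mono) auto
  also have "\<dots> = \<bar>sin (pi * \<bar>t\<bar>) * ?S\<bar>"
    using sin_pi_ge[of "\<bar>t\<bar>"] assms by (simp add: abs_mult)
  also have "\<dots> \<le> 1" unfolding dirichlet_kernel by simp
  finally have "\<bar>?S\<bar> \<le> 1 / (2 * \<bar>t\<bar>)" using assms by (simp add: field_simps)
  then have "\<bar>?S\<bar> / (2 * real m + 1) \<le> 1 / (2 * \<bar>t\<bar>) / (2 * real m + 1)" by (intro divide_right_mono) auto
  then have "\<bar>cosf (unif m) \<bar>t\<bar>\<bar> \<le> 1 / (2 * (2 * real m + 1) * \<bar>t\<bar>)"
    by (simp add: cosf_unif abs_divide mult_ac)
  then show ?thesis by (simp add: cosf_unif_abs)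
qed

text \<open>Only the two extreme terms \<open>k = m\<close> and \<open>k = - m\<close> are
  estimated, all others are bounded by 1. This loses a factor of order \<open>m\<close> in the
  exponent but is enough later. The sum is nonnegative in this range by the Dirichlet
  kernel.\<close>

lemma cosf_unif_near:
  assumes "m \<ge> 1" "\<bar>t\<bar> \<le> 1 / (2 * real m + 1)"
  shows "\<bar>cosf (unif m) t\<bar> \<le> exp (- (5 * real m) * t\<^sup>2)"
proof (cases "t = 0")
  case True
  then show ?thesis by (simp add: cosf_def)
next
  case False
  define u where "u = \<bar>t\<bar>"
  have u: "0 < u" "u \<le> 1 / (2 * real m + 1)" "u\<^sup>2 = t\<^sup>2" using False assms by (auto simp: u_def)
  have um: "u * (2 * real m + 1) \<le> 1" using u(2) by (simp add: field_simps)
  have umm: "u * real m \<le> 1/2" using um u(1) by (simp add: algebra_simps)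
  have u2: "u \<le> 1/2" 
  proof -
    have "u * 2 \<le> u * (2 * real m + 1)" using u(1) assms(1) by (intro mult_left_mono) auto
    then show ?thesis using um by linarith
  qed
  let ?f = "\<lambda>k::int. cos (2 * pi * u * of_int k)"
  let ?S = "\<Sum>k=-int m..int m. ?f k"
  have "0 \<le> sin ((2 * real m + 1) * (pi * u))"
  proof (rule sin_ge_zero)
    have "(2 * real m + 1) * (pi * u) = pi * (u * (2 * real m + 1))" by simp
    also have "\<dots> \<le> pi * 1" using um by (intro mult_left_mono) auto
    finally show "(2 * real m + 1) * (pi * u) \<le> pi" by simp
  qed (use u in auto)
  then have "0 \<le> sin (pi * u) * ?S" by (simp add: dirichlet_kernel)
  moreover have "sin (pi * u) > 0" using sin_pi_ge[of u] u u2 by auto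
  ultimately have Snn: "0 \<le> ?S" by (simp add: zero_le_mult_iff)
  have fm: "?f (int m) \<le> 1 - 8 * real m ^ 2 * u\<^sup>2"
  proof -
    have "?f (int m) = 1 - 2 * (sin (pi * (u * real m)))\<^sup>2"
      using cos_double_sin[of "pi * (u * real m)"] by (simp add: mult_ac)
    moreover have "(2 * (u * real m))\<^sup>2 \<le> (sin (pi * (u * real m)))\<^sup>2"
      using sin_pi_ge[of "u * real m"] u umm by (intro power_mono) auto
    ultimately show ?thesis by (simp add: power_mult_distrib)
  qed
  have "?S = ?f (- int m) + (?f (int m) + (\<Sum>k\<in>{- int m..int m} - {- int m} - {int m}. ?f k))"
    using assms(1) by (simp add: sum.remove[of "{- int m..int m}" "- int m"] sum.remove[of "{- int m..int m} - {- int m}" "int m"])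
  also have "\<dots> \<le> (1 - 8 * real m ^ 2 * u\<^sup>2) + ((1 - 8 * real m ^ 2 * u\<^sup>2) + (\<Sum>k\<in>{- int m..int m} - {- int m} - {int m}. 1))"
    using fm by (intro add_mono sum_mono) auto
  also have "(\<Sum>k\<in>{- int m..int m} - {- int m} - {int m}. 1 :: real) = 2 * real m - 1"
    using assms(1) by (simp add: card_Diff_subset of_nat_diff)
  finally have "?S \<le> (2 * real m + 1) - 16 * real m ^ 2 * u\<^sup>2" by (simp add: algebra_simps)
  also have "\<dots> \<le> (2 * real m + 1) * (1 - 5 * real m * u\<^sup>2)"
  proof -
    have "(2 * real m + 1) * (5 * real m) \<le> 16 * real m ^ 2"
      using assms(1) by (simp add: power2_eq_square algebra_simps)
    then have "(2 * real m + 1) * (5 * real m) * u\<^sup>2 \<le> 16 * real m ^ 2 * u\<^sup>2" by (intro mult_right_mono) auto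
    then show ?thesis by (simp add: algebra_simps)
  qed
  finally have "?S / (2 * real m + 1) \<le> 1 - 5 * real m * u\<^sup>2" by (simp add: field_simps)
  also have "\<dots> \<le> exp (- (5 * real m) * u\<^sup>2)" using exp_ge_add_one_self[of "- (5 * real m) * u\<^sup>2"] by simp
  finally have "\<bar>cosf (unif m) u\<bar> \<le> exp (- (5 * real m) * u\<^sup>2)" using Snn by (simp add: cosf_unif)
  then show ?thesis using cosf_unif_abs[of m t] u(3) by (simp add: u_def)
qed

text \<open>Beyond \<open>1 / (2 * real m + 1)\<close> the decay bound is at most 1/2, while
  \<open>A * \<alpha>\<^sup>2 \<le> 1/2\<close> keeps the Gaussian at or above
  \<open>exp (- (1/2))\<close>.\<close>

lemma cosf_unif_gaussian:
  assumes "m \<ge> 1" "\<bar>t\<bar> \<le> \<alpha>" "\<alpha> \<le> 1/2" "A \<le> 5 * real m" "A * \<alpha>\<^sup>2 \<le> 1/2" "0 \<le> A"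
  shows "\<bar>cosf (unif m) t\<bar> \<le> exp (- A * t\<^sup>2)"
proof (cases "\<bar>t\<bar> \<le> 1 / (2 * real m + 1)")
  case True
  have "\<bar>cosf (unif m) t\<bar> \<le> exp (- (5 * real m) * t\<^sup>2)" using cosf_unif_near[OF assms(1) True] .
  also have "\<dots> \<le> exp (- A * t\<^sup>2)" using assms by (auto intro!: mult_right_mono)
  finally show ?thesis .
next
  case False
  then have t: "1 < (2 * real m + 1) * \<bar>t\<bar>" by (simp add: field_simps)
  then have t0: "0 < \<bar>t\<bar>" by (cases "t = 0") auto
  have "\<bar>cosf (unif m) t\<bar> \<le> 1 / (2 * (2 * real m + 1) * \<bar>t\<bar>)"
    using t0 assms by (intro cosf_unif_decay) auto
  also have "\<dots> = 1 / (2 * ((2 * real m + 1) * \<bar>t\<bar>))" by simp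
  also have "\<dots> \<le> 1 / 2" using t by (intro divide_left_mono) auto
  also have "\<dots> \<le> exp (- (1/2))" by (rule half_le_exp_minus_half)
  also have "\<dots> \<le> exp (- A * t\<^sup>2)"
  proof -
    have "t\<^sup>2 \<le> \<alpha>\<^sup>2" using assms(2) by (metis abs_ge_zero abs_le_square_iff abs_of_nonneg order_trans)
    then have "A * t\<^sup>2 \<le> A * \<alpha>\<^sup>2" using assms by (intro mult_left_mono) auto
    then show ?thesis using assms(5) by simp
  qed
  finally show ?thesis .
qed

section \<open>The lazy comparison variable\<close>

definition diff_unif :: "nat \<Rightarrow> real pmf" where
  "diff_unif q = map_pmf (\<lambda>(x, y). real x - real y) (pair_pmf (pmf_of_set {..<q}) (pmf_of_set {..<q}))"

text \<open>A difference of two independent copies has a squared modulus as characteristic function,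
  hence a nonnegative one. The atom at 0 raises it to at least \<open>\<delta>\<close>, so in the
  far zone an absolute bound on the other characteristic function is enough.\<close>

definition lazy :: "real \<Rightarrow> nat \<Rightarrow> real pmf" where
  "lazy \<delta> q = bernoulli_pmf \<delta> \<bind> (\<lambda>b. if b then return_pmf 0 else diff_unif q)"

locale lazy_params =
  fixes \<delta> :: real and q :: nat
  assumes \<delta>: "0 < \<delta>" "\<delta> < 1" and q: "q \<ge> 1"
begin

lemma ne: "{..<q} \<noteq> {}" using q by (auto simp: lessThan_empty_iff)

lemma finite_diff: "finite (set_pmf (diff_unif q))"
  using ne by (simp add: diff_unif_def)

lemma finite_lazy: "finite (set_pmf (lazy \<delta> q))"
  using finite_diff by (auto simp: lazy_def)

lemma lazy_Ints: "set_pmf (lazy \<delta> q) \<subseteq> \<int>"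
  using ne by (auto simp: lazy_def diff_unif_def split: if_splits)

lemma diff_eq: "map_pmf uminus (diff_unif q) = diff_unif q"
proof -
  let ?U = "pmf_of_set {..<q}"
  have "map_pmf uminus (diff_unif q) = map_pmf (\<lambda>(x, y). real y - real x) (pair_pmf ?U ?U)"
    by (auto simp: diff_unif_def map_pmf_comp intro!: map_pmf_cong)
  also have "\<dots> = map_pmf (\<lambda>(x, y). real y - real x) (map_pmf (\<lambda>(x, y). (y, x)) (pair_pmf ?U ?U))"
    by (subst pair_commute_pmf) simp
  also have "\<dots> = diff_unif q"
    by (auto simp: diff_unif_def map_pmf_comp intro!: map_pmf_cong)
  finally show ?thesis .
qed

lemma symmetric_lazy: "symmetric_pmf (lazy \<delta> q)"
  unfolding symmetric_pmf_def lazy_def map_bind_pmf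
  by (intro bind_pmf_cong) (auto simp: diff_eq)

lemma pmf_lazy: "pmf (lazy \<delta> q) x = \<delta> * of_bool (x = 0) + (1 - \<delta>) * pmf (diff_unif q) x"
  using \<delta> by (simp add: lazy_def pmf_bind indicator_def)

lemma expectation_diff:
  fixes f :: "real \<Rightarrow> real"
  shows "measure_pmf.expectation (diff_unif q) f = (\<Sum>x<q. \<Sum>y<q. f (real x - real y)) / (real q)\<^sup>2"
proof -
  have "measure_pmf.expectation (diff_unif q) f = measure_pmf.expectation (pmf_of_set {..<q})
      (\<lambda>x. measure_pmf.expectation (pmf_of_set {..<q}) (\<lambda>y. f (real x - real y)))"
    unfolding diff_unif_def using ne by (simp add: expectation_pair case_prod_unfold)
  then show ?thesis using ne by (simp add: integral_pmf_of_set sum_divide_distrib power2_eq_square)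
qed

lemma pmf_diff_le: "pmf (diff_unif q) v \<le> 1 / real q"
proof -
  have "pmf (diff_unif q) v = measure_pmf.expectation (diff_unif q) (\<lambda>x. of_bool (x = v))"
    using prob_eq_expectation[of "diff_unif q" "\<lambda>x. x = v"] by (simp add: measure_pmf_single)
  also have "\<dots> = (\<Sum>x<q. \<Sum>y<q. of_bool (real x - real y = v)) / (real q)\<^sup>2" by (rule expectation_diff)
  also have "\<dots> \<le> (\<Sum>x<q. 1) / (real q)\<^sup>2"
  proof (intro divide_right_mono sum_mono)
    fix x
    have "(\<Sum>y<q. of_bool (real x - real y = v)) = real (card {y\<in>{..<q}. real x - real y = v})"
      by (simp add: of_bool_def sum.If_cases Int_def)
    also have "card {y\<in>{..<q}. real x - real y = v} \<le> card {nat \<lfloor>real x - v\<rfloor>}"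
      by (intro card_mono) auto
    finally show "(\<Sum>y<q. of_bool (real x - real y = v)) \<le> (1::real)" by simp
  qed auto
  also have "\<dots> = 1 / real q" using q by (simp add: power2_eq_square)
  finally show ?thesis .
qed

lemma pmf_lazy_le: "pmf (lazy \<delta> q) x \<le> \<delta> + (1 - \<delta>) / real q"
proof -
  have "(1 - \<delta>) * pmf (diff_unif q) x \<le> (1 - \<delta>) * (1 / real q)"
    using pmf_diff_le \<delta> by (intro mult_left_mono) auto
  moreover have "\<delta> * of_bool (x = 0) \<le> \<delta>" using \<delta> by simp
  ultimately show ?thesis unfolding pmf_lazy by simp
qed

lemma cosf_diff: "cosf (diff_unif q) t = (\<Sum>x<q. \<Sum>y<q. cos (2 * pi * t * (real x - real y))) / (real q)\<^sup>2"
  unfolding cosf_def by (rule expectation_diff)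

lemma cosf_lazy: "cosf (lazy \<delta> q) t = \<delta> + (1 - \<delta>) * cosf (diff_unif q) t"
proof -
  have "cosf (lazy \<delta> q) t = (\<Sum>b\<in>UNIV. pmf (bernoulli_pmf \<delta>) b *\<^sub>R
     measure_pmf.expectation (if b then return_pmf 0 else diff_unif q) (\<lambda>x. cos (2 * pi * t * x)))"
    unfolding cosf_def lazy_def using finite_diff by (intro pmf_expectation_bind) auto
  then show ?thesis using \<delta> by (simp add: UNIV_bool cosf_def)
qed

lemma cosf_diff_nonneg: "0 \<le> cosf (diff_unif q) t"
proof -
  have "(\<Sum>x<q. \<Sum>y<q. cos (2 * pi * t * (real x - real y))) =
    (\<Sum>x<q. \<Sum>y<q. cos (2 * pi * t * real x) * cos (2 * pi * t * real y)) + (\<Sum>x<q. \<Sum>y<q. sin (2 * pi * t * real x) * sin (2 * pi * t * real y))"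
    by (simp add: right_diff_distrib cos_diff sum.distrib)
  also have "\<dots> = (\<Sum>x<q. cos (2 * pi * t * real x))\<^sup>2 + (\<Sum>x<q. sin (2 * pi * t * real x))\<^sup>2"
    by (simp add: power2_eq_square sum_product)
  finally show ?thesis unfolding cosf_diff by simp
qed

lemma cosf_diff_ge: "1 - 2 * pi\<^sup>2 * (real q)\<^sup>2 * t\<^sup>2 \<le> cosf (diff_unif q) t"
proof -
  have "(real q)\<^sup>2 * (1 - 2 * pi\<^sup>2 * (real q)\<^sup>2 * t\<^sup>2) = (\<Sum>x<q. \<Sum>y<q. 1 - 2 * pi\<^sup>2 * (real q)\<^sup>2 * t\<^sup>2)"
    by (simp add: power2_eq_square)
  also have "\<dots> \<le> (\<Sum>x<q. \<Sum>y<q. cos (2 * pi * t * (real x - real y)))"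
  proof (intro sum_mono)
    fix x y assume xy: "x \<in> {..<q}" "y \<in> {..<q}"
    have "\<bar>real x - real y\<bar> \<le> \<bar>real q\<bar>" using xy by auto
    then have "(real x - real y)\<^sup>2 \<le> (real q)\<^sup>2" by (rule abs_le_square_iff[THEN iffD1])
    then have "2 * pi\<^sup>2 * t\<^sup>2 * (real x - real y)\<^sup>2 \<le> 2 * pi\<^sup>2 * t\<^sup>2 * (real q)\<^sup>2" by (intro mult_left_mono) auto
    moreover have "(2 * pi * t * (real x - real y))\<^sup>2 / 2 = 2 * pi\<^sup>2 * t\<^sup>2 * (real x - real y)\<^sup>2"
      by (simp add: power_mult_distrib)
    moreover have "2 * pi\<^sup>2 * (real q)\<^sup>2 * t\<^sup>2 = 2 * pi\<^sup>2 * t\<^sup>2 * (real q)\<^sup>2" by (simp only: mult_ac)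
    ultimately show "1 - 2 * pi\<^sup>2 * (real q)\<^sup>2 * t\<^sup>2 \<le> cos (2 * pi * t * (real x - real y))"
      using one_minus_half_square_le_cos[of "2 * pi * t * (real x - real y)"] by linarith
  qed
  finally show ?thesis unfolding cosf_diff using q by (simp add: field_simps)
qed

lemma cosf_lazy_ge: "\<delta> \<le> cosf (lazy \<delta> q) t"
  unfolding cosf_lazy using \<delta> cosf_diff_nonneg by simp

text \<open>Two regimes: for \<open>x \<le> 1/2\<close> the quadratic lower bound and
  \<open>exp (- (2 * x)) \<le> 1 - x\<close> apply; otherwise the floor
  \<open>\<delta> \<ge> exp (- (1 / \<delta>))\<close> does. The constant 40 is twice 20, which
  bounds \<open>2 * pi\<^sup>2\<close>.\<close>

lemma cosf_lazy_gaussian: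
  "exp (- (40 * (1 - \<delta>) * (real q)\<^sup>2 / \<delta>) * t\<^sup>2) \<le> cosf (lazy \<delta> q) t"
proof -
  define x where "x = (1 - \<delta>) * (20 * (real q)\<^sup>2 * t\<^sup>2)"
  have x0: "x \<ge> 0" using \<delta> by (simp add: x_def)
  have e: "(40 * (1 - \<delta>) * (real q)\<^sup>2 / \<delta>) * t\<^sup>2 = 2 * x / \<delta>" by (simp add: x_def)
  have "exp (- (2 * x / \<delta>)) \<le> cosf (lazy \<delta> q) t"
  proof (cases "x \<le> 1/2")
    case True
    have "1 + 2 * x \<le> exp (2 * x)" by (rule exp_ge_add_one_self)
    moreover have "1 \<le> (1 - x) * (1 + 2 * x)" using True x0 mult_nonneg_nonneg[of x "1 - 2 * x"] by (simp add: algebra_simps)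
    ultimately have "1 \<le> (1 - x) * exp (2 * x)" 
      using True mult_left_mono[of "1 + 2 * x" "exp (2 * x)" "1 - x"] by linarith
    then have "exp (- (2 * x)) \<le> 1 - x" by (simp add: exp_minus field_simps)
    moreover have "2 * x * 1 \<le> 2 * x * (1 / \<delta>)" using \<delta> x0 by (intro mult_left_mono) auto
    then have "exp (- (2 * x / \<delta>)) \<le> exp (- (2 * x))" by simp
    moreover have "1 - x \<le> cosf (lazy \<delta> q) t"
    proof -
      have "pi\<^sup>2 \<le> 10" using power_mono[of pi "3.15" 2] pi_approx(2) by (simp add: power2_eq_square)
      then have "2 * pi\<^sup>2 * (real q)\<^sup>2 * t\<^sup>2 \<le> 20 * (real q)\<^sup>2 * t\<^sup>2" by (intro mult_right_mono) auto
      then have "1 - 20 * (real q)\<^sup>2 * t\<^sup>2 \<le> cosf (diff_unif q) t" using cosf_diff_ge[of t] by linarith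
      then have "(1 - \<delta>) * (1 - 20 * (real q)\<^sup>2 * t\<^sup>2) \<le> (1 - \<delta>) * cosf (diff_unif q) t"
        using \<delta> by (intro mult_left_mono) auto
      then show ?thesis unfolding cosf_lazy by (simp add: x_def algebra_simps)
    qed
    ultimately show ?thesis by linarith
  next
    case False
    have "1 / \<delta> \<le> exp (1 / \<delta>)" using exp_ge_add_one_self[of "1/\<delta>"] by linarith
    then have "exp (- (1 / \<delta>)) \<le> \<delta>" using \<delta> by (simp add: exp_minus field_simps)
    moreover have "1 / \<delta> \<le> 2 * x / \<delta>" using False \<delta> by (intro divide_right_mono) auto
    then have "exp (- (2 * x / \<delta>)) \<le> exp (- (1 / \<delta>))" by simp
    ultimately show ?thesis using cosf_lazy_ge[of t] by linarith
  qed
  then show ?thesis by (simp only: e mult_minus_left)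
qed

lemma charfun_pair_lazy:
  assumes "m \<ge> 1" "0 < \<alpha>" "\<alpha> \<le> 1/8" "D = 40 * (1 - \<delta>) * (real q)\<^sup>2 / \<delta>" "4 * D \<le> A"
    "A \<le> 5 * real m" "A * \<alpha>\<^sup>2 \<le> 1/2" "0 \<le> \<epsilon>\<^sub>0" "\<epsilon>\<^sub>0 \<le> 1"
    and far: "\<And>t. \<alpha> \<le> \<bar>t\<bar> \<Longrightarrow> \<bar>t\<bar> \<le> 1/2 \<Longrightarrow> \<bar>cosf (unif m) t\<bar> \<le> \<epsilon>\<^sub>0 * \<delta>"
  shows "charfun_pair (cosf (unif m)) (cosf (lazy \<delta> q)) \<alpha> A D \<epsilon>\<^sub>0"
proof
  have D: "D > 0" using assms(4) \<delta> q by simp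
  then show "0 < D" .
  show "continuous_on UNIV (cosf (unif m))" "continuous_on UNIV (cosf (lazy \<delta> q))"
    using finite_lazy by (auto intro: continuous_on_cosf)
  show "cosf (unif m) (x + of_int k) = cosf (unif m) x" "cosf (lazy \<delta> q) (x + of_int k) = cosf (lazy \<delta> q) x" for x k
    by (rule cosf_add_int[OF finite_unif unif_Ints], rule cosf_add_int[OF finite_lazy lazy_Ints])
  show "0 \<le> cosf (lazy \<delta> q) x" for x using cosf_lazy_ge[of x] \<delta> by linarith
  show "exp (- D * x\<^sup>2) \<le> cosf (lazy \<delta> q) x" for x
    unfolding assms(4) by (rule cosf_lazy_gaussian)
  show "\<bar>cosf (unif m) x\<bar> \<le> exp (- A * x\<^sup>2)" if "\<bar>x\<bar> \<le> \<alpha>" for x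
    by (rule cosf_unif_gaussian[where \<alpha> = \<alpha>]) (use assms that D in auto)
  show "\<bar>cosf (unif m) x\<bar> \<le> \<epsilon>\<^sub>0 * cosf (lazy \<delta> q) x" if "\<alpha> \<le> \<bar>x\<bar>" "\<bar>x\<bar> \<le> 1/2" for x
    using far[OF that] mult_left_mono[OF cosf_lazy_ge[of x] assms(8)] by linarith
qed (use assms in auto)

end

section \<open>From determinants to dependent rows\<close>

text \<open>A kernel vector of the transposed integer matrix is a relation between the rows;
  dividing by a nonzero coefficient over the reals expresses one row by the others. The vanishing of
  \<open>R\<close> beyond \<open>n\<close> extends the relation to the whole functions.\<close>

lemma det_zero_imp_dependent:
  fixes R :: "nat \<Rightarrow> nat \<Rightarrow> int"
  assumes det: "Determinant.det (Matrix.mat n n (\<lambda>(i, j). R i j)) = 0" and R: "\<And>i j. j \<ge> n \<Longrightarrow> R i j = 0"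
  shows "\<not> rowsp.indep_upto (\<lambda>i j. real_of_int (R i j)) n"
proof
  let ?A = "Matrix.mat n n (\<lambda>(i, j). R i j)" and ?X = "\<lambda>i j. real_of_int (R i j)"
  assume ind: "rowsp.indep_upto ?X n"
  have A: "?A \<in> carrier_mat n n" by simp
  then have "Determinant.det (transpose_mat ?A) = 0" using det Determinant.det_transpose[OF A] by simp
  then obtain v where v: "v \<in> carrier_vec n" "v \<noteq> 0\<^sub>v n" "transpose_mat ?A *\<^sub>v v = 0\<^sub>v n"
    using det_0_iff_vec_prod_zero[of "transpose_mat ?A" n] A by auto
  have zero: "(\<Sum>i<n. vec_index v i * R i j) = 0" if "j < n" for j
  proof -
    have "vec_index (transpose_mat ?A *\<^sub>v v) j = (\<Sum>i<n. R i j * vec_index v i)"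
      using that v(1) by (simp add: scalar_prod_def lessThan_atLeast0)
    then show ?thesis using v(3) that by (simp add: mult.commute)
  qed
  obtain k where k: "k < n" "vec_index v k \<noteq> 0" using v(1,2) by (metis eq_vecI carrier_vecD index_zero_vec)
  have "?X k = (\<Sum>i\<in>{..<n}-{k}. (\<lambda>j. (- real_of_int (vec_index v i) / real_of_int (vec_index v k)) * ?X i j))"
  proof
    fix j
    have "(\<Sum>i<n. vec_index v i * R i j) = 0" using zero R by (cases "j < n") auto
    then have "real_of_int (\<Sum>i<n. vec_index v i * R i j) = 0" by simp
    then have "(\<Sum>i<n. real_of_int (vec_index v i) * ?X i j) = 0" by simp
    then have "real_of_int (vec_index v k) * ?X k j + (\<Sum>i\<in>{..<n}-{k}. real_of_int (vec_index v i) * ?X i j) = 0"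
      using k by (simp add: sum.remove[of "{..<n}" k])
    then have "?X k j = - (\<Sum>i\<in>{..<n}-{k}. real_of_int (vec_index v i) * ?X i j) / real_of_int (vec_index v k)"
      using k by (simp add: field_simps)
    then show "?X k j = (\<Sum>i\<in>{..<n}-{k}. (\<lambda>j. (- real_of_int (vec_index v i) / real_of_int (vec_index v k)) * ?X i j)) j"
      unfolding sum_fun_apply by (simp add: sum_negf sum_divide_distrib)
  qed
  also have "\<dots> \<in> rowsp.span (?X ` ({..<n} - {k}))"
    by (intro rowsp.span_sum rowsp.span_scale rowsp.span_base) auto
  also have "?X ` ({..<n} - {k}) = ?X ` {..<n} - {?X k}"
    using ind k by (auto simp: rowsp.indep_upto_def inj_on_def)
  finally have "rowsp.dependent (?X ` {..<n})"
    unfolding rowsp.dependent_def using k by blast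
  then show False using ind by (simp add: rowsp.indep_upto_def)
qed

text \<open>Both laws are uniform, and cutting off the default rows and columns is a bijection from
  the finite function space \<open>S\<close> to the matrices.\<close>

lemma prob_singular_eq:
  "prob_singular n m = measure_pmf.prob (Pi_pmf {..<n} (\<lambda>_. 0) (\<lambda>_. Pi_pmf {..<n} 0 (\<lambda>_. pmf_of_set {- int m..int m})))
    {R. Determinant.det (Matrix.mat n n (\<lambda>(i, j). R i j)) = 0}"
proof -
  define S where "S = PiE_dflt {..<n} (\<lambda>_. 0) (\<lambda>_. PiE_dflt {..<n} 0 (\<lambda>_. {- int m..int m}))"
  let ?g = "\<lambda>R::nat\<Rightarrow>nat\<Rightarrow>int. Matrix.mat n n (\<lambda>(i, j). R i j)"
  have fin: "finite S" unfolding S_def by (intro finite_PiE_dflt) auto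
  have ne: "S \<noteq> {}" unfolding S_def by auto
  have rows: "Pi_pmf {..<n} (\<lambda>_. 0) (\<lambda>_. Pi_pmf {..<n} 0 (\<lambda>_. pmf_of_set {- int m..int m})) = pmf_of_set S"
    unfolding S_def
    by (subst Pi_pmf_of_set, simp, simp, simp, subst Pi_pmf_of_set) (auto intro!: finite_PiE_dflt)
  have inj: "inj_on ?g S"
  proof (rule inj_onI)
    fix R R' assume R: "R \<in> S" "R' \<in> S" "?g R = ?g R'"
    show "R = R'"
    proof (intro ext)
      fix i j
      show "R i j = R' i j"
      proof (cases "i < n \<and> j < n")
        case True
        then have "?g R $$ (i, j) = ?g R' $$ (i, j)" using R(3) by simp
        then show ?thesis using True by simp
      next
        case False
        have "R i j = 0" "R' i j = 0"
          using R(1,2) False unfolding S_def PiE_dflt_def by (cases "i < n"; simp)+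
        then show ?thesis by simp
      qed
    qed
  qed
  have img: "?g ` S = bounded_int_mats n m"
  proof (intro equalityI subsetI)
    fix A assume "A \<in> ?g ` S"
    then show "A \<in> bounded_int_mats n m"
      by (auto simp: bounded_int_mats_def S_def PiE_dflt_def)
  next
    fix A assume A: "A \<in> bounded_int_mats n m"
    define R where "R = (\<lambda>i j. if i < n \<and> j < n then A $$ (i, j) else 0)"
    have "R \<in> S" using A by (auto simp: R_def S_def PiE_dflt_def bounded_int_mats_def fun_eq_iff)
    moreover have "A = ?g R" using A by (auto simp: R_def bounded_int_mats_def)
    ultimately show "A \<in> ?g ` S" by blast
  qed
  have "pmf_of_set (bounded_int_mats n m) = map_pmf ?g (pmf_of_set S)"
    unfolding img[symmetric] by (rule map_pmf_of_set_inj[OF inj ne fin, symmetric])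
  then show ?thesis unfolding prob_singular_def rows by (simp add: vimage_def)
qed

lemma prob_singular_le_sum: "prob_singular n m \<le> (\<Sum>k<n. rowsp.dep_prob (iid_vec n (unif m)) k)"
proof -
  let ?U = "pmf_of_set {- int m..int m}"
  let ?V = "Pi_pmf {..<n} 0 (\<lambda>_. ?U)"
  let ?Ri = "Pi_pmf {..<n} (\<lambda>_. 0) (\<lambda>_. ?V)"
  let ?h = "\<lambda>R i j. real_of_int (R i j)"
  have 1: "iid_vec n (unif m) = map_pmf (\<lambda>r j. real_of_int (r j)) ?V"
    unfolding iid_vec_def unif_def by (subst Pi_pmf_map[where dflt = 0]) (auto simp: comp_def[abs_def])
  have 2: "Pi_pmf {..<n} 0 (\<lambda>_. iid_vec n (unif m)) = map_pmf ?h ?Ri"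
    unfolding 1 by (subst Pi_pmf_map[where dflt = "\<lambda>_. 0"]) (auto simp: comp_def[abs_def] zero_fun_def)
  have "prob_singular n m \<le> measure_pmf.prob ?Ri {R. \<not> rowsp.indep_upto (?h R) n}"
    unfolding prob_singular_eq
  proof (rule measure_pmf.finite_measure_mono_AE)
    have "\<not> rowsp.indep_upto (?h R) n"
      if "R \<in> set_pmf ?Ri" "Determinant.det (Matrix.mat n n (\<lambda>(i, j). R i j)) = 0" for R
    proof (rule det_zero_imp_dependent[OF that(2)])
      fix i j assume "n \<le> j"
      then show "R i j = 0" using that(1) by (cases "i < n") (auto simp: set_Pi_pmf PiE_dflt_def)
    qed
    then show "AE R in measure_pmf ?Ri. R \<in> {R. Determinant.det (Matrix.mat n n (\<lambda>(i, j). R i j)) = 0} \<longrightarrow>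
        R \<in> {R. \<not> rowsp.indep_upto (?h R) n}"
      by (auto simp: AE_measure_pmf_iff)
  qed auto
  also have "\<dots> = measure_pmf.prob (Pi_pmf {..<n} 0 (\<lambda>_. iid_vec n (unif m))) {X. \<not> rowsp.indep_upto X n}"
    unfolding 2 by (simp add: vimage_def)
  also have "\<dots> \<le> (\<Sum>k<n. rowsp.dep_prob (iid_vec n (unif m)) k)"
    by (intro rowsp.prob_dependent_le finite_set_iid_vec finite_unif)
  finally show ?thesis .
qed

text \<open>The identity matrix is a nonsingular outcome. This serves the finitely many pairs that
  the asymptotic bounds leave open.\<close>

lemma prob_singular_less_1: "prob_singular n m < 1" if "m \<ge> 1"
proof -
  have fin: "finite (bounded_int_mats n m)"
  proof -
    have "bounded_int_mats n m \<subseteq> (\<lambda>f. Matrix.mat n n (\<lambda>(i, j). f (i, j))) ` PiE ({..<n} \<times> {..<n}) (\<lambda>_. {- int m..int m})"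
    proof
      fix A assume A: "A \<in> bounded_int_mats n m"
      have "A = Matrix.mat n n (\<lambda>(i, j). restrict (\<lambda>p. A $$ p) ({..<n} \<times> {..<n}) (i, j))"
        using A by (auto simp: bounded_int_mats_def)
      moreover have "restrict (\<lambda>p. A $$ p) ({..<n} \<times> {..<n}) \<in> PiE ({..<n} \<times> {..<n}) (\<lambda>_. {- int m..int m})"
        using A by (auto simp: bounded_int_mats_def)
      ultimately show "A \<in> (\<lambda>f. Matrix.mat n n (\<lambda>(i, j). f (i, j))) ` PiE ({..<n} \<times> {..<n}) (\<lambda>_. {- int m..int m})"
        by blast
    qed
    then show ?thesis by (rule finite_subset) (auto intro!: finite_PiE)
  qed
  have one: "1\<^sub>m n \<in> bounded_int_mats n m" using that by (auto simp: bounded_int_mats_def)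
  have "prob_singular n m = real (card (bounded_int_mats n m \<inter> {A. Determinant.det A = 0})) / real (card (bounded_int_mats n m))"
    unfolding prob_singular_def using fin one by (intro measure_pmf_of_set) auto
  also have "\<dots> < 1"
  proof -
    have "bounded_int_mats n m \<inter> {A. Determinant.det A = 0} \<subset> bounded_int_mats n m"
    proof -
      have "1\<^sub>m n \<notin> {A :: int mat. Determinant.det A = 0}" by simp
      then show ?thesis using one by blast
    qed
    then have "card (bounded_int_mats n m \<inter> {A. Determinant.det A = 0}) < card (bounded_int_mats n m)"
      using fin by (rule psubset_card_mono[rotated])
    then show ?thesis by simp
  qed
  finally show ?thesis .
qed

section \<open>The two regimes\<close>

lemma exp_2_le: "exp (2::real) \<le> 7.4"
proof -
  have "exp (2::real) = exp 1 ^ 2" by (simp add: power2_eq_square flip: exp_add)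
  also have "\<dots> \<le> 2.72 ^ 2" using e_less_272 by (intro power_mono) auto
  finally show ?thesis by (simp add: power2_eq_square)
qed

text \<open>Turns the constants of the hyperplane comparison into \<open>16 * 24\<close> and
  24.\<close>

lemma exp_2_pi_le: "exp 2 * pi \<le> (24 :: real)"
proof -
  have "exp 2 * pi \<le> (7.4 :: real) * 3.15" using exp_2_le pi_approx(2) by (intro mult_mono) auto
  then show ?thesis by simp
qed

context lazy_params
begin

lemma dep_prob_lazy:
  assumes cp: "charfun_pair (cosf (unif m)) (cosf (lazy \<delta> q)) \<alpha> A D \<epsilon>\<^sub>0"
    and \<epsilon>\<^sub>1: "16 * 24 * \<alpha> \<le> \<epsilon>\<^sub>1" "24 * sqrt (2 * D / A) \<le> \<epsilon>\<^sub>1"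
    and \<epsilon>: "\<epsilon>\<^sub>0 + (1 - \<epsilon>\<^sub>0) * \<epsilon>\<^sub>1 \<le> \<epsilon>" "\<epsilon> \<le> 1" and \<eta>: "0 < \<eta>" "\<eta> < 1"
    and \<rho>: "\<delta> + (1 - \<delta>) / real q \<le> \<rho>" "\<rho> \<le> 1" and k: "k < n" "s \<le> k"
  shows "rowsp.dep_prob (iid_vec n (unif m)) k \<le> \<rho> ^ s / \<eta> + real (k choose s) * (\<epsilon> / (1 - \<eta>)) ^ (k - s)"
proof -
  interpret charfun_pair "cosf (unif m)" "cosf (lazy \<delta> q)" \<alpha> A D \<epsilon>\<^sub>0 by (fact cp)
  have "exp 2 * (16 * pi * \<alpha>) = (16 * \<alpha>) * (exp 2 * pi)" by simp
  also have "\<dots> \<le> (16 * \<alpha>) * 24" using exp_2_pi_le pos by (intro mult_left_mono) auto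
  finally have 1: "exp 2 * (16 * pi * \<alpha>) \<le> \<epsilon>\<^sub>1" using \<epsilon>\<^sub>1(1) by linarith
  have "exp 2 * (pi * sqrt (2 * D / A)) = (exp 2 * pi) * sqrt (2 * D / A)" by simp
  also have "\<dots> \<le> 24 * sqrt (2 * D / A)" using exp_2_pi_le pos by (intro mult_right_mono) auto
  finally have 2: "exp 2 * (pi * sqrt (2 * D / A)) \<le> \<epsilon>\<^sub>1" using \<epsilon>\<^sub>1 by simp
  have "0 < \<epsilon>"
  proof -
    have "\<epsilon>\<^sub>1 > 0" using \<epsilon>\<^sub>1(1) pos(1) by linarith
    then have "0 < \<epsilon>\<^sub>0 + (1 - \<epsilon>\<^sub>0) * \<epsilon>\<^sub>1"
      using pos(5,6) by (cases "\<epsilon>\<^sub>0 = 1") (auto intro!: add_nonneg_pos mult_pos_pos)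
    then show ?thesis using \<epsilon> by linarith
  qed
  show ?thesis
  proof (rule dep_prob_bounds[OF finite_unif finite_lazy k])
    fix a i0 assume i0: "i0 < n" "a i0 \<noteq> (0::real)"
    have "measure_pmf.prob (iid_vec n (unif m)) {x. (\<Sum>i<n. a i * x i) = 0}
       \<le> (\<epsilon>\<^sub>0 + (1 - \<epsilon>\<^sub>0) * \<epsilon>\<^sub>1) * measure_pmf.prob (iid_vec n (lazy \<delta> q)) {x. (\<Sum>i<n. a i * x i) = 0}"
      by (rule hyperplane_comparison[of "unif m" "lazy \<delta> q" \<alpha> A D \<epsilon>\<^sub>0 i0 n a \<epsilon>\<^sub>1,
            OF finite_unif finite_lazy symmetric_unif symmetric_lazy cp i0 1 2])
    also have "\<dots> \<le> \<epsilon> * measure_pmf.prob (iid_vec n (lazy \<delta> q)) {x. (\<Sum>i<n. a i * x i) = 0}"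
      using \<epsilon> by (intro mult_right_mono) auto
    finally show "measure_pmf.prob (iid_vec n (unif m)) {x. (\<Sum>i<n. a i * x i) = 0}
       \<le> \<epsilon> * measure_pmf.prob (iid_vec n (lazy \<delta> q)) {x. (\<Sum>i<n. a i * x i) = 0}" .
  next
    show "pmf (lazy \<delta> q) x \<le> \<rho>" for x using pmf_lazy_le[of x] \<rho> by linarith
  qed (use \<rho> \<eta> \<epsilon> \<open>0 < \<epsilon>\<close> in auto)
qed

end

lemma dep_prob_unif_direct:
  assumes "k \<le> n" "1 / (2 * real m + 1) \<le> \<rho>" "\<rho> \<le> 1"
  shows "rowsp.dep_prob (iid_vec n (unif m)) k \<le> \<rho> ^ (n - k)"
  using order_trans[OF pmf_unif_le assms(2)] assms by (intro dep_prob_direct) auto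

text \<open>With \<open>Q = real q\<close> the parameters are \<open>\<delta> = 1 / Q\<close>,
  \<open>\<alpha> = 1 / Q ^ 4\<close>, \<open>A = Q ^ 8 / 2\<close>,
  \<open>\<epsilon>\<^sub>0 = 1 / Q ^ 3\<close>, and \<open>D\<close> is about
  \<open>40 * Q ^ 3\<close>. The hypothesis \<open>q ^ 8 \<le> m\<close> makes the far bound
  \<open>1 / Q ^ 4\<close>, which is \<open>\<epsilon>\<^sub>0 * \<delta>\<close>. Then
  \<open>\<epsilon>\<^sub>1 = 400 / Q\<^sup>2\<close>; adding \<open>\<epsilon>\<^sub>0\<close> and
  taking \<open>\<eta> = 1/2\<close> leads to 802.\<close>

lemma dep_prob_large:
  assumes q: "q \<ge> 802" "q ^ 8 \<le> m" and k: "k < n" "s \<le> k"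
  shows "rowsp.dep_prob (iid_vec n (unif m)) k \<le>
    2 * (2 / real q) ^ s + real (k choose s) * (802 / (real q)\<^sup>2) ^ (k - s)"
proof -
  define Q where "Q = real q"
  have Q: "Q \<ge> 802" using q by (simp add: Q_def)
  have Qm: "Q ^ 8 \<le> real m" using q(2) unfolding Q_def by (metis of_nat_le_iff of_nat_power)
  have Qp: "Q ^ i > 0" for i using Q by simp
  have m1: "real m \<ge> 1" using Qm one_le_power[of Q 8] Q by linarith
  interpret lazy_params "1 / Q" q using Q q(1) by unfold_locales auto
  define D where "D = 40 * (1 - 1 / Q) * (real q)\<^sup>2 / (1 / Q)"
  have D_le: "D \<le> 40 * Q ^ 3"
  proof -
    have "D = (1 - 1 / Q) * (40 * Q ^ 3)" by (simp add: D_def Q_def power2_eq_square power3_eq_cube)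
    also have "\<dots> \<le> 1 * (40 * Q ^ 3)" using Q by (intro mult_right_mono) auto
    finally show ?thesis by simp
  qed
  \<comment> \<open>320 is what \<open>4 * D \<le> Q ^ 8 / 2\<close> asks for, given
    \<open>D \<le> 40 * Q ^ 3\<close>.\<close>
  have Q5: "Q ^ 5 \<ge> 320"
  proof -
    have "Q ^ 1 \<le> Q ^ 5" using Q by (intro power_increasing) auto
    then show ?thesis using Q by simp
  qed
  have Q8: "Q ^ 8 = Q ^ 5 * Q ^ 3" "Q ^ 8 = Q ^ 4 * Q ^ 4" by (simp_all flip: power_add)
  have cp: "charfun_pair (cosf (unif m)) (cosf (lazy (1 / Q) q)) (1 / Q ^ 4) (Q ^ 8 / 2) D (1 / Q ^ 3)"
  proof (rule charfun_pair_lazy[OF _ _ _ D_def])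
    show "m \<ge> 1" using m1 by simp
    show "0 < 1 / Q ^ 4" using Q by simp
    have "Q ^ 1 \<le> Q ^ 4" using Q by (intro power_increasing) auto
    then show "1 / Q ^ 4 \<le> 1 / 8" using Q by (intro divide_left_mono) auto
    have "320 * Q ^ 3 \<le> Q ^ 5 * Q ^ 3" using Q5 Q by (intro mult_right_mono) auto
    then show "4 * D \<le> Q ^ 8 / 2" using D_le unfolding Q8(1) by linarith
    show "Q ^ 8 / 2 \<le> 5 * real m" using Qm m1 by linarith
    show "Q ^ 8 / 2 * (1 / Q ^ 4)\<^sup>2 \<le> 1 / 2" using Qp[of 8] by (simp add: power_divide flip: power_mult)
    show "0 \<le> 1 / Q ^ 3" using Q by simp
    show "1 / Q ^ 3 \<le> 1" using Q by simp
    show "\<bar>cosf (unif m) t\<bar> \<le> 1 / Q ^ 3 * (1 / Q)" if t: "1 / Q ^ 4 \<le> \<bar>t\<bar>" "\<bar>t\<bar> \<le> 1 / 2" for t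
    proof -
      have t0: "0 < \<bar>t\<bar>" using t(1) Qp[of 4] by (smt (verit) divide_pos_pos)
      have "\<bar>cosf (unif m) t\<bar> \<le> 1 / (2 * (2 * real m + 1) * \<bar>t\<bar>)" by (rule cosf_unif_decay[OF t0 t(2)])
      also have "\<dots> \<le> 1 / Q ^ 4"
      proof (intro divide_left_mono)
        have "Q ^ 4 \<noteq> 0" using Q by simp
        then have "Q ^ 4 = Q ^ 8 * (1 / Q ^ 4)"
          unfolding Q8(2) times_divide_eq_right mult_1_right
          by (rule nonzero_mult_div_cancel_right[symmetric])
        also have "\<dots> \<le> 2 * (2 * real m + 1) * \<bar>t\<bar>"
          using t(1) Qm m1 Qp[of 4] Qp[of 8] by (intro mult_mono) auto
        finally show "Q ^ 4 \<le> 2 * (2 * real m + 1) * \<bar>t\<bar>" .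
      qed (use t0 m1 Qp[of 4] in \<open>auto intro!: mult_pos_pos add_nonneg_pos\<close>)
      also have "\<dots> = 1 / Q ^ 3 * (1 / Q)" by (simp add: eval_nat_numeral)
      finally show ?thesis .
    qed
  qed
  have "rowsp.dep_prob (iid_vec n (unif m)) k \<le>
    (2 / Q) ^ s / (1/2) + real (k choose s) * ((401 / Q\<^sup>2) / (1 - 1/2)) ^ (k - s)"
  proof (rule dep_prob_lazy[OF cp, where \<epsilon>\<^sub>1 = "400 / Q\<^sup>2"])
    have "Q ^ 2 \<le> Q ^ 4" using Q by (intro power_increasing) auto
    then have "1 / Q ^ 4 \<le> 1 / Q\<^sup>2" using Q by (intro divide_left_mono) auto
    then have "384 * (1 / Q ^ 4) \<le> 400 * (1 / Q\<^sup>2)" using Q by (intro mult_mono) auto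
    then show "16 * 24 * (1 / Q ^ 4) \<le> 400 / Q\<^sup>2" by simp
    have "2 * D / (Q ^ 8 / 2) \<le> (13 / Q\<^sup>2)\<^sup>2"
    proof -
      have "2 * D / (Q ^ 8 / 2) \<le> 2 * (40 * Q ^ 3) / (Q ^ 8 / 2)"
        using D_le Q by (intro divide_right_mono) auto
      also have "\<dots> = 160 / Q ^ 5"
      proof -
        have cancel: "2 * (40 * b) / (a * b / 2) = 160 / a" if "b \<noteq> 0" for a b :: real
          using that by (simp add: field_simps)
        show ?thesis unfolding Q8(1) by (rule cancel) (use Q in simp)
      qed
      also have "\<dots> \<le> 160 / Q ^ 4"
        using Q power_increasing[of 4 5 Q] by (intro divide_left_mono) auto
      also have "\<dots> \<le> (13 / Q\<^sup>2)\<^sup>2" using Q by (simp add: power_divide divide_right_mono flip: power_mult)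
      finally show ?thesis .
    qed
    then have "sqrt (2 * D / (Q ^ 8 / 2)) \<le> 13 / Q\<^sup>2" using Q by (intro real_le_lsqrt) auto
    then have "24 * sqrt (2 * D / (Q ^ 8 / 2)) \<le> 24 * (13 / Q\<^sup>2)" by (intro mult_left_mono) auto
    also have "\<dots> \<le> 400 / Q\<^sup>2" using Q by (simp add: divide_right_mono)
    finally show "24 * sqrt (2 * D / (Q ^ 8 / 2)) \<le> 400 / Q\<^sup>2" .
    have "1 / Q ^ 3 \<le> 1 / Q\<^sup>2" using Q power_increasing[of 2 3 Q] by (intro divide_left_mono) auto
    moreover have "(1 - 1 / Q ^ 3) * (400 / Q\<^sup>2) \<le> 1 * (400 / Q\<^sup>2)" using Q by (intro mult_right_mono) auto
    ultimately show "1 / Q ^ 3 + (1 - 1 / Q ^ 3) * (400 / Q\<^sup>2) \<le> 401 / Q\<^sup>2" by simp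
    have "Q ^ 1 \<le> Q ^ 2" using Q by (intro power_increasing) auto
    then show "401 / Q\<^sup>2 \<le> 1" using Q by simp
    show "1 / Q + (1 - 1 / Q) / real q \<le> 2 / Q" using Q by (simp add: Q_def[symmetric] field_simps)
    show "2 / Q \<le> 1" using Q by simp
  qed (use k in auto)
  then show ?thesis by (simp add: Q_def mult.commute)
qed

text \<open>The comparison variable is nonzero so rarely that \<open>D\<close> is tiny against
  \<open>A = 2\<close>, a decay rate available for every \<open>m \<ge> 1\<close>. All constants are
  therefore independent of \<open>m\<close>.\<close>

lemma dep_prob_small:
  "\<exists>\<rho> \<eta> \<kappa> :: real. 0 < \<rho> \<and> \<rho> < 1 \<and> 0 < \<eta> \<and> 0 < \<kappa> \<and> \<kappa> < 1 \<and> (\<forall>m\<ge>1. \<forall>n k s. k < n \<longrightarrow> s \<le> k \<longrightarrow>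
     rowsp.dep_prob (iid_vec n (unif m)) k \<le> \<rho> ^ s / \<eta> + real (k choose s) * \<kappa> ^ (k - s))"
proof -
  \<comment> \<open>\<open>\<alpha> = 1 / 800\<close> gives
    \<open>16 * 24 * \<alpha> \<le> 1/2\<close>. The gap \<open>1 - \<delta>\<close> must then be
    smaller than about \<open>2 * \<alpha>\<^sup>2\<close> for
    \<open>\<epsilon>\<^sub>0 < 1\<close>, and it also makes \<open>D\<close> small enough for the
    square-root condition.\<close>
  define \<delta> :: real where "\<delta> = 1 - 1 / 10^6"
  define \<alpha> :: real where "\<alpha> = 1 / 800"
  define D :: real where "D = 40 * (1 - \<delta>) * (real 2)\<^sup>2 / \<delta>"
  define \<epsilon>\<^sub>0 where "\<epsilon>\<^sub>0 = exp (- 2 * \<alpha>\<^sup>2) / \<delta>"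
  interpret lazy_params \<delta> 2 by unfold_locales (auto simp: \<delta>_def)
  have \<epsilon>\<^sub>0: "0 < \<epsilon>\<^sub>0" "\<epsilon>\<^sub>0 < 1"
  proof -
    show "0 < \<epsilon>\<^sub>0" using \<delta> by (simp add: \<epsilon>\<^sub>0_def)
    have "exp (- (2 * \<alpha>\<^sup>2)) \<le> 1 / (1 + 2 * \<alpha>\<^sup>2)" by (intro exp_minus_le_inverse) auto
    also have "\<dots> < \<delta>" by (simp add: \<alpha>_def \<delta>_def power2_eq_square)
    finally show "\<epsilon>\<^sub>0 < 1" using \<delta> by (simp add: \<epsilon>\<^sub>0_def)
  qed
  have D: "D > 0" "D \<le> (13 / 1000)\<^sup>2" by (simp_all add: D_def \<delta>_def power2_eq_square)
  define \<epsilon> where "\<epsilon> = (1 + \<epsilon>\<^sub>0) / 2"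
  have \<epsilon>: "0 < \<epsilon>" "\<epsilon> < 1" using \<epsilon>\<^sub>0 by (auto simp: \<epsilon>_def)
  \<comment> \<open>With this choice \<open>\<epsilon> / (1 - \<eta>)\<close> equals
    \<open>2 * \<epsilon> / (1 + \<epsilon>)\<close>, which is still below 1.\<close>
  define \<eta> where "\<eta> = (1 - \<epsilon>) / 2"
  define \<rho> where "\<rho> = \<delta> + (1 - \<delta>) / real 2"
  have \<rho>: "0 < \<rho>" "\<rho> < 1" by (auto simp: \<rho>_def \<delta>_def)
  have cp: "charfun_pair (cosf (unif m)) (cosf (lazy \<delta> 2)) \<alpha> 2 D \<epsilon>\<^sub>0" if m: "m \<ge> 1" for m
  proof (rule charfun_pair_lazy[OF m _ _ D_def])
    show "4 * D \<le> 2" using D(2) by (simp add: power2_eq_square)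
    show "\<bar>cosf (unif m) t\<bar> \<le> \<epsilon>\<^sub>0 * \<delta>" if t: "\<alpha> \<le> \<bar>t\<bar>" "\<bar>t\<bar> \<le> 1 / 2" for t
    proof -
      \<comment> \<open>With exponent 2 the Gaussian bound is valid on all of
        \<open>\<bar>t\<bar> \<le> 1/2\<close>, since
        \<open>2 * (1/2)\<^sup>2 = 1/2\<close>.\<close>
      have "\<bar>cosf (unif m) t\<bar> \<le> exp (- 2 * t\<^sup>2)"
        by (rule cosf_unif_gaussian[OF m t(2)]) (use m in \<open>auto simp: power2_eq_square\<close>)
      also have "\<alpha>\<^sup>2 \<le> t\<^sup>2" using t(1) by (intro abs_le_square_iff[THEN iffD1]) (auto simp: \<alpha>_def)
      then have "exp (- 2 * t\<^sup>2) \<le> exp (- 2 * \<alpha>\<^sup>2)" by simp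
      finally show ?thesis using \<delta> by (simp add: \<epsilon>\<^sub>0_def)
    qed
  qed (use m \<epsilon>\<^sub>0 in \<open>auto simp: \<alpha>_def power2_eq_square\<close>)
  have main: "rowsp.dep_prob (iid_vec n (unif m)) k \<le> \<rho> ^ s / \<eta> + real (k choose s) * (\<epsilon> / (1 - \<eta>)) ^ (k - s)"
    if "m \<ge> 1" "k < n" "s \<le> k" for m n k s
  proof (rule dep_prob_lazy[OF cp[OF that(1)], where \<epsilon>\<^sub>1 = "1/2"])
    show "16 * 24 * \<alpha> \<le> 1 / 2" by (simp add: \<alpha>_def)
    have "sqrt (2 * D / 2) \<le> 13 / 1000" using D by (intro real_le_lsqrt) auto
    then show "24 * sqrt (2 * D / 2) \<le> 1 / 2" by simp
    show "\<epsilon>\<^sub>0 + (1 - \<epsilon>\<^sub>0) * (1 / 2) \<le> \<epsilon>" by (simp add: \<epsilon>_def field_simps)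
  qed (use that \<epsilon> \<rho> in \<open>auto simp: \<eta>_def \<rho>_def\<close>)
  show ?thesis
  proof (rule exI[of _ \<rho>], rule exI[of _ \<eta>], rule exI[of _ "\<epsilon> / (1 - \<eta>)"], intro conjI allI impI)
    show "0 < \<eta>" "0 < \<epsilon> / (1 - \<eta>)" "\<epsilon> / (1 - \<eta>) < 1" using \<epsilon> by (auto simp: \<eta>_def field_simps)
  qed (use main \<rho> in auto)
qed

text \<open>Indices \<open>k\<close> below \<open>n/2\<close> are handled directly. For the others
  \<open>s\<close> is a small fixed fraction of \<open>n\<close>: \<open>\<rho> ^ s\<close> still
  decays exponentially, while the binomial coefficient is beaten by
  \<open>\<kappa> ^ (k - s)\<close>.\<close>

lemma prob_singular_exponential:
  "\<exists>C \<theta> :: real. 0 < \<theta> \<and> \<theta> < 1 \<and> (\<forall>n. \<forall>m\<ge>1. prob_singular n m \<le> C * real n * \<theta> ^ n)"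
proof -
  obtain \<rho> \<eta> \<kappa> :: real where *: "0 < \<rho> \<and> \<rho> < 1 \<and> 0 < \<eta> \<and> 0 < \<kappa> \<and> \<kappa> < 1 \<and>
      (\<forall>m\<ge>1. \<forall>n k s. k < n \<longrightarrow> s \<le> k \<longrightarrow>
        rowsp.dep_prob (iid_vec n (unif m)) k \<le> \<rho> ^ s / \<eta> + real (k choose s) * \<kappa> ^ (k - s))"
    using dep_prob_small by (elim exE) (rule that)
  then have \<rho>: "0 < \<rho>" "\<rho> < 1" and \<eta>: "0 < \<eta>" and \<kappa>: "0 < \<kappa>" "\<kappa> < 1" by simp_all
  from * have dep: "rowsp.dep_prob (iid_vec n (unif m)) k \<le> \<rho> ^ s / \<eta> + real (k choose s) * \<kappa> ^ (k - s)"
    if "m \<ge> 1" "k < n" "s \<le> k" for m n k s using that by simp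
  have "\<kappa> powr (- (1/8)) > 1" using \<kappa> by (simp add: powr_def)
  \<comment> \<open>The binomial coefficient is bounded by \<open>(1 + x) ^ k / x ^ s\<close>. The
    choice of \<open>x\<close> limits the numerator to \<open>\<kappa> powr (- n / 8)\<close>, and
    \<open>\<gamma>\<close> is chosen so that dividing by \<open>(x * \<kappa>) ^ s\<close> costs at
    most another such factor; of \<open>\<kappa> ^ k\<close> with \<open>k \<ge> n / 2\<close> there
    remains \<open>\<kappa> powr (n / 4)\<close>.\<close>
  define x where "x = min (1/2) (\<kappa> powr (- (1/8)) - 1)"
  have x: "0 < x" "x < 1" "1 + x \<le> \<kappa> powr (- (1/8))" using \<open>\<kappa> powr (- (1/8)) > 1\<close> by (auto simp: x_def)
  have x\<kappa>: "0 < x * \<kappa>" "x * \<kappa> < 1"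
    using x \<kappa> mult_strict_mono[of x 1 \<kappa> 1] by auto
  have lnneg: "ln (x * \<kappa>) < 0" "ln \<kappa> < 0" using x\<kappa> \<kappa> by auto
  define \<gamma> where "\<gamma> = min (1/2) (ln \<kappa> / 8 / ln (x * \<kappa>))"
  have \<gamma>: "0 < \<gamma>" "\<gamma> \<le> 1/2" using lnneg by (auto simp: \<gamma>_def divide_neg_neg)
  have "\<gamma> \<le> ln \<kappa> / 8 / ln (x * \<kappa>)" by (simp add: \<gamma>_def)
  then have \<gamma>ln: "ln \<kappa> / 8 \<le> \<gamma> * ln (x * \<kappa>)" using lnneg by (simp add: neg_le_divide_eq)
  define \<theta> where "\<theta> = Max {\<rho> powr \<gamma>, \<kappa> powr (1/4), (1/3) powr (1/2)}"
  have \<theta>ge: "\<rho> powr \<gamma> \<le> \<theta>" "\<kappa> powr (1/4) \<le> \<theta>" "(1/3) powr (1/2) \<le> \<theta>" by (auto simp: \<theta>_def)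
  have "b powr c < 1" if "0 < b" "b < 1" "0 < c" for b c :: real
    using that by (simp add: powr_def mult_pos_neg)
  then have "\<rho> powr \<gamma> < 1" "\<kappa> powr (1/4) < 1" "(1/3) powr (1/2) < (1::real)"
    using \<rho> \<kappa> \<gamma> by simp_all
  then have \<theta>1: "\<theta> < 1" by (auto simp: \<theta>_def)
  have \<theta>0: "0 < \<theta>" using \<theta>ge(1) \<rho> by (smt (verit) powr_gt_zero)
  define C where "C = 1 / (\<rho> * \<eta>) + 1 + 1"
  have pn: "b powr (c * real n) \<le> \<theta> ^ n" if "0 < b" "b powr c \<le> \<theta>" for b c :: real and n
  proof -
    have "b powr (c * real n) = (b powr c) ^ n" using that by (simp add: powr_power mult.commute)
    also have "\<dots> \<le> \<theta> ^ n" using that by (intro power_mono) auto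
    finally show ?thesis .
  qed
  have bound: "rowsp.dep_prob (iid_vec n (unif m)) k \<le> C * \<theta> ^ n" if m: "m \<ge> 1" and k: "k < n" for n m k
  proof -
    have C1: "0 \<le> 1 / (\<rho> * \<eta>) * \<theta> ^ n" "0 \<le> \<theta> ^ n" using \<rho> \<eta> \<theta>0 by auto
    show ?thesis
    proof (cases "2 * k < n")
      case True
      have "rowsp.dep_prob (iid_vec n (unif m)) k \<le> (1/3) ^ (n - k)"
        using m k by (intro dep_prob_unif_direct) (auto simp: field_simps)
      also have "\<dots> = (1/3) powr (real (n - k))" by (simp add: powr_realpow)
      also have "\<dots> \<le> (1/3) powr (1/2 * real n)" using True by (intro powr_mono') auto
      also have "\<dots> \<le> \<theta> ^ n" using \<theta>ge(3) by (intro pn) auto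
      also have "\<dots> \<le> C * \<theta> ^ n" using C1 by (simp add: C_def algebra_simps)
      finally show ?thesis .
    next
      case False
      \<comment> \<open>Rounding down loses at most one factor \<open>\<rho>\<close>, which
        \<open>C\<close> absorbs through \<open>1 / (\<rho> * \<eta>)\<close>.\<close>
      define s where "s = nat \<lfloor>\<gamma> * real n\<rfloor>"
      have s: "real s \<le> \<gamma> * real n" "\<gamma> * real n - 1 \<le> real s"
        using \<gamma> by (auto simp: s_def)
      have "real s \<le> (1/2) * real n" using s(1) \<gamma> by (smt (verit) mult_right_mono of_nat_0_le_iff)
      then have sk: "s \<le> k" using False by linarith
      have "rowsp.dep_prob (iid_vec n (unif m)) k \<le> \<rho> ^ s / \<eta> + real (k choose s) * \<kappa> ^ (k - s)"
        by (rule dep[OF m k sk])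
      also have "\<rho> ^ s / \<eta> \<le> 1 / (\<rho> * \<eta>) * \<theta> ^ n"
      proof -
        have "\<rho> ^ s = \<rho> powr real s" using \<rho> by (simp add: powr_realpow)
        also have "\<dots> \<le> \<rho> powr (\<gamma> * real n - 1)" using s(2) \<rho> by (intro powr_mono') auto
        also have "\<dots> = \<rho> powr (\<gamma> * real n) / \<rho>" using \<rho> by (simp add: powr_diff)
        also have "\<dots> \<le> \<theta> ^ n / \<rho>" using pn[OF \<rho>(1) \<theta>ge(1)] \<rho> by (intro divide_right_mono) auto
        finally have "\<rho> ^ s / \<eta> \<le> \<theta> ^ n / \<rho> / \<eta>" using \<eta> by (intro divide_right_mono) auto
        then show ?thesis by (simp add: mult.commute)
      qed
      also have "real (k choose s) * \<kappa> ^ (k - s) \<le> \<theta> ^ n"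
      proof -
        have "real (k choose s) * x ^ s \<le> (\<Sum>i\<le>k. real (k choose i) * x ^ i * 1 ^ (k - i))"
          using member_le_sum[of s "{..k}" "\<lambda>i. real (k choose i) * x ^ i * 1 ^ (k - i)"] sk x by simp
        also have "\<dots> = (x + 1) ^ k" by (rule binomial_ring[symmetric])
        also have "\<dots> \<le> (x + 1) ^ n" using x k by (intro power_increasing) auto
        also have "\<dots> \<le> (\<kappa> powr (- (1/8))) ^ n" using x by (intro power_mono) auto
        also have "\<dots> = exp (- (ln \<kappa> / 8) * real n)" using \<kappa> by (simp add: powr_def flip: exp_of_nat_mult)
        finally have 1: "real (k choose s) * x ^ s \<le> exp (- (ln \<kappa> / 8) * real n)" .
        have pow: "y ^ i = exp (real i * ln y)" if "y > 0" for y :: real and i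
          using that by (simp add: exp_of_nat_mult)
        have "real (k choose s) * \<kappa> ^ (k - s) * (x * \<kappa>) ^ s = (real (k choose s) * x ^ s) * \<kappa> ^ k"
          using sk by (simp add: power_mult_distrib mult_ac flip: power_add)
        also have "\<dots> \<le> exp (- (ln \<kappa> / 8) * real n) * \<kappa> ^ k" using 1 \<kappa> by (intro mult_right_mono) auto
        also have "\<dots> = exp (- (ln \<kappa> / 8) * real n + real k * ln \<kappa>)" by (simp only: exp_add pow[OF \<kappa>(1)])
        finally have 2: "real (k choose s) * \<kappa> ^ (k - s) * exp (real s * ln (x * \<kappa>)) \<le> exp (- (ln \<kappa> / 8) * real n + real k * ln \<kappa>)"
          using pow[OF x\<kappa>(1), of s] by simp
        have "real (k choose s) * \<kappa> ^ (k - s) = real (k choose s) * \<kappa> ^ (k - s) * exp (real s * ln (x * \<kappa>)) * exp (- (real s * ln (x * \<kappa>)))"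
          by (simp add: mult.assoc flip: exp_add)
        also have "\<dots> \<le> exp (- (ln \<kappa> / 8) * real n + real k * ln \<kappa>) * exp (- (real s * ln (x * \<kappa>)))"
          using 2 by (intro mult_right_mono) auto
        also have "\<dots> = exp (- (ln \<kappa> / 8) * real n + real k * ln \<kappa> - real s * ln (x * \<kappa>))"
          by (simp only: diff_conv_add_uminus exp_add)
        also have "\<dots> \<le> exp (1/4 * real n * ln \<kappa>)"
        proof -
          have "real s * ln (x * \<kappa>) \<ge> (\<gamma> * real n) * ln (x * \<kappa>)"
            using s(1) lnneg by (intro mult_right_mono_neg) auto
          moreover have "(\<gamma> * ln (x * \<kappa>)) * real n \<ge> (ln \<kappa> / 8) * real n" using \<gamma>ln by (intro mult_right_mono) auto
          moreover have "real k * ln \<kappa> \<le> (1/2 * real n) * ln \<kappa>"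
            using False lnneg by (intro mult_right_mono_neg) auto
          ultimately show ?thesis by (simp add: algebra_simps)
        qed
        also have "\<dots> = \<kappa> powr (1/4 * real n)" using \<kappa> by (simp add: powr_def)
        also have "\<dots> \<le> \<theta> ^ n" by (rule pn[OF \<kappa>(1) \<theta>ge(2)])
        finally show ?thesis .
      qed
      finally show ?thesis using C1 by (simp add: C_def algebra_simps)
    qed
  qed
  have "prob_singular n m \<le> C * real n * \<theta> ^ n" if "m \<ge> 1" for n m
  proof -
    have "prob_singular n m \<le> (\<Sum>k<n. rowsp.dep_prob (iid_vec n (unif m)) k)" by (rule prob_singular_le_sum)
    also have "\<dots> \<le> (\<Sum>k<n. C * \<theta> ^ n)" using bound[OF that] by (intro sum_mono) auto
    finally show ?thesis by (simp add: mult_ac)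
  qed
  then show ?thesis using \<theta>0 \<theta>1 by blast
qed

text \<open>All powers of \<open>y = 802 / real q\<close> that occur have exponent at least
  \<open>n / 8\<close>, and \<open>real n * (2 + 2 ^ n) \<le> 8 ^ n\<close> moves the remaining
  factors into the base.\<close>

lemma prob_singular_large_entries:
  assumes q: "q \<ge> 802" "q ^ 8 \<le> m" and n: "n \<ge> 1"
  shows "prob_singular n m \<le> (8 ^ 8 * 802 / real q) powr (real n / 8)"
proof -
  define y where "y = 802 / real q"
  have y: "0 < y" "y \<le> 1" using q by (auto simp: y_def)
  define Y where "Y = y powr (real n / 8)"
  have powY: "y ^ i \<le> Y" if "real n / 8 \<le> real i" for i
    using that y unfolding Y_def by (simp add: powr_realpow[symmetric] powr_mono')
  have qq: "real q \<ge> 802" using q by simp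
  have "real q ^ 1 \<le> real q ^ 8" using qq by (intro power_increasing) auto
  then have qm: "real q \<le> real m" using q(2) by (metis of_nat_le_iff of_nat_power order_trans power_one_right)
  have direct: "rowsp.dep_prob (iid_vec n (unif m)) k \<le> y ^ (n - k)" if "k < n" for k
  proof (rule dep_prob_unif_direct)
    have "1 / (2 * real m + 1) \<le> 1 / real q" using qm qq by (intro divide_left_mono) auto
    also have "\<dots> \<le> y" unfolding y_def using qq by (intro divide_right_mono) auto
    finally show "1 / (2 * real m + 1) \<le> y" .
  qed (use that y in auto)
  have Ynn: "0 \<le> Y" by (simp add: Y_def)
  have each: "rowsp.dep_prob (iid_vec n (unif m)) k \<le> (2 + 2 ^ n) * Y" if k: "k < n" for k
  \<comment> \<open>For \<open>n < 8\<close> the direct bound suffices, as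
    \<open>n - k \<ge> 1 \<ge> n / 8\<close>; from \<open>n = 8\<close> on,
    \<open>s = n div 4\<close> satisfies \<open>n \<le> 8 * s\<close>.\<close>
  proof (cases "n < 8 \<or> 2 * k < n")
    case True
    have "rowsp.dep_prob (iid_vec n (unif m)) k \<le> y ^ (n - k)" by (rule direct[OF k])
    also have "\<dots> \<le> Y" using True k by (intro powY) auto
    also have "\<dots> \<le> (2 + 2 ^ n) * Y" using Ynn by (simp add: algebra_simps)
    finally show ?thesis .
  next
    case False
    define s where "s = n div 4"
    have s: "n \<le> 8 * s" "s \<le> k" "n \<le> 8 * (k - s)" using False by (auto simp: s_def)
    have "rowsp.dep_prob (iid_vec n (unif m)) k \<le> 2 * (2 / real q) ^ s + real (k choose s) * (802 / (real q)\<^sup>2) ^ (k - s)"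
      by (rule dep_prob_large[OF q k s(2)])
    also have "(2 / real q) ^ s \<le> y ^ s" unfolding y_def using qq by (intro power_mono divide_right_mono) auto
    also have "y ^ s \<le> Y" using s by (intro powY) auto
    also have "real (k choose s) * (802 / (real q)\<^sup>2) ^ (k - s) \<le> 2 ^ n * Y"
    proof (intro mult_mono)
      have "k choose s \<le> 2 ^ k" by (rule binomial_le_pow2)
      also have "\<dots> \<le> 2 ^ n" using k by simp
      finally show "real (k choose s) \<le> 2 ^ n" by (metis of_nat_le_iff of_nat_numeral of_nat_power)
      have "real q \<le> (real q)\<^sup>2" using qq by (simp add: power2_eq_square)
      then have "802 / (real q)\<^sup>2 \<le> y" unfolding y_def using qq by (intro divide_left_mono) auto
      then have "(802 / (real q)\<^sup>2) ^ (k - s) \<le> y ^ (k - s)" by (intro power_mono) auto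
      also have "\<dots> \<le> Y" using s by (intro powY) auto
      finally show "(802 / (real q)\<^sup>2) ^ (k - s) \<le> Y" .
    qed auto
    finally show ?thesis by (simp add: algebra_simps)
  qed
  have "prob_singular n m \<le> (\<Sum>k<n. rowsp.dep_prob (iid_vec n (unif m)) k)" by (rule prob_singular_le_sum)
  also have "\<dots> \<le> (\<Sum>k<n. (2 + 2 ^ n) * Y)" using each by (intro sum_mono) auto
  also have "\<dots> = (real n * (2 + 2 ^ n)) * Y" by simp
  also have "\<dots> \<le> 8 ^ n * Y"
  proof (intro mult_right_mono Ynn)
    have "real n \<le> 2 ^ n" using of_nat_less_two_power[of n, where 'a = real] by simp
    have "(2::real) ^ 1 \<le> 2 ^ n" using n by (intro power_increasing) auto
    have "real n * (2 + 2 ^ n) \<le> 2 ^ n * (2 * 2 ^ n)"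
      using \<open>real n \<le> 2 ^ n\<close> \<open>(2::real) ^ 1 \<le> 2 ^ n\<close> by (intro mult_mono) auto
    moreover have "(2::real) ^ n * (2 * 2 ^ n) \<le> 2 ^ n * (2 ^ n * 2 ^ n)"
      using \<open>(2::real) ^ 1 \<le> 2 ^ n\<close> by (intro mult_left_mono mult_right_mono) auto
    moreover have "(2::real) ^ n * (2 ^ n * 2 ^ n) = 8 ^ n" by (simp flip: power_mult_distrib)
    ultimately show "real n * (2 + 2 ^ n) \<le> 8 ^ n" by linarith
  qed
  also have "8 ^ n = (8 ^ 8) powr (real n / 8)"
  proof -
    have "((8::real) ^ 8) powr (real n / 8) = (8 powr 8) powr (real n / 8)" by (simp add: powr_numeral)
    also have "\<dots> = 8 powr real n" by (simp add: powr_powr)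
    finally show ?thesis by (simp add: powr_realpow)
  qed
  also have "(8 ^ 8) powr (real n / 8) * Y = (8 ^ 8 * 802 / real q) powr (real n / 8)"
    unfolding Y_def y_def by (subst powr_mult[symmetric]) (use qq in auto)
  finally show ?thesis .
qed

text \<open>Three ranges each give an exponent: \<open>m \<ge> M\<close> by a comparison variable of
  growing width, \<open>m \<le> M\<close> with large \<open>n\<close> by the exponential bound, and
  the remaining finitely many pairs by the maximum of probabilities below 1.\<close>

theorem theorem1:
  shows "\<exists>c::real > 0. \<forall>n m :: nat. n \<ge> 1 \<longrightarrow> m \<ge> 1 \<longrightarrow>
           prob_singular n m \<le> real m powr (- c * real n)"
proof -
  \<comment> \<open>The factor \<open>1604 = 2 * 802\<close> allows for
    \<open>real q \<ge> r\<^sup>2 / 2\<close>, and the 16th power in \<open>M\<close> makes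
    \<open>r \<ge> K\<close> for \<open>m \<ge> M\<close>.\<close>
  define K :: real where "K = 8 ^ 8 * 1604"
  define M where "M = nat \<lceil>K ^ 16\<rceil>"
  have K: "K \<ge> 2000" by (simp add: K_def)
  have MK: "real M \<ge> K ^ 16" by (simp add: M_def real_nat_ceiling_ge)
  have "K ^ 1 \<le> K ^ 16" using K by (intro power_increasing) auto
  then have M2: "real M \<ge> 2" using MK K by simp
  have large: "prob_singular n m \<le> real m powr (- (1/128) * real n)" if n: "n \<ge> 1" and m: "m \<ge> M" for n m
  proof -
    \<comment> \<open>The width \<open>q\<close> is about \<open>r\<^sup>2 = m powr (1/8)\<close>.
      The base is then at most \<open>K / r\<^sup>2 \<le> 1 / r\<close>, so one factor
      \<open>m powr (- (1/16))\<close> survives, and the exponent \<open>n / 8\<close> turns it into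
      1/128.\<close>
    define r where "r = real m powr (1/16)"
    have rm: "real m \<ge> K ^ 16" using MK m by linarith
    have "K = (K ^ 16) powr (1/16)"
    proof -
      have "K ^ 16 = K powr 16" using powr_realpow[of K 16] K by simp
      then have "(K ^ 16) powr (1/16) = K powr (16 * (1/16))" by (simp only: powr_powr)
      then show ?thesis using K by simp
    qed
    also have "\<dots> \<le> r" unfolding r_def using rm K by (intro powr_mono2) auto
    finally have rK: "K \<le> r" .
    have mpos: "real m > 0" using rm K by (smt (verit) zero_less_power)
    have r2: "r\<^sup>2 = real m powr (1/8)" unfolding r_def using mpos by (simp add: powr_power)
    have r16: "r ^ 16 = real m" unfolding r_def using mpos by (simp add: powr_power)
    define q where "q = nat \<lfloor>r\<^sup>2\<rfloor>"
    have q: "real q \<le> r\<^sup>2" "r\<^sup>2 - 1 \<le> real q" by (auto simp: q_def)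
    have rsq: "r * K \<le> r\<^sup>2" "K * K \<le> r * K" using rK K by (auto simp: power2_eq_square intro!: mult_mono)
    have KK: "K * 2000 \<le> K * K" using K by (intro mult_left_mono) auto
    have q2: "r\<^sup>2 / 2 \<le> real q" using q(2) rsq KK K by linarith
    then have q802: "q \<ge> 802" using rsq KK K by linarith
    have "real q ^ 8 \<le> (r\<^sup>2) ^ 8" using q(1) by (intro power_mono) auto
    also have "\<dots> = real m" using r16 by (simp flip: power_mult)
    finally have qm: "q ^ 8 \<le> m" by (metis of_nat_le_iff of_nat_power)
    have "8 ^ 8 * 802 / real q \<le> 8 ^ 8 * 802 / (r\<^sup>2 / 2)"
      using q2 rK K q802 by (intro divide_left_mono) auto
    also have "\<dots> = K / r\<^sup>2" by (simp add: K_def)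
    also have "\<dots> \<le> r / r\<^sup>2" using rK by (intro divide_right_mono) auto
    also have "\<dots> = real m powr (- (1/16))" using rK K by (simp add: r_def powr_minus_divide power2_eq_square)
    finally have "(8 ^ 8 * 802 / real q) powr (real n / 8) \<le> (real m powr (- (1/16))) powr (real n / 8)"
      by (intro powr_mono2) auto
    also have "\<dots> = real m powr (- (1/128) * real n)" by (simp add: powr_powr)
    finally show ?thesis using prob_singular_large_entries[OF q802 qm n] by linarith
  qed
  obtain C \<theta> :: real where \<theta>: "0 < \<theta>" "\<theta> < 1"
    and exp: "\<And>n m. m \<ge> 1 \<Longrightarrow> prob_singular n m \<le> C * real n * \<theta> ^ n"
    using prob_singular_exponential by blast
  \<comment> \<open>The decay \<open>\<theta> ^ n\<close> is split in two halves: one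
    \<open>\<sigma> ^ n\<close> absorbs \<open>C * n\<close>, the other becomes a power of
    \<open>M\<close>.\<close>
  define \<sigma> where "\<sigma> = sqrt \<theta>"
  have \<sigma>: "0 < \<sigma>" "\<sigma> < 1" "\<sigma> * \<sigma> = \<theta>" using \<theta> by (auto simp: \<sigma>_def)
  have "(\<lambda>n. C * (real n * \<sigma> ^ n)) \<longlonglongrightarrow> C * 0"
    by (intro tendsto_mult_left powser_times_n_limit_0) (use \<sigma> in auto)
  then have "\<forall>\<^sub>F n in sequentially. C * (real n * \<sigma> ^ n) < 1"
    by (intro order_tendstoD(2)) auto
  then obtain n0 where n0: "\<And>n. n \<ge> n0 \<Longrightarrow> C * (real n * \<sigma> ^ n) < 1"
    by (auto simp: eventually_sequentially)
  have lnM: "ln (real M) > 0" using M2 by simp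
  \<comment> \<open>Solves \<open>real M powr (- c1) = \<sigma>\<close>; replacing \<open>M\<close>
    by a smaller \<open>m\<close> only increases the power.\<close>
  define c1 where "c1 = - ln \<sigma> / ln (real M)"
  have c1: "c1 > 0" using \<sigma> lnM by (simp add: c1_def divide_neg_pos)
  have mid: "prob_singular n m \<le> real m powr (- c1 * real n)" if n: "n \<ge> n0" and m: "m \<ge> 1" "m \<le> M" for n m
  proof -
    have "prob_singular n m \<le> C * real n * \<theta> ^ n" by (rule exp[OF m(1)])
    also have "\<dots> = (C * (real n * \<sigma> ^ n)) * \<sigma> ^ n" by (simp add: power_mult_distrib flip: \<sigma>(3))
    also have "\<dots> \<le> 1 * \<sigma> ^ n" using n0[OF n] \<sigma> by (intro mult_right_mono) auto
    also have "\<dots> = exp (real n * ln \<sigma>)" using \<sigma> by (simp add: exp_of_nat_mult)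
    also have "\<dots> = real M powr (- c1 * real n)" using lnM M2 by (simp add: powr_def c1_def)
    also have "\<dots> \<le> real m powr (- c1 * real n)" using m c1 by (intro powr_mono2') auto
    finally show ?thesis .
  qed
  \<comment> \<open>The successor keeps \<open>N\<close> positive even for \<open>n0 = 0\<close>, as
    it occurs in the denominator of \<open>c2\<close>.\<close>
  define N where "N = real (Suc n0)"
  \<comment> \<open>The extra element 1/2 keeps the maximum positive, so that its logarithm can be
    used.\<close>
  define F where "F = insert (1/2) ((\<lambda>(n, m). prob_singular n m) ` ({..n0} \<times> {1..M}))"
  define \<omega> where "\<omega> = Max F"
  have finF: "finite F" by (simp add: F_def)
  have "1/2 \<in> F" by (simp add: F_def)
  then have "1/2 \<le> \<omega>" unfolding \<omega>_def by (rule Max_ge[OF finF])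
  moreover have "\<omega> < 1" unfolding \<omega>_def using finF
    by (auto simp: F_def prob_singular_less_1)
  ultimately have \<omega>: "1/2 \<le> \<omega>" "\<omega> < 1" by auto
  define c2 where "c2 = - ln \<omega> / (N * ln (real M))"
  have c2: "c2 > 0" using \<omega> lnM by (simp add: c2_def N_def divide_neg_pos)
  have few: "prob_singular n m \<le> real m powr (- c2 * real n)" if n: "n \<le> n0" and m: "m \<ge> 1" "m \<le> M" for n m
  proof -
    have "prob_singular n m \<in> F" using that by (auto simp: F_def)
    then have "prob_singular n m \<le> \<omega>" unfolding \<omega>_def using finF by simp
    also have "\<omega> = real M powr (- c2 * N)" using \<omega> lnM M2 by (simp add: powr_def c2_def N_def)
    also have "\<dots> \<le> real M powr (- c2 * real n)" using M2 c2 n by (intro powr_mono) (auto simp: N_def)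
    also have "\<dots> \<le> real m powr (- c2 * real n)" using m c2 by (intro powr_mono2') auto
    finally show ?thesis .
  qed
  define c where "c = min (1/128) (min c1 c2)"
  have weaken: "real m powr (- c' * real n) \<le> real m powr (- c * real n)" if "m \<ge> 1" "c \<le> c'" for c' n m
    using that by (intro powr_mono) (auto intro: mult_right_mono)
  show ?thesis
  proof (intro exI[of _ c] conjI allI impI)
    show "0 < c" using c1 c2 by (simp add: c_def)
    fix n m :: nat assume nm: "n \<ge> 1" "m \<ge> 1"
    consider "m \<ge> M" | "m \<le> M" "n \<ge> n0" | "m \<le> M" "n \<le> n0" by linarith
    then show "prob_singular n m \<le> real m powr (- c * real n)"
    proof cases
      case 1
      show ?thesis by (rule order_trans[OF large[OF nm(1) 1] weaken[OF nm(2)]]) (simp add: c_def)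
    next
      case 2
      show ?thesis by (rule order_trans[OF mid[OF 2(2) nm(2) 2(1)] weaken[OF nm(2)]]) (simp add: c_def)
    next
      case 3
      show ?thesis by (rule order_trans[OF few[OF 3(2) nm(2) 3(1)] weaken[OF nm(2)]]) (simp add: c_def)
    qed
  qed
qed

end
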